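(* Let $G = (G_x)_{x \in X}$ be a Borel field of Polish groups. Assume that every $G_x$ is locally compact. Up to multiplication by a Borel function $X \to (0,+\infty)$, there is a unique choice of left Haar measures $\lambda_x$ on $G_x$ such that for every Borel function $F : G \to [0,+\infty]$, the map $$X \to [0,+\infty] : x \mapsto \int_{G_x} F \, d\lambda_x$$ is Borel. (That is: such a family $(\lambda_x)_{x\in X}$ exists, and if $(\lambda'_x)_{x\in X}$ is another such family, there is a Borel function $r : X\to(0,+\infty)$ with $\lambda'_x=r(x)\lambda_x$ for all $x\in X$.)
   Context: Conventions. A standard Borel space is a measurable space isomorphic to a Borel subset of a Polish space. Product spaces carry the product $\sigma$-algebra and subsets the restricted $\sigma$-algebra. For a family of sets $V = (V_x)_{x\in X}$, the symbol $V$ also denotes the disjoint union of the $V_x$, and $\pi : V \to X$ is the map with $\pi(v) = x$ for $v \in V_x$. $V \times_\pi V = \{(v,w) \in V \times V \mid \pi(v)=\pi(w)\}$. A section is a map $\varphi : X \to V$ with $\varphi(x)\in V_x$ for all $x$. A sequence of Borel sections $\varphi_n : X \to V$ is dense if $\{\varphi_n(x) \mid n\in\mathbb{N}\}$ is dense in $V_x$ for every $x\in X$. A left Haar measure on a second countable locally compact group $L$ is a nonzero measure $\lambda$ on its Borel $\sigma$-algebra that is finite on compact sets and satisfies $\lambda(g A)=\lambda(A)$ for all $g\in L$ and Borel $A\subset L$; it is unique up to multiplication by a positive real number. A Borel field of Polish spaces consists of a standard Borel space $X$, a family $V=(V_x)_{x\in X}$ of Polish spaces and a standard Borel structure on $V$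 such that: (1) $\pi : V\to X$ is Borel; (2) there is a Borel map $d : V\times_\pi V\to[0,+\infty)$ whose restriction to each $V_x\times V_x$ is a separable complete metric inducing the topology of $V_x$; (3) there is a dense sequence of Borel sections $X\to V$. A Borel field of Polish groups is a family $G=(G_x)_{x\in X}$ of Polish groups over a standard Borel space $X$ with a standard Borel structure on $G$ such that $G$ is a Borel field of Polish spaces and the unit section $X\to G : x\mapsto e_x$, the inverse $G\to G$ and the multiplication $G\times_\pi G\to G$ are Borel. *)

theory Defs
  imports "HOL-Analysis.Analysis" "HOL-Algebra.Coset"
begin

(* In this theory a value of type measure that stands for a Borel space is used only through its
   space and sets. *)

definition borel_of :: "'a topology \<Rightarrow> 'a measure" where
  "borel_of T = sigma (topspace T) {U. openin T U}"

definition polish_topology :: "'a topology \<Rightarrow> bool" where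
  "polish_topology T \<longleftrightarrow> completely_metrizable_space T \<and> separable_space T"

definition borel_isomorphic :: "'a measure \<Rightarrow> 'b measure \<Rightarrow> bool" where
  "borel_isomorphic M N \<longleftrightarrow>
     (\<exists>f g. f \<in> M \<rightarrow>\<^sub>M N \<and> g \<in> N \<rightarrow>\<^sub>M M \<and>
        (\<forall>x\<in>space M. g (f x) = x) \<and> (\<forall>y\<in>space N. f (g y) = y))"

(* HOL does not quantify over types, so the Polish spaces range over all Polish topologies
   whose points are real numbers. Nothing is lost: a Polish space has at most continuum many
   points, hence is homeomorphic to one whose underlying set is a set of reals. The topology T is
   unrelated to the usual topology of the reals. *)
definition standard_borel :: "'a measure \<Rightarrow> bool" where
  "standard_borel M \<longleftrightarrow>
     (\<exists>(T :: real topology) B. polish_topology T \<and> B \<in> sets (borel_of T) \<and>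
        borel_isomorphic M (restrict_space (borel_of T) B))"

(* The total space of a family of subsets of 'v indexed by 'x is a set of pairs (x, v). *)
definition fibre_product :: "('x \<times> 'v) measure \<Rightarrow> (('x \<times> 'v) \<times> ('x \<times> 'v)) measure" where
  "fibre_product V = restrict_space (V \<Otimes>\<^sub>M V) {(v, w). fst v = fst w}"

(* T x is the topology of the fibre over x, whose underlying set is topspace (T x); V is the Borel
   structure of the total space. The last two assumptions are the existence of a Borel fibrewise
   metric and of a dense sequence of Borel sections. Metric_space asks for nonnegativity and symmetry
   on the whole type; this is no restriction, as the values of d outside the fibre product are
   irrelevant to its measurability. *)
locale borel_field_of_polish_spaces =
  fixes X :: "'x measure" and T :: "'x \<Rightarrow> 'v topology" and V :: "('x \<times> 'v) measure"
  assumes standard_borel_base: "standard_borel X"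
    and polish_fibre: "\<And>x. x \<in> space X \<Longrightarrow> polish_topology (T x)"
    and space_total: "space V = (SIGMA x:space X. topspace (T x))"
    and standard_borel_total: "standard_borel V"
    and proj_measurable: "fst \<in> V \<rightarrow>\<^sub>M X"
    and ex_borel_metric: "\<exists>d. d \<in> borel_measurable (fibre_product V) \<and>
          (\<forall>x\<in>space X.
             let Vx = topspace (T x); dx = (\<lambda>v w. d ((x, v), (x, w)) :: real)
             in Metric_space Vx dx \<and> Metric_space.mcomplete Vx dx \<and>
                separable_space (Metric_space.mtopology Vx dx) \<and>
                Metric_space.mtopology Vx dx = T x)"
    and ex_dense_sections: "\<exists>\<phi> :: nat \<Rightarrow> 'x \<Rightarrow> 'v.
          (\<forall>n. (\<lambda>x. (x, \<phi> n x)) \<in> X \<rightarrow>\<^sub>M V) \<and>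
          (\<forall>x\<in>space X. T x closure_of range (\<lambda>n. \<phi> n x) = topspace (T x))"

definition topological_group :: "'g monoid \<Rightarrow> 'g topology \<Rightarrow> bool" where
  "topological_group L T \<longleftrightarrow> group L \<and> topspace T = carrier L \<and>
     continuous_map (prod_topology T T) T (\<lambda>(g, h). g \<otimes>\<^bsub>L\<^esub> h) \<and>
     continuous_map T T (\<lambda>g. inv\<^bsub>L\<^esub> g)"

locale borel_field_of_polish_groups = borel_field_of_polish_spaces X T V
  for X :: "'x measure" and G :: "'x \<Rightarrow> 'g monoid" and T :: "'x \<Rightarrow> 'g topology"
    and V :: "('x \<times> 'g) measure" +
  assumes topological_group_fibre: "\<And>x. x \<in> space X \<Longrightarrow> topological_group (G x) (T x)"
    and unit_measurable: "(\<lambda>x. (x, \<one>\<^bsub>G x\<^esub>)) \<in> X \<rightarrow>\<^sub>M V"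
    and inverse_measurable: "(\<lambda>(x, g). (x, inv\<^bsub>G x\<^esub> g)) \<in> V \<rightarrow>\<^sub>M V"
    and mult_measurable:
      "(\<lambda>((x, g), (y, h)). (x, g \<otimes>\<^bsub>G x\<^esub> h)) \<in> fibre_product V \<rightarrow>\<^sub>M V"

definition left_haar_measure :: "'g monoid \<Rightarrow> 'g topology \<Rightarrow> 'g measure \<Rightarrow> bool" where
  "left_haar_measure L T \<mu> \<longleftrightarrow>
     sets \<mu> = sets (borel_of T) \<and>
     emeasure \<mu> (space \<mu>) \<noteq> 0 \<and>
     (\<forall>K. compactin T K \<longrightarrow> emeasure \<mu> K < \<infinity>) \<and>
     (\<forall>g\<in>carrier L. \<forall>A\<in>sets \<mu>. emeasure \<mu> (g <#\<^bsub>L\<^esub> A) = emeasure \<mu> A)"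

(* For a Borel field, x-slices of sets in V are Borel in the fibre over x, so the integrands below
   are measurable and nn_integral is the usual integral. *)
definition borel_haar_family ::
  "'x measure \<Rightarrow> ('x \<Rightarrow> 'g monoid) \<Rightarrow> ('x \<Rightarrow> 'g topology) \<Rightarrow> ('x \<times> 'g) measure \<Rightarrow>
   ('x \<Rightarrow> 'g measure) \<Rightarrow> bool" where
  "borel_haar_family X G T V \<mu> \<longleftrightarrow>
     (\<forall>x\<in>space X. left_haar_measure (G x) (T x) (\<mu> x)) \<and>
     (\<forall>F :: 'x \<times> 'g \<Rightarrow> ennreal. F \<in> borel_measurable V \<longrightarrow>
        (\<lambda>x. \<integral>\<^sup>+ g. F (x, g) \<partial>\<mu> x) \<in> borel_measurable X)"

end

theory Submission
  imports Defs
begin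

text \<open>The field enters through a fibrewise metric \<open>d\<close> and dense sections \<open>\<phi>\<^sub>n\<close>. In one group \<open>L\<close>, let
  \<open>P\<^sub>k A\<close> be the largest size of a finite \<open>S \<subseteq> A\<close> with \<open>d(1, a\<^sup>-\<^sup>1 b) > 1 / (k + 1)\<close> for distinct \<open>a, b \<in> S\<close>.
  A cluster point of the normalised set functions \<open>P\<^sub>k A / P\<^sub>k A\<^sub>0\<close> is a left invariant content, which
  Caratheodory's construction turns into a Haar measure. Contents are only determined up to
  boundary effects, but by uniqueness of Haar measures the upper limit of \<open>P\<^sub>k A / P\<^sub>k B\<close> lies between
  \<open>\<nu> A / \<nu> B'\<close> and \<open>\<nu> A' / \<nu> B\<close> whenever \<open>A, B\<close> are relatively compact in \<open>A', B'\<close>. Hence the ratios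
  \<open>\<nu> A / \<nu> B\<close> are iterated limits of packing ratios. The condition defining \<open>P\<^sub>k\<close> on an open set is open,
  so the points of \<open>S\<close> may be taken from the dense sections, and \<open>P\<^sub>k\<close> depends measurably on the fibre.
  Normalising on a measurably chosen relatively compact open set gives the Haar family on open sets \<open>{u > 0}\<close>;
  these generate the Borel structure of the total space by Blackwell's theorem, which also makes the
  slices of its Borel sets Borel.\<close>

text \<open>Choosing a Haar measure in every fibre says nothing about its dependence on the fibre,
  and neither does a cluster point of packing ratios: it comes from compactness of a product over
  all subsets, separately in each group. Uniqueness removes the choice. All cluster points yield the
  same measure up to a factor, so an upper limit, which is a countable operation and keeps
  measurability, can stand in for any of them. The quantity \<open>d(1, a^-1 b)\<close> is used in
  place of \<open>d(a, b)\<close> because it makes packing numbers left invariant without replacing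
  the given Borel metric by an invariant one. The Borel structure of the total space is given
  abstractly and not as one generated by open sets of the fibres. Measurability on the sets where
  some \<open>u\<close> is positive reaches all Borel functions only once these sets are known to
  generate. What can be checked by hand is that countably many of them separate points; in a
  standard Borel space this is enough.\<close>

subsection \<open>Lusin separation and countable generation of standard Borel structures\<close>

text \<open>A scheme presents \<open>C\<close> as a continuous image of a closed set of the sequences \<open>s\<close>: the value at \<open>s\<close>
  is the limit of any sequence in \<open>C\<close> that is eventually in each of the sets \<open>U j (s j)\<close>.\<close>

definition souslin_scheme :: "'a topology \<Rightarrow> 'a set \<Rightarrow> (nat \<Rightarrow> nat \<Rightarrow> 'a set) \<Rightarrow> bool" where
  "souslin_scheme T C U \<longleftrightarrow> (\<forall>k. C \<subseteq> (\<Union>i. U k i)) \<and>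
     (\<forall>s x. (\<forall>\<^sub>F k in sequentially. x k \<in> C) \<longrightarrow>
        (\<forall>j. \<forall>\<^sub>F k in sequentially. x k \<in> U j (s j)) \<longrightarrow>
        (\<exists>p\<in>C. limitin T x p sequentially))"

lemma souslin_schemeD:
  assumes "souslin_scheme T C U"
  shows souslin_scheme_cover: "C \<subseteq> (\<Union>i. U k i)"
    and souslin_scheme_limit: "\<lbrakk>\<forall>\<^sub>F k in sequentially. x k \<in> C;
       \<And>j. \<forall>\<^sub>F k in sequentially. x k \<in> U j (s j)\<rbrakk> \<Longrightarrow> \<exists>p\<in>C. limitin T x p sequentially"
  using assms unfolding souslin_scheme_def by blast+

lemma souslin_scheme_empty: "souslin_scheme T {} U"
  by (simp add: souslin_scheme_def)

text \<open>The sequence is total even if the space has no points, a case that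
  \<open>standard_borel\<close> allows; hence the condition on its range.\<close>

lemma (in Metric_space) separable_dense_sequence:
  assumes "separable_space mtopology"
  obtains q :: "nat \<Rightarrow> 'a" where "M \<noteq> {} \<Longrightarrow> range q \<subseteq> M"
     "\<And>x \<epsilon>. x \<in> M \<Longrightarrow> \<epsilon> > 0 \<Longrightarrow> \<exists>n. d (q n) x < \<epsilon>"
proof (cases "M = {}")
  case True
  then show ?thesis by (intro that) auto
next
  case False
  obtain D where D: "countable D" "D \<subseteq> M" "mtopology closure_of D = M"
    using assms unfolding separable_space_def by auto
  then have "D \<noteq> {}" using False by auto
  then have r: "range (from_nat_into D) = D" using D by (simp add: range_from_nat_into)
  have "\<exists>n. d (from_nat_into D n) x < \<epsilon>" if "x \<in> M" "\<epsilon> > 0" for x \<epsilon>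
  proof -
    have "x \<in> mtopology closure_of D" using D that by auto
    then obtain y where "y \<in> D" "y \<in> mball x \<epsilon>"
      using \<open>\<epsilon> > 0\<close> unfolding metric_closure_of by blast
    moreover obtain n where "y = from_nat_into D n" using r \<open>y \<in> D\<close> by (metis rangeE)
    ultimately show ?thesis by (auto simp: commute)
  qed
  then show ?thesis using r D by (intro that[of "from_nat_into D"]) auto
qed

text \<open>Level \<open>k\<close> consists of closed balls inside \<open>S\<close> of radius at
  most \<open>1 / Suc k\<close> around dense points; other indices give \<open>{}\<close>, where no
  sequence can settle. Shrinking radii make a sequence that settles in one ball per level Cauchy,
  and closedness of the ball chosen at level 0 keeps the limit in \<open>S\<close>, although
  \<open>S\<close> is only open.\<close>

lemma souslin_scheme_open:
  assumes "polish_topology T" "openin T S"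
  shows "\<exists>U. souslin_scheme T S U"
proof -
  obtain M d where "Metric_space M d" and c: "Metric_space.mcomplete M d"
    and T: "T = Metric_space.mtopology M d"
    using assms unfolding polish_topology_def completely_metrizable_space_def by auto
  interpret Metric_space M d by fact
  have sep: "separable_space mtopology" using assms T unfolding polish_topology_def by auto
  obtain q :: "nat \<Rightarrow> 'a" where q: "M \<noteq> {} \<Longrightarrow> range q \<subseteq> M"
     "\<And>x \<epsilon>. x \<in> M \<Longrightarrow> \<epsilon> > 0 \<Longrightarrow> \<exists>n. d (q n) x < \<epsilon>"
    using separable_dense_sequence[OF sep] by metis
  have SM: "S \<subseteq> M" using assms(2) T openin_subset by fastforce
  define U where "U k i = (case prod_decode i of (a, b) \<Rightarrow>
      if mcball (q a) (1 / Suc b) \<subseteq> S \<and> k \<le> b then mcball (q a) (1 / Suc b) else {})" for k i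
  have "souslin_scheme T S U" unfolding souslin_scheme_def
  proof (intro conjI allI impI subsetI)
    fix k x assume x: "x \<in> S"
    then obtain e where e: "e > 0" "mball x e \<subseteq> S"
      using assms(2) T openin_mtopology by blast
    obtain b0 where b0: "1 / Suc b0 < e / 2" using e
      by (metis half_gt_zero_iff nat_approx_posE of_nat_Suc)
    define b where "b = max b0 k"
    have "1 / Suc b \<le> 1 / Suc b0" unfolding b_def by (intro divide_left_mono) auto
    then have b: "1 / Suc b < e / 2" "k \<le> b" using b0 b_def by auto
    obtain a where a: "d (q a) x < 1 / Suc b" using q(2)[of x "1 / Suc b"] x SM by auto
    have qa: "q a \<in> M" using q(1) x SM by blast
    have "mcball (q a) (1 / Suc b) \<subseteq> mball x e"
    proof
      fix y assume y: "y \<in> mcball (q a) (1 / Suc b)"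
      have "d x y \<le> d x (q a) + d (q a) y" using y qa x SM by (intro triangle) auto
      then show "y \<in> mball x e" using y a b x SM by (auto simp: commute)
    qed
    then have "x \<in> U k (prod_encode (a, b))"
      unfolding U_def using e b a qa x SM by auto
    then show "x \<in> (\<Union>i. U k i)" by blast
  next
    fix s x assume xS: "\<forall>\<^sub>F k in sequentially. x k \<in> S"
      and xU: "\<forall>j. \<forall>\<^sub>F k in sequentially. x k \<in> U j (s j)"
    have U: "\<exists>a b. mcball (q a) (1 / Suc b) \<subseteq> S \<and> j \<le> b \<and> U j i = mcball (q a) (1 / Suc b)"
      if "U j i \<noteq> {}" for j i
      using that unfolding U_def by (auto split: prod.splits if_splits)
    have Une: "U j (s j) \<noteq> {}" for j
      using xU by (metis empty_iff eventually_False_sequentially eventually_mono)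
    from xS obtain N0 where N0: "\<And>k. k \<ge> N0 \<Longrightarrow> x k \<in> S" unfolding eventually_sequentially by auto
    define y where "y k = x (k + N0)" for k
    have yS: "y k \<in> S" for k by (simp add: y_def N0)
    have yU: "\<exists>N. \<forall>k\<ge>N. y k \<in> U j (s j)" for j
      using xU[rule_format, of j] unfolding eventually_sequentially y_def
      by (metis trans_le_add1)
    have "MCauchy y" unfolding MCauchy_def
    proof (intro conjI allI impI)
      show "range y \<subseteq> M" using yS SM by auto
      fix e :: real assume "e > 0"
      then obtain j where j: "1 / Suc j < e / 2"
        by (metis half_gt_zero_iff nat_approx_posE of_nat_Suc)
      obtain a b where ab: "j \<le> b" "U j (s j) = mcball (q a) (1 / Suc b)"
        using U[OF Une[of j]] by auto
      have "1 / Suc b \<le> 1 / Suc j" using ab by (intro divide_left_mono) auto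
      then have b: "1 / Suc b < e / 2" using j by auto
      obtain N where N: "\<And>k. k \<ge> N \<Longrightarrow> y k \<in> U j (s j)" using yU[of j] by auto
      show "\<exists>N. \<forall>n n'. N \<le> n \<longrightarrow> N \<le> n' \<longrightarrow> d (y n) (y n') < e"
      proof (intro exI[of _ N] allI impI)
        fix n n' assume n: "N \<le> n" "N \<le> n'"
        have m: "y n \<in> mcball (q a) (1 / Suc b)" "y n' \<in> mcball (q a) (1 / Suc b)"
          using N n ab by auto
        have "d (y n) (y n') \<le> d (y n) (q a) + d (q a) (y n')" using m by (intro triangle) auto
        then show "d (y n) (y n') < e" using m b by (auto simp: commute)
      qed
    qed
    then obtain p where p: "limitin mtopology y p sequentially"
      using c unfolding mcomplete_def by auto
    obtain a b where ab: "mcball (q a) (1 / Suc b) \<subseteq> S" "U 0 (s 0) = mcball (q a) (1 / Suc b)"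
      using U[OF Une[of 0]] by auto
    have "p \<in> mcball (q a) (1 / Suc b)"
      using ab yU[of 0] by (intro limitin_closedin[OF p]) (auto simp: eventually_sequentially)
    moreover have "limitin T x p sequentially"
      using p unfolding y_def T by (rule limitin_sequentially_offset_rev)
    ultimately show "\<exists>p\<in>S. limitin T x p sequentially" using ab by blast
  qed
  then show ?thesis by blast
qed

lemma souslin_scheme_closed:
  assumes U: "souslin_scheme T (topspace T) U" and "closedin T S"
  shows "souslin_scheme T S U"
  unfolding souslin_scheme_def
proof (intro conjI allI impI)
  have S: "S \<subseteq> topspace T" using assms(2) closedin_subset by auto
  then show "S \<subseteq> (\<Union>i. U k i)" for k using souslin_scheme_cover[OF U] by blast
  fix s x assume x: "\<forall>\<^sub>F k in sequentially. x k \<in> S" "\<forall>j. \<forall>\<^sub>F k in sequentially. x k \<in> U j (s j)"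
  have "\<forall>\<^sub>F k in sequentially. x k \<in> topspace T" using x(1) by eventually_elim (use S in auto)
  then obtain p where p: "limitin T x p sequentially"
    using souslin_scheme_limit[OF U, of x s] x by auto
  then show "\<exists>p\<in>S. limitin T x p sequentially"
    using limitin_closedin[OF p assms(2) x(1)] by auto
qed

section \<open>Countable intersections and disjoint unions of schemes\<close>

definition inter_scheme :: "(nat \<Rightarrow> nat \<Rightarrow> nat \<Rightarrow> 'a set) \<Rightarrow> nat \<Rightarrow> nat \<Rightarrow> 'a set" where
  "inter_scheme U k = (case prod_decode k of (n, j) \<Rightarrow> U n j)"

text \<open>A branch through the interleaved levels contains a branch through every
  \<open>U n\<close>, so it has a limit in every \<open>C n\<close>; the Hausdorff property makes
  these limits one point.\<close>

lemma souslin_scheme_Inter: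
  assumes U: "\<And>n. souslin_scheme T (C n) (U n)" and "Hausdorff_space T"
  shows "souslin_scheme T (\<Inter>n. C n) (inter_scheme U)"
  unfolding souslin_scheme_def
proof (intro conjI allI impI)
  show "(\<Inter>n. C n) \<subseteq> (\<Union>i. inter_scheme U k i)" for k
    using souslin_scheme_cover[OF U] unfolding inter_scheme_def by (force split: prod.splits)
  fix s x assume xC: "\<forall>\<^sub>F k in sequentially. x k \<in> (\<Inter>n. C n)"
    and xU: "\<forall>j. \<forall>\<^sub>F k in sequentially. x k \<in> inter_scheme U j (s j)"
  have "\<exists>p\<in>C n. limitin T x p sequentially" for n
  proof (rule souslin_scheme_limit[OF U, where s = "\<lambda>j. s (prod_encode (n, j))"])
    show "\<forall>\<^sub>F k in sequentially. x k \<in> C n" using xC by eventually_elim auto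
    show "\<forall>\<^sub>F k in sequentially. x k \<in> U n j (s (prod_encode (n, j)))" for j
      using xU[rule_format, of "prod_encode (n, j)"] by (simp add: inter_scheme_def)
  qed
  then show "\<exists>p\<in>\<Inter>n. C n. limitin T x p sequentially"
    using limitin_Hausdorff_unique[OF _ _ _ assms(2)] by (metis INT_I trivial_limit_sequentially)
qed

text \<open>Level 0 names the piece. Each later level carries its own guess \<open>n\<close>, cut
  down to \<open>C n\<close>, so that for disjoint \<open>C\<close> the guess has to agree with
  level 0 as soon as a sequence settles in both.\<close>

definition union_scheme :: "(nat \<Rightarrow> 'a set) \<Rightarrow> (nat \<Rightarrow> nat \<Rightarrow> nat \<Rightarrow> 'a set) \<Rightarrow> nat \<Rightarrow> nat \<Rightarrow> 'a set" where
  "union_scheme C U k i = (case k of 0 \<Rightarrow> C i | Suc k' \<Rightarrow>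
     (case prod_decode i of (n, j) \<Rightarrow> U n k' j \<inter> C n))"

text \<open>The limit is located in the piece named at level 0 and not merely in the union;
  \<open>souslin_scheme_refine\<close> relies on this.\<close>

lemma union_scheme_limit:
  assumes U: "\<And>n. souslin_scheme T (C n) (U n)" and disj: "disjoint_family C"
    and xU: "\<And>j. \<forall>\<^sub>F k in sequentially. x k \<in> union_scheme C U j (s j)"
  shows "(\<forall>\<^sub>F k in sequentially. x k \<in> C (s 0)) \<and> (\<exists>p\<in>C (s 0). limitin T x p sequentially)"
proof -
  have x0: "\<forall>\<^sub>F k in sequentially. x k \<in> C (s 0)"
    using xU[of 0] by (simp add: union_scheme_def)
  have "\<exists>p\<in>C (s 0). limitin T x p sequentially"
  proof (rule souslin_scheme_limit[OF U x0])
    fix j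
    obtain m i where mi: "prod_decode (s (Suc j)) = (m, i)" by fastforce
    have ev: "\<forall>\<^sub>F k in sequentially. x k \<in> U m j i \<inter> C m"
      using xU[of "Suc j"] by (simp add: union_scheme_def mi)
    obtain k where "x k \<in> C m \<and> x k \<in> C (s 0)"
      using eventually_happens'[OF sequentially_bot eventually_conj[OF ev x0]] by auto
    then have "m = s 0" using disj unfolding disjoint_family_on_def by blast
    then show "\<forall>\<^sub>F k in sequentially. x k \<in> U (s 0) j (snd (prod_decode (s (Suc j))))"
      using ev mi by (auto elim: eventually_mono)
  qed
  with x0 show ?thesis by blast
qed

lemma souslin_scheme_disjoint_Union:
  assumes U: "\<And>n. souslin_scheme T (C n) (U n)" and disj: "disjoint_family C"
  shows "souslin_scheme T (\<Union>n. C n) (union_scheme C U)"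
  unfolding souslin_scheme_def
proof (intro conjI allI impI subsetI)
  fix k x assume "x \<in> (\<Union>n. C n)"
  then obtain n where n: "x \<in> C n" by auto
  show "x \<in> (\<Union>i. union_scheme C U k i)"
  proof (cases k)
    case 0
    then show ?thesis using n by (auto simp: union_scheme_def)
  next
    case (Suc k')
    obtain j where "x \<in> U n k' j" using n souslin_scheme_cover[OF U, of n k'] by auto
    then have "x \<in> union_scheme C U k (prod_encode (n, j))" using n Suc by (simp add: union_scheme_def)
    then show ?thesis by blast
  qed
next
  fix s x assume "\<forall>j. \<forall>\<^sub>F k in sequentially. x k \<in> union_scheme C U j (s j)"
  then show "\<exists>p\<in>\<Union>n. C n. limitin T x p sequentially"
    using union_scheme_limit[OF U disj, of x s] by blast
qed

definition bisouslin :: "'a topology \<Rightarrow> 'a set \<Rightarrow> bool" where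
  "bisouslin T C \<longleftrightarrow> C \<subseteq> topspace T \<and> (\<exists>U. souslin_scheme T C U) \<and>
     (\<exists>U. souslin_scheme T (topspace T - C) U)"

lemma souslin_Inter:
  assumes "\<And>n::nat. \<exists>U. souslin_scheme T (C n) U" and "Hausdorff_space T"
  shows "\<exists>U. souslin_scheme T (\<Inter>n. C n) U"
  using assms(1) souslin_scheme_Inter[OF _ assms(2)] by metis

lemma polish_Hausdorff: "polish_topology T \<Longrightarrow> Hausdorff_space T"
  unfolding polish_topology_def
  using completely_metrizable_imp_metrizable_space metrizable_imp_Hausdorff_space by blast

text \<open>Complements are built into \<open>bisouslin\<close>, so only countable unions need work.
  The scheme of a union wants disjoint pieces, hence the passage to \<open>disjointed A\<close>,
  whose members are countable intersections of some \<open>A n\<close> with complements of earlier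
  sets.\<close>

lemma bisouslin_borel:
  assumes T: "polish_topology T" and "C \<in> sets (borel_of T)"
  shows "bisouslin T C"
proof -
  note H = polish_Hausdorff[OF T]
  have "{U. openin T U} \<subseteq> Pow (topspace T)" using openin_subset by auto
  then have "C \<in> sigma_sets (topspace T) {U. openin T U}"
    using assms(2) unfolding borel_of_def by simp
  then show ?thesis
  proof induction
    case (Basic S)
    then have o: "openin T S" by simp
    obtain U where "souslin_scheme T (topspace T) U" by (metis souslin_scheme_open[OF T openin_topspace])
    then have "souslin_scheme T (topspace T - S) U" using o by (rule souslin_scheme_closed[OF _ closedin_diff[OF closedin_topspace]])
    with souslin_scheme_open[OF T o] openin_subset[OF o] show ?case
      unfolding bisouslin_def by fast
  next
    case Empty
    then show ?case using souslin_scheme_open[OF T openin_topspace]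
      by (auto simp: bisouslin_def souslin_scheme_empty)
  next
    case (Compl a)
    then show ?case unfolding bisouslin_def by (simp add: double_diff)
  next
    case (Union A)
    have "\<exists>U. souslin_scheme T (disjointed A n) U" for n
    proof -
      have "disjointed A n = (\<Inter>m. if m < n then topspace T - A m else A n)" (is "_ = ?R")
      proof
        show "disjointed A n \<subseteq> ?R" using Union(2)[of n] by (auto simp: disjointed_def bisouslin_def)
        show "?R \<subseteq> disjointed A n"
        proof
          fix x assume x: "x \<in> ?R"
          have "x \<in> A n" using INT_D[OF x UNIV_I, of n] by simp
          moreover have "x \<notin> A m" if "m < n" for m
            using INT_D[OF x UNIV_I, of m] that by simp
          ultimately show "x \<in> disjointed A n" by (auto simp: disjointed_def)
        qed
      qed
      moreover have "\<exists>U. souslin_scheme T (if m < n then topspace T - A m else A n) U" for m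
        using Union(2) by (simp add: bisouslin_def)
      ultimately show ?thesis
        using souslin_Inter[OF _ H, of "\<lambda>m. if m < n then topspace T - A m else A n"] by simp
    qed
    then obtain U where "\<And>n. souslin_scheme T (disjointed A n) (U n)" by metis
    from souslin_scheme_disjoint_Union[OF this disjoint_family_disjointed]
    have un: "\<exists>U. souslin_scheme T (\<Union>n. A n) U"
      unfolding UN_disjointed_eq by (rule exI[of "souslin_scheme T (\<Union>n. A n)"])
    have int: "\<exists>U. souslin_scheme T (\<Inter>n. topspace T - A n) U"
      using Union(2) by (intro souslin_Inter[OF _ H]) (simp add: bisouslin_def)
    have eq: "topspace T - (\<Union>n. A n) = (\<Inter>n. topspace T - A n)" by auto
    have "(\<Union>n. A n) \<subseteq> topspace T"
      using Union(2) by (intro UN_least) (simp add: bisouslin_def)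
    then show ?case unfolding bisouslin_def eq by (intro conjI un int)
  qed
qed

text \<open>Each \<open>A n\<close> and its complement form a disjoint union whose scheme decides at
  level 0 which of the two a branch follows. Intersecting these schemes with that of
  \<open>C\<close> gives limits lying on the same side of every \<open>A n\<close> as the tails of
  the sequence, although \<open>A n\<close> need be neither open nor closed.\<close>

lemma souslin_scheme_refine:
  assumes C: "souslin_scheme T C U" "C \<subseteq> topspace T" and H: "Hausdorff_space T"
    and A: "\<And>n::nat. bisouslin T (A n)"
  obtains W :: "nat \<Rightarrow> nat \<Rightarrow> 'a set" where "\<And>k. C \<subseteq> (\<Union>i. W k i)"
    and "\<And>n. \<exists>j. \<forall>i. W j i \<subseteq> A n \<or> W j i \<inter> A n = {}"
    and "\<And>s x. \<lbrakk>\<forall>\<^sub>F k in sequentially. x k \<in> C; \<And>j. \<forall>\<^sub>F k in sequentially. x k \<in> W j (s j)\<rbrakk>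
       \<Longrightarrow> \<exists>p\<in>C. \<forall>n. \<forall>\<^sub>F k in sequentially. (x k \<in> A n \<longleftrightarrow> p \<in> A n)"
proof -
  \<comment> \<open>Families are indexed by all naturals, so the two pieces are padded with
    \<open>{}\<close>.\<close>
  define B where "B n i = (if i = 0 then A n else if i = 1 then topspace T - A n else {})" for n i :: nat
  have "\<exists>U. souslin_scheme T (B n i) U" for n i
    using A[of n] souslin_scheme_empty unfolding B_def bisouslin_def by auto
  then obtain UB where UB: "\<And>n i. souslin_scheme T (B n i) (UB n i)" by metis
  have disj: "disjoint_family (B n)" for n unfolding disjoint_family_on_def B_def by auto
  have BU: "(\<Union>i. B n i) = topspace T" for n
  proof
    show "(\<Union>i. B n i) \<subseteq> topspace T" using A[of n] by (auto simp: B_def bisouslin_def split: if_splits)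
    have "topspace T \<subseteq> B n 0 \<union> B n 1" unfolding B_def by auto
    then show "topspace T \<subseteq> (\<Union>i. B n i)" by blast
  qed
  define V where "V n = union_scheme (B n) (UB n)" for n
  have V: "souslin_scheme T (topspace T) (V n)" for n
    using souslin_scheme_disjoint_Union[OF UB disj, of n] unfolding BU V_def .
  \<comment> \<open>Number 0 is the scheme of \<open>C\<close>; the one that decides
    \<open>A n\<close> has number \<open>Suc n\<close>.\<close>
  define C' where "C' n = (case n of 0 \<Rightarrow> C | Suc _ \<Rightarrow> topspace T)" for n :: nat
  define U' where "U' n = (case n of 0 \<Rightarrow> U | Suc m \<Rightarrow> V m)" for n
  have "souslin_scheme T (C' n) (U' n)" for n
    unfolding C'_def U'_def using C V by (simp split: nat.split)
  then have W: "souslin_scheme T (\<Inter>n. C' n) (inter_scheme U')"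
    by (rule souslin_scheme_Inter[OF _ H])
  have CC: "(\<Inter>n. C' n) = C" using C(2) by (auto simp: C'_def split: nat.splits)
  show thesis
  proof (rule that)
    show "C \<subseteq> (\<Union>i. inter_scheme U' k i)" for k using souslin_scheme_cover[OF W] CC by simp
    show "\<exists>j. \<forall>i. inter_scheme U' j i \<subseteq> A n \<or> inter_scheme U' j i \<inter> A n = {}" for n
      by (intro exI[of _ "prod_encode (Suc n, 0)"])
        (auto simp: inter_scheme_def U'_def V_def union_scheme_def B_def)
    fix s x assume x: "\<forall>\<^sub>F k in sequentially. x k \<in> C"
       "\<And>j. \<forall>\<^sub>F k in sequentially. x k \<in> inter_scheme U' j (s j)"
    obtain p where p: "p \<in> C" "limitin T x p sequentially"
      using souslin_scheme_limit[OF W, of x s] x unfolding CC by auto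
    have "\<forall>\<^sub>F k in sequentially. (x k \<in> A n \<longleftrightarrow> p \<in> A n)" for n
    proof -
      define t where "t j = s (prod_encode (Suc n, j))" for j
      have "\<forall>\<^sub>F k in sequentially. x k \<in> union_scheme (B n) (UB n) j (t j)" for j
        using x(2)[of "prod_encode (Suc n, j)"] by (simp add: inter_scheme_def U'_def V_def t_def)
      from union_scheme_limit[OF UB disj this]
      have ev: "\<forall>\<^sub>F k in sequentially. x k \<in> B n (t 0)" and "\<exists>p\<in>B n (t 0). limitin T x p sequentially"
        by auto
      then have pB: "p \<in> B n (t 0)"
        using p limitin_Hausdorff_unique[OF _ _ _ H] by (metis trivial_limit_sequentially)
      show ?thesis using ev by eventually_elim (use pB in \<open>auto simp: B_def split: if_splits\<close>)
    qed
    then show "\<exists>p\<in>C. \<forall>n. \<forall>\<^sub>F k in sequentially. (x k \<in> A n \<longleftrightarrow> p \<in> A n)" using p by auto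
  qed
qed

section \<open>Separation by members of a prescribed sigma-algebra\<close>

definition separated_by :: "'a set set \<Rightarrow> 'a set \<Rightarrow> 'a set \<Rightarrow> bool" where
  "separated_by \<Sigma> C C' \<longleftrightarrow> (\<exists>D\<in>\<Sigma>. C \<subseteq> D \<and> C' \<inter> D = {})"

text \<open>Take the union over \<open>i\<close> of the intersections over \<open>j\<close> of sets
  separating \<open>X i\<close> from \<open>Y j\<close>. The contrapositive is what serves below: an
  inseparable pair has an inseparable pair of pieces.\<close>

lemma separated_by_Union:
  assumes "sigma_algebra \<Omega> \<Sigma>" and "\<And>(i::nat) (j::nat). separated_by \<Sigma> (X i) (Y j)"
    and "C \<subseteq> (\<Union>i. X i)" "C' \<subseteq> (\<Union>j. Y j)"
  shows "separated_by \<Sigma> C C'"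
proof -
  interpret sigma_algebra \<Omega> \<Sigma> by fact
  obtain D where D: "\<And>i j. D i j \<in> \<Sigma>" "\<And>i j. X i \<subseteq> D i j" "\<And>i j. Y j \<inter> D i j = {}"
    using assms(2) unfolding separated_by_def by metis
  have "(\<Inter>j. D i j) \<in> \<Sigma>" for i using D(1) by (intro countable_INT) auto
  then have "range (\<lambda>i. \<Inter>j. D i j) \<subseteq> \<Sigma>" by (rule image_subsetI)
  then have "(\<Union>i. \<Inter>j. D i j) \<in> \<Sigma>" by (rule countable_UN)
  moreover have "C \<subseteq> (\<Union>i. \<Inter>j. D i j)"
    by (rule order_trans[OF assms(3)]) (intro UN_mono INT_greatest; simp add: D(2))
  moreover have "C' \<inter> (\<Union>i. \<Inter>j. D i j) = {}"
  proof (rule equals0I)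
    fix x assume x: "x \<in> C' \<inter> (\<Union>i. \<Inter>j. D i j)"
    then obtain j where "x \<in> Y j" using assms(4) by auto
    moreover obtain i where "x \<in> D i j" using x by auto
    ultimately show False using D(3)[of j i] by auto
  qed
  ultimately show ?thesis unfolding separated_by_def by blast
qed

text \<open>Unlike in the classical theorem, the separating set must come from \<Sigma>, which
  contains the \<open>A n\<close> but perhaps no nontrivial open set. So the limits of a shrinking
  sequence of inseparable pairs are told apart by some \<open>A n\<close> instead of by disjoint
  neighbourhoods. The refined schemes put one late piece inside \<open>A n\<close> and the other
  outside, and then \<open>A n\<close> or its complement separates them.\<close>

theorem lusin_separation:
  assumes \<Sigma>: "sigma_algebra (topspace T) \<Sigma>" and H: "Hausdorff_space T"
    and A: "\<And>n::nat. bisouslin T (A n)" "\<And>n. A n \<in> \<Sigma>"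
    and C: "souslin_scheme T C U" "C \<subseteq> topspace T"
    and C': "souslin_scheme T C' U'" "C' \<subseteq> topspace T"
    and sep: "\<And>p p'. p \<in> C \<Longrightarrow> p' \<in> C' \<Longrightarrow> \<exists>n. p \<in> A n \<longleftrightarrow> p' \<notin> A n"
  shows "separated_by \<Sigma> C C'"
proof (rule ccontr)
  assume nsep: "\<not> separated_by \<Sigma> C C'"
  interpret sigma_algebra "topspace T" \<Sigma> by fact
  obtain W :: "nat \<Rightarrow> nat \<Rightarrow> 'a set" where W: "\<And>k. C \<subseteq> (\<Union>i. W k i)"
      "\<And>n. \<exists>j. \<forall>i. W j i \<subseteq> A n \<or> W j i \<inter> A n = {}"
      "\<And>s x. \<lbrakk>\<forall>\<^sub>F k in sequentially. x k \<in> C; \<And>j. \<forall>\<^sub>F k in sequentially. x k \<in> W j (s j)\<rbrakk>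
       \<Longrightarrow> \<exists>p\<in>C. \<forall>n. \<forall>\<^sub>F k in sequentially. (x k \<in> A n \<longleftrightarrow> p \<in> A n)"
    using souslin_scheme_refine[OF C H, of A] A(1) by metis
  obtain W' :: "nat \<Rightarrow> nat \<Rightarrow> 'a set" where W': "\<And>k. C' \<subseteq> (\<Union>i. W' k i)"
      "\<And>n. \<exists>j. \<forall>i. W' j i \<subseteq> A n \<or> W' j i \<inter> A n = {}"
      "\<And>s x. \<lbrakk>\<forall>\<^sub>F k in sequentially. x k \<in> C'; \<And>j. \<forall>\<^sub>F k in sequentially. x k \<in> W' j (s j)\<rbrakk>
       \<Longrightarrow> \<exists>p\<in>C'. \<forall>n. \<forall>\<^sub>F k in sequentially. (x k \<in> A n \<longleftrightarrow> p \<in> A n)"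
    using souslin_scheme_refine[OF C' H, of A] A(1) by metis
  define P where "P n Z \<longleftrightarrow> \<not> separated_by \<Sigma> (fst Z) (snd Z) \<and> fst Z \<subseteq> C \<and> snd Z \<subseteq> C'"
    for n :: nat and Z :: "'a set \<times> 'a set"
  define Q where "Q k Z Z' \<longleftrightarrow> (\<exists>i j. Z' = (fst Z \<inter> W k i, snd Z \<inter> W' k j))"
    for k and Z Z' :: "'a set \<times> 'a set"
  have "\<exists>f. \<forall>n. P n (f n) \<and> Q n (f n) (f (Suc n))"
  proof (rule dependent_nat_choice)
    show "\<exists>Z. P 0 Z" using nsep unfolding P_def by (intro exI[of _ "(C, C')"]) simp
    fix Z k assume Z: "P k Z"
    have "\<exists>i j. \<not> separated_by \<Sigma> (fst Z \<inter> W k i) (snd Z \<inter> W' k j)"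
    proof (rule ccontr)
      assume "\<nexists>i j. \<not> separated_by \<Sigma> (fst Z \<inter> W k i) (snd Z \<inter> W' k j)"
      then have "separated_by \<Sigma> (fst Z) (snd Z)"
        using W(1)[of k] W'(1)[of k] Z unfolding P_def
        by - (rule separated_by_Union[OF \<Sigma>, where X = "\<lambda>i. fst Z \<inter> W k i" and Y = "\<lambda>j. snd Z \<inter> W' k j"], auto)
      then show False using Z by (simp add: P_def)
    qed
    then show "\<exists>Z'. P (Suc k) Z' \<and> Q k Z Z'" using Z unfolding P_def Q_def by fastforce
  qed
  then obtain f where P: "\<And>n. P n (f n)" and "\<And>n. Q n (f n) (f (Suc n))" by blast
  then obtain s t where st: "\<And>n. f (Suc n) = (fst (f n) \<inter> W n (s n), snd (f n) \<inter> W' n (t n))"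
    unfolding Q_def by metis
  have dec: "fst (f m) \<subseteq> fst (f n) \<and> snd (f m) \<subseteq> snd (f n)" if "n \<le> m" for n m
    using that by (induction rule: dec_induct) (auto simp: st)
  have inW: "fst (f k) \<subseteq> W j (s j)" "snd (f k) \<subseteq> W' j (t j)" if "j < k" for j k
    using dec[of "Suc j" k] that st[of j] by auto
  \<comment> \<open>An empty set is separated from anything by \<open>{}\<close> or by the whole
    space, so inseparable pieces contain points to choose.\<close>
  have "fst (f k) \<noteq> {} \<and> snd (f k) \<noteq> {}" for k
  proof (rule ccontr)
    assume "\<not> (fst (f k) \<noteq> {} \<and> snd (f k) \<noteq> {})"
    then have "separated_by \<Sigma> (fst (f k)) (snd (f k))"
      using P[of k] C(2) unfolding separated_by_def P_def
      by (metis Int_empty_left Int_empty_right empty_sets empty_subsetI order_trans top)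
    then show False using P[of k] by (simp add: P_def)
  qed
  then have ne: "fst (f k) \<noteq> {}" "snd (f k) \<noteq> {}" for k by auto
  define x y where "x k = (SOME z. z \<in> fst (f k))" and "y k = (SOME z. z \<in> snd (f k))" for k
  have xy: "x k \<in> fst (f k)" "y k \<in> snd (f k)" for k
    unfolding x_def y_def using ne by (simp_all add: some_in_eq)
  have "\<exists>p\<in>C. \<forall>n. \<forall>\<^sub>F k in sequentially. (x k \<in> A n \<longleftrightarrow> p \<in> A n)"
  proof (rule W(3))
    show "\<forall>\<^sub>F k in sequentially. x k \<in> C" using xy(1) P by (intro always_eventually) (auto simp: P_def)
    show "\<forall>\<^sub>F k in sequentially. x k \<in> W j (s j)" for j
      using eventually_gt_at_top[of j] by eventually_elim (use xy(1) inW in blast)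
  qed
  then obtain p where p: "p \<in> C" "\<And>n. \<forall>\<^sub>F k in sequentially. (x k \<in> A n \<longleftrightarrow> p \<in> A n)" by auto
  have "\<exists>p\<in>C'. \<forall>n. \<forall>\<^sub>F k in sequentially. (y k \<in> A n \<longleftrightarrow> p \<in> A n)"
  proof (rule W'(3))
    show "\<forall>\<^sub>F k in sequentially. y k \<in> C'" using xy(2) P by (intro always_eventually) (auto simp: P_def)
    show "\<forall>\<^sub>F k in sequentially. y k \<in> W' j (t j)" for j
      using eventually_gt_at_top[of j] by eventually_elim (use xy(2) inW in blast)
  qed
  then obtain p' where p': "p' \<in> C'" "\<And>n. \<forall>\<^sub>F k in sequentially. (y k \<in> A n \<longleftrightarrow> p' \<in> A n)" by auto
  obtain n where n: "p \<in> A n \<longleftrightarrow> p' \<notin> A n" using sep p p' by blast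
  obtain j where j: "W j (s j) \<subseteq> A n \<or> W j (s j) \<inter> A n = {}" using W(2) by blast
  obtain j' where j': "W' j' (t j') \<subseteq> A n \<or> W' j' (t j') \<inter> A n = {}" using W'(2) by blast
  have "\<forall>\<^sub>F k in sequentially. (x k \<in> A n \<longleftrightarrow> p \<in> A n) \<and> (y k \<in> A n \<longleftrightarrow> p' \<in> A n) \<and> j < k \<and> j' < k"
    using p(2)[of n] p'(2)[of n] eventually_gt_at_top[of j] eventually_gt_at_top[of j']
    by eventually_elim auto
  then obtain k where k: "x k \<in> A n \<longleftrightarrow> p \<in> A n" "y k \<in> A n \<longleftrightarrow> p' \<in> A n" "j < k" "j' < k"
    using eventually_happens'[OF sequentially_bot] by blast
  have X: "if p \<in> A n then fst (f k) \<subseteq> A n else fst (f k) \<inter> A n = {}"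
    using inW(1)[OF k(3)] j xy(1)[of k] k(1) by auto
  have Y: "if p \<in> A n then snd (f k) \<inter> A n = {} else snd (f k) \<subseteq> A n"
    using inW(2)[OF k(4)] j' xy(2)[of k] k(2) n by auto
  have "separated_by \<Sigma> (fst (f k)) (snd (f k))"
  proof (cases "p \<in> A n")
    case True
    then show ?thesis using X Y A(2)[of n] unfolding separated_by_def by auto
  next
    case False
    then have "fst (f k) \<subseteq> topspace T - A n" "snd (f k) \<inter> (topspace T - A n) = {}"
      using X Y P[of k] C(2) by (auto simp: P_def)
    then show ?thesis using A(2)[of n] unfolding separated_by_def by blast
  qed
  then show False using P[of k] by (simp add: P_def)
qed

lemma borel_of_simps [simp]:
  "space (borel_of T) = topspace T" "openin T U \<Longrightarrow> U \<in> sets (borel_of T)"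
proof -
  have "{U. openin T U} \<subseteq> Pow (topspace T)" using openin_subset by auto
  then show "space (borel_of T) = topspace T" "openin T U \<Longrightarrow> U \<in> sets (borel_of T)"
    unfolding borel_of_def by (auto simp: sets_measure_of)
qed

lemma sets_borel_of: "sets (borel_of T) = sigma_sets (topspace T) {U. openin T U}"
proof -
  have "{U. openin T U} \<subseteq> Pow (topspace T)" using openin_subset by auto
  then show ?thesis unfolding borel_of_def by simp
qed

lemma borel_of_closed: "closedin T S \<Longrightarrow> S \<in> sets (borel_of T)"
  by (metis borel_of_simps closedin_def double_diff openin_subset order_refl sets.compl_sets)

text \<open>Blackwell's theorem; the points of a standard Borel space can be taken from a Borel subset
  of a Polish space, in which two complementary Borel sets are separated by Lusin's argument.\<close>

theorem standard_borel_countably_generated: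
  assumes "standard_borel M" and A: "\<And>n::nat. A n \<in> sets M"
    and sep: "\<And>x y. x \<in> space M \<Longrightarrow> y \<in> space M \<Longrightarrow> x \<noteq> y \<Longrightarrow> \<exists>n. x \<in> A n \<longleftrightarrow> y \<notin> A n"
  shows "sets M = sigma_sets (space M) (range A)"
proof
  obtain T :: "real topology" and B f g where T: "polish_topology T" and B: "B \<in> sets (borel_of T)"
    and f: "f \<in> M \<rightarrow>\<^sub>M restrict_space (borel_of T) B" and g: "g \<in> restrict_space (borel_of T) B \<rightarrow>\<^sub>M M"
    and fg: "\<forall>x\<in>space M. g (f x) = x"
      "\<forall>y\<in>space (restrict_space (borel_of T) B). f (g y) = y"
    using assms(1) unfolding standard_borel_def borel_isomorphic_def by blast
  have BT: "B \<subseteq> topspace T" using sets.sets_into_space[OF B] by simp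
  have spB: "space (restrict_space (borel_of T) B) = B" using BT by (simp add: space_restrict_space Int_absorb2)
  have fB: "f x \<in> B" if "x \<in> space M" for x using measurable_space[OF f that] spB by simp
  have gM: "g y \<in> space M" if "y \<in> B" for y using measurable_space[OF g, of y] that spB by simp
  have pull: "g -` S \<inter> B \<in> sets (borel_of T)" if "S \<in> sets M" for S
    using measurable_sets[OF g that] B BT unfolding spB
    by (auto simp: sets_restrict_space intro: sets.Int)
  show "sets M \<subseteq> sigma_sets (space M) (range A)"
  proof
    fix S assume S: "S \<in> sets M"
    \<comment> \<open>\<Sigma> collects the sets whose preimage under \<open>f\<close> is generated
      by the \<open>A n\<close>. Separating the images of \<open>S\<close> and of its complement by
      a member of \<Sigma> exhibits \<open>S\<close> itself as generated.\<close>
    define \<Sigma> where "\<Sigma> = {D. D \<subseteq> topspace T \<and> f -` D \<inter> space M \<in> sigma_sets (space M) (range A)}"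
    have rA: "range A \<subseteq> Pow (space M)" using A sets.sets_into_space by blast
    interpret G: sigma_algebra "space M" "sigma_sets (space M) (range A)"
      by (rule sigma_algebra_sigma_sets[OF rA])
    have \<Sigma>: "sigma_algebra (topspace T) \<Sigma>"
      unfolding sigma_algebra_iff2
    proof (intro conjI ballI allI impI)
      show "\<Sigma> \<subseteq> Pow (topspace T)" "{} \<in> \<Sigma>" by (auto simp: \<Sigma>_def)
      fix D assume D: "D \<in> \<Sigma>"
      have "f -` (topspace T - D) \<inter> space M = space M - (f -` D \<inter> space M)" using fB BT by auto
      then show "topspace T - D \<in> \<Sigma>" using D by (auto simp: \<Sigma>_def)
    next
      fix D :: "nat \<Rightarrow> real set" assume D: "range D \<subseteq> \<Sigma>"
      have "f -` (\<Union>i. D i) \<inter> space M = (\<Union>i. f -` D i \<inter> space M)" by auto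
      moreover have "(\<Union>i. f -` D i \<inter> space M) \<in> sigma_sets (space M) (range A)"
        using D by (intro G.countable_UN) (auto simp: \<Sigma>_def)
      ultimately show "(\<Union>i. D i) \<in> \<Sigma>" using D by (auto simp: \<Sigma>_def image_subset_iff)
    qed
    have pre: "f -` (g -` X \<inter> B) \<inter> space M = X" if "X \<in> sets M" for X
      using sets.sets_into_space[OF that] fB fg by auto
    have gA: "g -` A n \<inter> B \<in> \<Sigma>" "bisouslin T (g -` A n \<inter> B)" for n
      using pre[OF A[of n]] BT bisouslin_borel[OF T pull[OF A[of n]]] by (auto simp: \<Sigma>_def)
    obtain U U' where U: "souslin_scheme T (g -` S \<inter> B) U" and U': "souslin_scheme T (g -` (space M - S) \<inter> B) U'"
      using bisouslin_borel[OF T pull[OF S]] bisouslin_borel[OF T pull[OF sets.compl_sets[OF S]]]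
      unfolding bisouslin_def by metis
    have "separated_by \<Sigma> (g -` S \<inter> B) (g -` (space M - S) \<inter> B)"
    proof (rule lusin_separation[OF \<Sigma> polish_Hausdorff[OF T] gA(2,1) U _ U'])
      fix p p' assume p: "p \<in> g -` S \<inter> B" "p' \<in> g -` (space M - S) \<inter> B"
      then show "\<exists>n. p \<in> g -` A n \<inter> B \<longleftrightarrow> p' \<notin> g -` A n \<inter> B"
        using sep[of "g p" "g p'"] gM[of p] gM[of p'] by (metis Diff_iff IntD1 IntD2 IntI vimageE vimageI)
    qed (use BT in auto)
    then obtain D where D: "D \<in> \<Sigma>" "g -` S \<inter> B \<subseteq> D" "g -` (space M - S) \<inter> B \<inter> D = {}"
      unfolding separated_by_def by auto
    have "f -` D \<inter> space M = S"
    proof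
      show "f -` D \<inter> space M \<subseteq> S" using D(3) fB fg(1) by auto
      show "S \<subseteq> f -` D \<inter> space M"
      proof
        fix x assume "x \<in> S"
        moreover then have "x \<in> space M" using sets.sets_into_space[OF S] by auto
        ultimately show "x \<in> f -` D \<inter> space M" using D(2) fB fg(1) by auto
      qed
    qed
    then show "S \<in> sigma_sets (space M) (range A)" using D(1) by (simp add: \<Sigma>_def)
  qed
  show "sigma_sets (space M) (range A) \<subseteq> sets M" using A by (intro sets.sigma_sets_subset) auto
qed

text \<open>Preimages of small balls around dense points separate in either direction. The
  normalisation \<open>A 0 = space M\<close> supplies an index at which cutting down to a member of
  the sequence changes nothing.\<close>

lemma standard_borel_separating_sequence:
  assumes "standard_borel M"
  obtains A :: "nat \<Rightarrow> 'a set" where "range A \<subseteq> sets M" "A 0 = space M"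
    "\<And>x y. x \<in> space M \<Longrightarrow> y \<in> space M \<Longrightarrow> x \<noteq> y \<Longrightarrow> \<exists>n. x \<in> A n \<and> y \<notin> A n"
proof -
  obtain T :: "real topology" and B f g where T: "polish_topology T"
    and f: "f \<in> M \<rightarrow>\<^sub>M restrict_space (borel_of T) B"
    and fg: "\<forall>x\<in>space M. g (f x) = x"
    using assms(1) unfolding standard_borel_def borel_isomorphic_def by blast
  obtain X d where "Metric_space X d" and c: "Metric_space.mcomplete X d"
    and TX: "T = Metric_space.mtopology X d"
    using T unfolding polish_topology_def completely_metrizable_space_def by auto
  interpret Metric_space X d by fact
  have sep: "separable_space mtopology" using T TX unfolding polish_topology_def by auto
  obtain q :: "nat \<Rightarrow> real" where q: "X \<noteq> {} \<Longrightarrow> range q \<subseteq> X"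
     "\<And>x \<epsilon>. x \<in> X \<Longrightarrow> \<epsilon> > 0 \<Longrightarrow> \<exists>n. d (q n) x < \<epsilon>"
    using separable_dense_sequence[OF sep] by metis
  have fX: "f x \<in> X" if "x \<in> space M" for x
    using measurable_space[OF f that] TX by (auto simp: space_restrict_space)
  have fT: "f \<in> M \<rightarrow>\<^sub>M borel_of T" using f by (simp add: measurable_restrict_space2_iff)
  define A where "A n = (case n of 0 \<Rightarrow> space M | Suc m \<Rightarrow>
    (case prod_decode m of (a, b) \<Rightarrow> f -` mball (q a) (1 / Suc b) \<inter> space M))" for n
  show thesis
  proof (rule that[of A])
    show "range A \<subseteq> sets M"
      using measurable_sets[OF fT] TX by (auto simp: A_def split: nat.splits prod.splits)
    show "A 0 = space M" by (simp add: A_def)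
    fix x y assume xy: "x \<in> space M" "y \<in> space M" "x \<noteq> y"
    then have "f x \<noteq> f y" using fg by metis
    then have "d (f x) (f y) > 0" using fX xy by auto
    then obtain b where b: "1 / Suc b < d (f x) (f y) / 2"
      by (metis half_gt_zero_iff nat_approx_posE of_nat_Suc)
    obtain a where a: "d (q a) (f x) < 1 / Suc b" using q(2) fX xy by (metis of_nat_0_less_iff zero_less_Suc zero_less_divide_1_iff)
    have qa: "q a \<in> X" using q(1) fX xy by blast
    have "d (f x) (f y) \<le> d (f x) (q a) + d (q a) (f y)" using qa fX xy by (intro triangle) auto
    then have "x \<in> A (Suc (prod_encode (a, b))) \<and> y \<notin> A (Suc (prod_encode (a, b)))"
      using a b qa fX xy by (auto simp: A_def commute)
    then show "\<exists>n. x \<in> A n \<and> y \<notin> A n" by blast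
  qed
qed

lemma continuous_map_borel_measurable:
  assumes "continuous_map T T' f" shows "f \<in> borel_of T \<rightarrow>\<^sub>M borel_of T'"
proof (rule measurable_sigma_sets[where \<Omega> = "topspace T'" and A = "{U. openin T' U}"])
  show "f -` U \<inter> space (borel_of T) \<in> sets (borel_of T)" if "U \<in> {U. openin T' U}" for U
  proof -
    have "openin T {x \<in> topspace T. f x \<in> U}" using that assms by (auto intro: openin_continuous_map_preimage)
    moreover have "f -` U \<inter> space (borel_of T) = {x \<in> topspace T. f x \<in> U}" by auto
    ultimately show ?thesis by simp
  qed
  show "{U. openin T' U} \<subseteq> Pow (topspace T')" using openin_subset by auto
  show "f \<in> space (borel_of T) \<rightarrow> topspace T'" using assms by (simp add: continuous_map_def)
qed (rule sets_borel_of)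

subsection \<open>Packing numbers in a locally compact group\<close>

locale metric_group = Metric_space "carrier L" d + group L
  for L :: "'g monoid" (structure) and d :: "'g \<Rightarrow> 'g \<Rightarrow> real" +
  assumes mult_continuous: "continuous_map (prod_topology mtopology mtopology) mtopology (\<lambda>(g, h). g \<otimes> h)"
    and inv_continuous: "continuous_map mtopology mtopology (\<lambda>g. inv g)"
    and locally_compact: "locally_compact_space mtopology"
    and separable: "separable_space mtopology"
begin

abbreviation "G \<equiv> carrier L"

lemma translation_continuous: "g \<in> G \<Longrightarrow> continuous_map mtopology mtopology (\<lambda>h. g \<otimes> h)"
proof -
  assume "g \<in> G"
  then have "continuous_map mtopology (prod_topology mtopology mtopology) (\<lambda>h. (g, h))"
    by (intro continuous_map_pairedI) auto
  from continuous_map_compose[OF this mult_continuous] show ?thesis by (simp add: o_def)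
qed

lemma quotient_continuous:
  "continuous_map (prod_topology mtopology mtopology) mtopology (\<lambda>(g, h). inv g \<otimes> h)"
proof -
  have "continuous_map (prod_topology mtopology mtopology) (prod_topology mtopology mtopology) (\<lambda>z. (inv (fst z), snd z))"
    using continuous_map_compose[OF continuous_map_fst inv_continuous]
    by (intro continuous_map_pairedI) (auto simp: o_def continuous_map_snd)
  from continuous_map_compose[OF this mult_continuous] show ?thesis by (simp add: o_def split_beta')
qed

lemma l_coset_image: "g <# A = (\<lambda>h. g \<otimes> h) ` A"
  by (auto simp: l_coset_def)

lemma translation_homeomorphic:
  assumes "g \<in> G" shows "homeomorphic_map mtopology mtopology (\<lambda>h. g \<otimes> h)"
proof -
  have "homeomorphic_maps mtopology mtopology (\<lambda>h. g \<otimes> h) (\<lambda>h. inv g \<otimes> h)"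
    unfolding homeomorphic_maps_def using assms
    by (auto intro: translation_continuous simp: m_assoc[symmetric])
  then show ?thesis by (rule homeomorphic_maps_imp_map)
qed

lemma l_coset_subset: "g \<in> G \<Longrightarrow> A \<subseteq> G \<Longrightarrow> g <# A \<subseteq> G"
  by (auto simp: l_coset_image)

lemma open_l_coset: "g \<in> G \<Longrightarrow> openin mtopology A \<Longrightarrow> openin mtopology (g <# A)"
  using homeomorphic_map_openness[OF translation_homeomorphic, of g A] openin_subset[of mtopology A]
  by (simp add: l_coset_image)

lemma compact_l_coset: "g \<in> G \<Longrightarrow> compactin mtopology A \<Longrightarrow> compactin mtopology (g <# A)"
  by (simp add: l_coset_image image_compactin translation_continuous)

lemma l_coset_inv_cancel: "g \<in> G \<Longrightarrow> A \<subseteq> G \<Longrightarrow> inv g <# (g <# A) = A"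
  by (simp add: lcos_m_assoc lcos_mult_one)

lemma l_coset_eq_vimage:
  assumes "g \<in> G" "A \<subseteq> G" shows "g <# A = (\<lambda>h. inv g \<otimes> h) -` A \<inter> G"
proof
  show "g <# A \<subseteq> (\<lambda>h. inv g \<otimes> h) -` A \<inter> G"
    using assms by (auto simp: l_coset_image m_assoc[symmetric] subsetD)
  show "(\<lambda>h. inv g \<otimes> h) -` A \<inter> G \<subseteq> g <# A"
  proof
    fix h assume h: "h \<in> (\<lambda>h. inv g \<otimes> h) -` A \<inter> G"
    then have "h = g \<otimes> (inv g \<otimes> h)" using assms by (simp add: m_assoc[symmetric])
    then show "h \<in> g <# A" using h unfolding l_coset_image by blast
  qed
qed

section \<open>Packing numbers\<close>

definition precompact :: "'g set \<Rightarrow> bool" where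
  "precompact A \<longleftrightarrow> (\<exists>K. compactin mtopology K \<and> A \<subseteq> K)"

lemma precompact_subset: "precompact A \<Longrightarrow> A \<subseteq> G"
  unfolding precompact_def using compactin_subset_topspace by fastforce

text \<open>The metric is not assumed left invariant, but quotients \<open>inv a \<otimes> b\<close>
  are unchanged by left translation. Their distance from the unit need not be symmetric in
  \<open>a\<close> and \<open>b\<close>, so the condition runs over ordered pairs. Strictness makes
  it an open condition on the points.\<close>

definition packings :: "nat \<Rightarrow> 'g set \<Rightarrow> 'g set set" where
  "packings k A = {S. finite S \<and> S \<subseteq> A \<and> (\<forall>a\<in>S. \<forall>b\<in>S. a \<noteq> b \<longrightarrow> 1 / Suc k < d \<one> (inv a \<otimes> b))}"

definition packing :: "nat \<Rightarrow> 'g set \<Rightarrow> ennreal" where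
  "packing k A = (SUP S\<in>packings k A. of_nat (card S))"

lemma packing_upper: "S \<in> packings k A \<Longrightarrow> of_nat (card S) \<le> packing k A"
  unfolding packing_def by (rule SUP_upper)

lemma packing_least: "(\<And>S. S \<in> packings k A \<Longrightarrow> of_nat (card S) \<le> c) \<Longrightarrow> packing k A \<le> c"
  unfolding packing_def by (rule SUP_least)

lemma empty_in_packings: "{} \<in> packings k A"
  by (simp add: packings_def)

lemma packing_mono: "A \<subseteq> B \<Longrightarrow> packing k A \<le> packing k B"
  by (intro packing_least packing_upper) (auto simp: packings_def)

lemma packing_ge_1:
  assumes "A \<noteq> {}" shows "1 \<le> packing k A"
proof -
  obtain a where "a \<in> A" using assms by auto
  then have "{a} \<in> packings k A" by (auto simp: packings_def)
  from packing_upper[OF this] show ?thesis by simp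
qed

lemma packing_Un: "packing k (A \<union> B) \<le> packing k A + packing k B"
proof (rule packing_least)
  fix S assume S: "S \<in> packings k (A \<union> B)"
  have "S \<inter> A \<in> packings k A" "S - A \<in> packings k B" using S by (auto simp: packings_def)
  then have "of_nat (card (S \<inter> A)) + of_nat (card (S - A)) \<le> packing k A + packing k B"
    by (intro add_mono packing_upper)
  moreover have "card S = card (S \<inter> A) + card (S - A)"
    using S card_Int_Diff[of S A] by (simp add: packings_def)
  ultimately show "of_nat (card S) \<le> packing k A + packing k B" by simp
qed

text \<open>The union of a packing of \<open>A\<close> and one of \<open>B\<close> is again a
  packing, and the two are disjoint because the unit has distance 0 from itself. Both orders occur
  in the hypothesis since the quotient distance is not symmetric.\<close>

lemma packing_separated:
  assumes "A \<subseteq> G" "B \<subseteq> G"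
    and sep: "\<And>a b. a \<in> A \<Longrightarrow> b \<in> B \<Longrightarrow> 1 / Suc k < d \<one> (inv a \<otimes> b) \<and> 1 / Suc k < d \<one> (inv b \<otimes> a)"
  shows "packing k A + packing k B \<le> packing k (A \<union> B)"
proof -
  have ne: "packings k C \<noteq> {}" for C using empty_in_packings[of k C] by auto
  have "of_nat (card S) + of_nat (card S') \<le> packing k (A \<union> B)"
    if S: "S \<in> packings k A" and S': "S' \<in> packings k B" for S S'
  proof -
    have "a \<noteq> b" if "a \<in> S" "b \<in> S'" for a b
    proof
      assume "a = b"
      then have "1 / Suc k < d \<one> \<one>" using sep[of a a] that S S' assms by (force simp: packings_def)
      then show False using zero[of \<one> \<one>] divide_pos_pos[of 1 "Suc k"] by (simp add: not_less)
    qed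
    then have disj: "S \<inter> S' = {}" by blast
    have "S \<union> S' \<in> packings k (A \<union> B)"
      using S S' sep unfolding packings_def by (auto simp: subset_iff)
    from packing_upper[OF this] show ?thesis
      using S S' disj by (simp add: card_Un_disjoint packings_def)
  qed
  then have "of_nat (card S) + packing k B \<le> packing k (A \<union> B)" if "S \<in> packings k A" for S
    unfolding packing_def[of k B] ennreal_SUP_add_right[OF ne] using that by (intro SUP_least)
  then show ?thesis
    unfolding packing_def[of k A] ennreal_SUP_add_left[OF ne, symmetric] by (intro SUP_least)
qed

lemma packing_translate_le:
  assumes "g \<in> G" "A \<subseteq> G" shows "packing k A \<le> packing k (g <# A)"
proof (rule packing_least)
  fix S assume S: "S \<in> packings k A"
  then have SG: "S \<subseteq> G" using assms by (auto simp: packings_def)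
  have inj: "inj_on (\<lambda>h. g \<otimes> h) S" using assms SG by (intro inj_onI) (auto simp: subset_iff)
  have eq: "inv (g \<otimes> a) \<otimes> (g \<otimes> b) = inv a \<otimes> b" if "a \<in> G" "b \<in> G" for a b
  proof -
    have "inv (g \<otimes> a) \<otimes> (g \<otimes> b) = inv a \<otimes> (inv g \<otimes> (g \<otimes> b))"
      using that assms by (simp add: inv_mult_group m_assoc)
    also have "inv g \<otimes> (g \<otimes> b) = b" using that assms by (simp add: m_assoc[symmetric])
    finally show ?thesis .
  qed
  have "(\<lambda>h. g \<otimes> h) ` S \<in> packings k (g <# A)"
    using S SG eq unfolding packings_def l_coset_image by (auto simp: subset_iff)
  from packing_upper[OF this] show "of_nat (card S) \<le> packing k (g <# A)"
    by (simp add: card_image[OF inj])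
qed

lemma packing_translate: "g \<in> G \<Longrightarrow> A \<subseteq> G \<Longrightarrow> packing k (g <# A) = packing k A"
  using packing_translate_le[of g A k] packing_translate_le[of "inv g" "g <# A" k]
  by (intro antisym) (auto simp: l_coset_inv_cancel l_coset_subset)

lemma packing_cover:
  assumes "finite F" "F \<subseteq> G" "B \<subseteq> G" "A \<subseteq> (\<Union>g\<in>F. g <# B)"
  shows "packing k A \<le> of_nat (card F) * packing k B"
proof -
  have "packing k (\<Union>g\<in>F. g <# B) \<le> of_nat (card F) * packing k B"
    using assms(1,2)
  proof (induction F)
    case empty
    have "packing k {} \<le> 0" by (rule packing_least) (simp add: packings_def)
    then show ?case by simp
  next
    case (insert g F)
    have "packing k (\<Union>h\<in>insert g F. h <# B) \<le> packing k (g <# B) + packing k (\<Union>h\<in>F. h <# B)"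
      using packing_Un[of k "g <# B"] by simp
    also have "\<dots> \<le> packing k B + of_nat (card F) * packing k B"
      using insert assms(3) by (intro add_mono) (auto simp: packing_translate)
    finally show ?case using insert by (simp add: distrib_right)
  qed
  with packing_mono[OF assms(4)] show ?thesis by (rule order_trans)
qed

lemma precompact_cover:
  assumes "precompact A" "openin mtopology W" "W \<noteq> {}"
  shows "\<exists>F. finite F \<and> F \<subseteq> G \<and> A \<subseteq> (\<Union>g\<in>F. g <# W)"
proof -
  obtain K where K: "compactin mtopology K" "A \<subseteq> K" using assms(1) precompact_def by auto
  obtain w where w: "w \<in> W" using assms(3) by auto
  have wG: "w \<in> G" using w openin_subset[OF assms(2)] by auto
  have cov: "K \<subseteq> \<Union> ((\<lambda>g. g <# W) ` G)"
  proof
    fix x assume "x \<in> K"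
    then have x: "x \<in> G" using compactin_subset_topspace[OF K(1)] by auto
    have "x = (x \<otimes> inv w) \<otimes> w" using x wG by (simp add: m_assoc)
    then have "x \<in> (x \<otimes> inv w) <# W" using w unfolding l_coset_image by blast
    moreover have "x \<otimes> inv w \<in> G" using x wG by simp
    ultimately show "x \<in> \<Union> ((\<lambda>g. g <# W) ` G)" by (intro UN_I)
  qed
  have op: "openin mtopology U" if "U \<in> (\<lambda>g. g <# W) ` G" for U
    using that open_l_coset[OF _ assms(2)] by auto
  obtain \<F> where \<F>: "finite \<F>" "\<F> \<subseteq> (\<lambda>g. g <# W) ` G" "K \<subseteq> \<Union>\<F>"
    using compactinD[OF K(1) op cov] by auto
  obtain F where "F \<subseteq> G" "finite F" "\<F> = (\<lambda>g. g <# W) ` F"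
    using finite_subset_image[OF \<F>(1,2)] by auto
  then show ?thesis using \<F>(3) K(2) by (intro exI[of _ F]) auto
qed

lemma small_quotients:
  assumes "r > 0"
  obtains W where "openin mtopology W" "\<one> \<in> W" "\<And>a b. a \<in> W \<Longrightarrow> b \<in> W \<Longrightarrow> d \<one> (inv a \<otimes> b) < r"
proof -
  define Z where "Z = {z \<in> topspace (prod_topology mtopology mtopology). (\<lambda>(g, h). inv g \<otimes> h) z \<in> mball \<one> r}"
  have "openin (prod_topology mtopology mtopology) Z"
    unfolding Z_def by (rule openin_continuous_map_preimage[OF quotient_continuous openin_mball])
  moreover have "(\<one>, \<one>) \<in> Z" using assms by (simp add: Z_def)
  ultimately obtain U V where UV: "openin mtopology U" "openin mtopology V" "\<one> \<in> U" "\<one> \<in> V" "U \<times> V \<subseteq> Z"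
    unfolding openin_prod_topology_alt by meson
  show thesis
  proof (rule that[of "U \<inter> V"])
    fix a b assume "a \<in> U \<inter> V" "b \<in> U \<inter> V"
    then have "(a, b) \<in> Z" using UV(5) by blast
    then show "d \<one> (inv a \<otimes> b) < r" by (simp add: Z_def)
  qed (use UV in auto)
qed

text \<open>A neighbourhood of the unit with small quotients holds at most one point of any packing,
  and finitely many of its translates cover a precompact set.\<close>

lemma packing_finite:
  assumes "precompact A" shows "packing k A < \<infinity>"
proof -
  obtain W where W: "openin mtopology W" "\<one> \<in> W"
    "\<And>a b. a \<in> W \<Longrightarrow> b \<in> W \<Longrightarrow> d \<one> (inv a \<otimes> b) < 1 / Suc k"
    using small_quotients[of "1 / Suc k"] by auto
  have WG: "W \<subseteq> G" using openin_subset[OF W(1)] by auto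
  have "packing k W \<le> 1"
  proof (rule packing_least)
    fix S assume S: "S \<in> packings k W"
    have "a = b" if "a \<in> S" "b \<in> S" for a b
      using S that W(3)[of a b] unfolding packings_def by fastforce
    then have "card S \<le> 1" using S card_le_Suc0_iff_eq[of S] by (auto simp: packings_def)
    then show "of_nat (card S) \<le> (1::ennreal)" by (metis of_nat_1 of_nat_le_iff)
  qed
  obtain F where F: "finite F" "F \<subseteq> G" "A \<subseteq> (\<Union>g\<in>F. g <# W)"
    using precompact_cover[OF assms W(1)] W(2) by blast
  have "packing k A \<le> of_nat (card F) * packing k W" by (rule packing_cover[OF F(1,2) WG F(3)])
  also have "\<dots> \<le> of_nat (card F) * 1" by (intro mult_left_mono) (use \<open>packing k W \<le> 1\<close> in auto)
  also have "\<dots> < \<infinity>" by (simp add: of_nat_less_top)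
  finally show ?thesis .
qed

text \<open>The quotients \<open>inv a \<otimes> b\<close> form a compact set that misses the unit,
  hence misses a ball around it. In the limit of fine scales this turns
  \<open>packing_separated\<close> into additivity on sets inside disjoint compact sets.\<close>

lemma disjoint_compact_separated:
  assumes "compactin mtopology K" "compactin mtopology K'" "K \<inter> K' = {}"
  shows "\<forall>\<^sub>F k in sequentially. \<forall>a\<in>K. \<forall>b\<in>K'. 1 / Suc k < d \<one> (inv a \<otimes> b)"
proof -
  define Q where "Q = (\<lambda>(g, h). inv g \<otimes> h) ` (K \<times> K')"
  have KG: "K \<subseteq> G" "K' \<subseteq> G" using assms compactin_subset_topspace by fastforce+
  have "compactin mtopology Q"
    unfolding Q_def using assms by (intro image_compactin[OF _ quotient_continuous]) (simp add: compactin_Times)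
  then have cl: "closedin mtopology Q" by (rule compactin_imp_closedin[OF Hausdorff_space_mtopology])
  have "\<one> \<notin> Q"
  proof
    assume "\<one> \<in> Q"
    then obtain a b where ab: "a \<in> K" "b \<in> K'" "\<one> = inv a \<otimes> b" by (auto simp: Q_def)
    then have "a = b" using KG by (metis inv_equality inv_inv subsetD inv_closed)
    then show False using ab assms(3) by auto
  qed
  then have "\<one> \<in> topspace mtopology - Q" by simp
  moreover have "openin mtopology (topspace mtopology - Q)" using cl by blast
  ultimately obtain r where r: "r > 0" "mball \<one> r \<subseteq> topspace mtopology - Q"
    unfolding openin_mtopology by blast
  have far: "r \<le> d \<one> q" if "q \<in> Q" for q
  proof (rule ccontr)
    assume "\<not> r \<le> d \<one> q"
    then have "q \<in> mball \<one> r" using that closedin_subset[OF cl] by auto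
    then show False using r that by auto
  qed
  obtain N where N: "1 / Suc N < r" using r by (metis nat_approx_posE of_nat_Suc)
  show ?thesis
    using eventually_ge_at_top[of N]
  proof eventually_elim
    case (elim k)
    have "1 / Suc k \<le> 1 / Suc N" using elim by (intro divide_left_mono) auto
    then show ?case using far N by (fastforce simp: Q_def)
  qed
qed

section \<open>Compactly contained open sets\<close>

lemma compact_basis:
  assumes "openin mtopology U" "x \<in> U"
  obtains N K where "openin mtopology N" "compactin mtopology K" "x \<in> N" "N \<subseteq> K" "K \<subseteq> U"
proof -
  have "neighbourhood_base_of (compactin mtopology) mtopology"
    using locally_compact_space_neighbourhood_base Hausdorff_space_mtopology locally_compact by blast
  then show thesis using assms that unfolding neighbourhood_base_of by metis
qed

text \<open>Limits of packing ratios may misjudge boundaries, so they are compared with a measure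
  only across a pair of sets of which one compactly contains the other.\<close>

definition inner_sets :: "'g set \<Rightarrow> 'g set set" where
  "inner_sets U = {W. openin mtopology W \<and> (\<exists>K. compactin mtopology K \<and> W \<subseteq> K \<and> K \<subseteq> U)}"

lemma inner_setsI: "openin mtopology W \<Longrightarrow> compactin mtopology K \<Longrightarrow> W \<subseteq> K \<Longrightarrow> K \<subseteq> U \<Longrightarrow> W \<in> inner_sets U"
  unfolding inner_sets_def by auto

lemma inner_setsE:
  assumes "W \<in> inner_sets U"
  obtains K where "openin mtopology W" "compactin mtopology K" "W \<subseteq> K" "K \<subseteq> U"
  using assms unfolding inner_sets_def by auto

lemma inner_sets_precompact: "W \<in> inner_sets U \<Longrightarrow> precompact W"
  unfolding inner_sets_def precompact_def by auto

lemma inner_sets_mono: "U \<subseteq> U' \<Longrightarrow> inner_sets U \<subseteq> inner_sets U'"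
  unfolding inner_sets_def by blast

lemma inner_sets_l_coset:
  assumes "g \<in> G" "W \<in> inner_sets U" shows "g <# W \<in> inner_sets (g <# U)"
proof -
  obtain K where K: "openin mtopology W" "compactin mtopology K" "W \<subseteq> K" "K \<subseteq> U"
    using assms(2) by (rule inner_setsE)
  show ?thesis
    by (rule inner_setsI[OF open_l_coset[OF assms(1) K(1)] compact_l_coset[OF assms(1) K(2)]])
      (use K in \<open>auto simp: l_coset_image\<close>)
qed

lemma inner_sets_empty: "{} \<in> inner_sets U"
  by (rule inner_setsI[of _ "{}"]) auto

lemma inner_sets_UN_finite:
  assumes "finite I" "\<And>i. i \<in> I \<Longrightarrow> W i \<in> inner_sets U" shows "(\<Union>i\<in>I. W i) \<in> inner_sets U"
proof -
  have "\<forall>i\<in>I. \<exists>K. openin mtopology (W i) \<and> compactin mtopology K \<and> W i \<subseteq> K \<and> K \<subseteq> U"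
    using assms(2) unfolding inner_sets_def by auto
  then obtain K where K: "\<And>i. i \<in> I \<Longrightarrow> openin mtopology (W i) \<and> compactin mtopology (K i) \<and> W i \<subseteq> K i \<and> K i \<subseteq> U"
    by metis
  show ?thesis
    using assms(1) K by (intro inner_setsI[of _ "\<Union>i\<in>I. K i"] openin_Union compactin_Union) auto
qed

text \<open>Every point of the compact set around \<open>W\<close> has a neighbourhood compactly
  contained in a single \<open>U i\<close>. Finitely many of them cover, and \<open>W' i\<close>
  collects those assigned to \<open>i\<close>.\<close>

lemma inner_sets_split:
  assumes W: "W \<in> inner_sets (\<Union>i. U i)" and U: "\<And>i::nat. openin mtopology (U i)"
  obtains n W' where "\<And>i. W' i \<in> inner_sets (U i)" "W \<subseteq> (\<Union>i<n. W' i)"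
proof -
  obtain K where K: "openin mtopology W" "compactin mtopology K" "W \<subseteq> K" "K \<subseteq> (\<Union>i. U i)"
    using W by (rule inner_setsE)
  have "\<exists>i. \<exists>N\<in>inner_sets (U i). x \<in> N" if x: "x \<in> K" for x
  proof -
    obtain i where "x \<in> U i" using x K(4) by auto
    then obtain N C where "openin mtopology N" "compactin mtopology C" "x \<in> N" "N \<subseteq> C" "C \<subseteq> U i"
      using compact_basis[OF U] by metis
    then show ?thesis using inner_setsI by blast
  qed
  then obtain f N where fN: "\<And>x. x \<in> K \<Longrightarrow> N x \<in> inner_sets (U (f x)) \<and> x \<in> N x" by metis
  have "\<exists>\<F>. finite \<F> \<and> \<F> \<subseteq> N ` K \<and> K \<subseteq> \<Union>\<F>"
    using fN by (intro compactinD[OF K(2)]) (auto simp: inner_sets_def)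
  then obtain E where E: "finite E" "E \<subseteq> K" "K \<subseteq> \<Union> (N ` E)"
    by (metis finite_subset_image)
  define W' where "W' i = (\<Union>x\<in>{x\<in>E. f x = i}. N x)" for i
  have "W' i \<in> inner_sets (U i)" for i
    unfolding W'_def using E fN by (intro inner_sets_UN_finite) auto
  \<comment> \<open>If \<open>E\<close> is empty then so is \<open>W\<close>, and the unspecified
    value of \<open>Max\<close> does no harm.\<close>
  moreover have "W \<subseteq> (\<Union>i<Suc (Max (f ` E)). W' i)"
  proof
    fix x assume "x \<in> W"
    then obtain y where y: "y \<in> E" "x \<in> N y" using K(3) E(3) by auto
    then have "f y \<le> Max (f ` E)" using E(1) by auto
    then show "x \<in> (\<Union>i<Suc (Max (f ` E)). W' i)"
      using y by (auto simp: W'_def less_Suc_eq_le intro!: bexI[of _ "f y"])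
  qed
  ultimately show thesis by (rule that)
qed

lemma compact_in_open_precompact:
  assumes "compactin mtopology K"
  obtains U C where "openin mtopology U" "compactin mtopology C" "K \<subseteq> U" "U \<subseteq> C"
  using assms locally_compact locally_compact_space_compact_closed_compact[of mtopology]
    Hausdorff_space_mtopology by blast

end

section \<open>Contents as cluster points of packing ratios\<close>

text \<open>The functions into \<open>ennreal\<close> form a compact space by Tychonoff's theorem. A
  finer filter takes the place of a subsequence because convergence is wanted at all arguments at
  once, and these may be uncountably many.\<close>

lemma ennreal_cluster_point:
  fixes f :: "'c \<Rightarrow> 'b \<Rightarrow> ennreal"
  assumes "F \<noteq> bot"
  obtains F' l where "F' \<le> F" "F' \<noteq> bot" "\<And>A. ((\<lambda>k. f k A) \<longlongrightarrow> l A) F'"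
proof -
  have "compactin (product_topology (\<lambda>_::'b. euclidean :: ennreal topology) UNIV) (PiE UNIV (\<lambda>_. UNIV))"
    unfolding compactin_PiE using compact_UNIV by auto
  then have "compact (UNIV :: ('b \<Rightarrow> ennreal) set)"
    by (simp add: euclidean_product_topology)
  moreover have "filtermap f F \<noteq> bot" using assms by (simp add: filtermap_bot_iff)
  ultimately obtain l where l: "inf (nhds l) (filtermap f F) \<noteq> bot"
    unfolding compact_filter by auto
  define F' where "F' = inf F (filtercomap f (nhds l))"
  have "F' \<noteq> bot"
  proof
    assume "F' = bot"
    then have "eventually (\<lambda>_. False) F'" by simp
    then obtain P Q where PQ: "eventually P F" "eventually Q (filtercomap f (nhds l))" "\<And>k. P k \<Longrightarrow> Q k \<Longrightarrow> False"
      unfolding F'_def eventually_inf by auto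
    obtain R where R: "eventually R (nhds l)" "\<And>k. R (f k) \<Longrightarrow> Q k"
      using PQ(2) unfolding eventually_filtercomap by auto
    have "eventually (\<lambda>y. \<not> R y) (filtermap f F)"
      using PQ(1) unfolding eventually_filtermap by eventually_elim (use PQ(3) R(2) in blast)
    with R(1) have "eventually (\<lambda>_. False) (inf (nhds l) (filtermap f F))"
      unfolding eventually_inf by blast
    then show False using l by simp
  qed
  moreover have "(f \<longlongrightarrow> l) F'"
    unfolding filterlim_def F'_def
    by (meson filtermap_filtercomap filtermap_mono inf_le2 order_trans)
  then have "((\<lambda>k. f k A) \<longlongrightarrow> l A) F'" for A
    by (intro continuous_on_tendsto_compose[of UNIV "\<lambda>g. g A" f l F']) (auto intro: continuous_intros)
  ultimately show thesis by (intro that[of F' l]) (auto simp: F'_def)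
qed

text \<open>The function \<open>lam\<close> is monotone, finitely subadditive and left invariant,
  but it is shown to be additive only on sets inside disjoint compact sets. Regularising by
  \<open>lam_inner\<close> and \<open>outer\<close> turns it into a measure on Borel sets.\<close>

locale packing_content = metric_group L d for L :: "'g monoid" (structure) and d +
  fixes A0 :: "'g set" and F :: "nat filter" and lam :: "'g set \<Rightarrow> ennreal"
  assumes A0: "openin mtopology A0" "A0 \<noteq> {}" "precompact A0"
    and F: "F \<le> sequentially" "F \<noteq> bot"
    and lam: "\<And>A. ((\<lambda>k. packing k A / packing k A0) \<longlongrightarrow> lam A) F"
begin

lemma packing_A0: "packing k A0 \<noteq> 0" "packing k A0 \<noteq> \<infinity>"
  using packing_ge_1[OF A0(2), of k] packing_finite[OF A0(3), of k] by auto

lemma lam_mono: "A \<subseteq> B \<Longrightarrow> lam A \<le> lam B"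
  by (intro tendsto_le[OF F(2) lam lam] always_eventually allI divide_right_mono_ennreal packing_mono)

lemma lam_A0: "lam A0 = 1"
proof -
  have "packing k A0 / packing k A0 = 1" for k
    using packing_A0[of k] by (intro ennreal_divide_self) (auto simp: less_top)
  then have "((\<lambda>k. 1) \<longlongrightarrow> lam A0) F" using lam[of A0] by simp
  then show ?thesis using tendsto_unique[OF F(2)] tendsto_const by blast
qed

lemma lam_Un: "lam (A \<union> B) \<le> lam A + lam B"
  by (intro tendsto_le[OF F(2) tendsto_add[OF lam lam] lam] always_eventually allI)
    (simp add: add_divide_distrib_ennreal[symmetric] divide_right_mono_ennreal packing_Un)

lemma lam_empty: "lam {} = 0"
proof -
  have "packing k {} \<le> 0" for k by (rule packing_least) (simp add: packings_def)
  then have "((\<lambda>k. 0) \<longlongrightarrow> lam {}) F" using lam[of "{}"] by simp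
  then show ?thesis using tendsto_unique[OF F(2)] tendsto_const by blast
qed

lemma lam_UN: "lam (\<Union>i<n. W i) \<le> (\<Sum>i<n. lam (W i))" for n :: nat
proof (induction n)
  case (Suc n)
  have "lam (\<Union>i<Suc n. W i) \<le> lam (W n) + lam (\<Union>i<n. W i)"
    using lam_Un[of "W n"] by (simp add: lessThan_Suc)
  with Suc show ?case by (simp add: add.commute add_left_mono order_trans)
qed (simp add: lam_empty)

lemma lam_translate: "g \<in> G \<Longrightarrow> A \<subseteq> G \<Longrightarrow> lam (g <# A) = lam A"
  using lam[of "g <# A"] lam[of A] tendsto_unique[OF F(2)] by (simp add: packing_translate)

lemma lam_finite:
  assumes "precompact A" shows "lam A < \<infinity>"
proof -
  obtain E where E: "finite E" "E \<subseteq> G" "A \<subseteq> (\<Union>g\<in>E. g <# A0)"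
    using precompact_cover[OF assms A0(1,2)] by auto
  have "packing k A / packing k A0 \<le> of_nat (card E)" for k
  proof -
    have "packing k A / packing k A0 \<le> of_nat (card E) * packing k A0 / packing k A0"
      using packing_cover[OF E(1,2) precompact_subset[OF A0(3)] E(3)] by (rule divide_right_mono_ennreal)
    also have "\<dots> = of_nat (card E)"
      using packing_A0[of k] by (simp add: ennreal_times_divide[symmetric] ennreal_divide_self less_top)
    finally show ?thesis .
  qed
  then have "lam A \<le> of_nat (card E)"
    by (intro tendsto_upperbound[OF lam _ F(2)] always_eventually allI)
  then show ?thesis by (simp add: of_nat_less_top order_le_less_trans)
qed

lemma lam_separated:
  assumes K: "compactin mtopology K" "compactin mtopology K'" "K \<inter> K' = {}" and "A \<subseteq> K" "B \<subseteq> K'"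
  shows "lam A + lam B \<le> lam (A \<union> B)"
proof (rule tendsto_le[OF F(2) lam tendsto_add[OF lam lam]])
  have G: "A \<subseteq> G" "B \<subseteq> G" using assms compactin_subset_topspace by fastforce+
  have "\<forall>\<^sub>F k in sequentially. packing k A / packing k A0 + packing k B / packing k A0
      \<le> packing k (A \<union> B) / packing k A0"
    using disjoint_compact_separated[OF K] disjoint_compact_separated[OF K(2,1) K(3)[unfolded Int_commute[of K]]]
  proof eventually_elim
    case (elim k)
    have "packing k A + packing k B \<le> packing k (A \<union> B)"
      using elim assms(4,5) by (intro packing_separated[OF G]) blast
    then show ?case by (simp add: add_divide_distrib_ennreal[symmetric] divide_right_mono_ennreal)
  qed
  then show "\<forall>\<^sub>F k in F. packing k A / packing k A0 + packing k B / packing k A0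
      \<le> packing k (A \<union> B) / packing k A0"
    by (rule filter_leD[OF F(1)])
qed

definition lam_inner :: "'g set \<Rightarrow> ennreal" where
  "lam_inner U = (SUP W\<in>inner_sets U. lam W)"

lemma lam_inner_mono: "U \<subseteq> U' \<Longrightarrow> lam_inner U \<le> lam_inner U'"
  unfolding lam_inner_def by (rule SUP_subset_mono[OF inner_sets_mono]) auto

lemma lam_le_inner: "W \<in> inner_sets U \<Longrightarrow> lam W \<le> lam_inner U"
  unfolding lam_inner_def by (rule SUP_upper)

lemma lam_inner_le: "lam_inner U \<le> lam U"
  unfolding lam_inner_def by (rule SUP_least) (auto elim!: inner_setsE intro!: lam_mono)

text \<open>A set compactly contained in the union is covered by finitely many sets, each compactly
  contained in one \<open>U i\<close>, so finite subadditivity of \<open>lam\<close> suffices. This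
  is the gain from passing to \<open>lam_inner\<close>.\<close>

lemma lam_inner_UN:
  assumes "\<And>i::nat. openin mtopology (U i)"
  shows "lam_inner (\<Union>i. U i) \<le> (\<Sum>i. lam_inner (U i))"
  unfolding lam_inner_def[of "\<Union>i. U i"]
proof (rule SUP_least)
  fix W assume W: "W \<in> inner_sets (\<Union>i. U i)"
  obtain n W' where W': "\<And>i. W' i \<in> inner_sets (U i)" "W \<subseteq> (\<Union>i<n. W' i)"
    using inner_sets_split[OF W assms] by metis
  have "lam W \<le> (\<Sum>i<n. lam (W' i))" using lam_mono[OF W'(2)] lam_UN by (rule order_trans)
  also have "\<dots> \<le> (\<Sum>i<n. lam_inner (U i))" using W' by (intro sum_mono lam_le_inner)
  also have "\<dots> \<le> (\<Sum>i. lam_inner (U i))" by (intro sum_le_suminf) auto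
  finally show "lam W \<le> (\<Sum>i. lam_inner (U i))" .
qed

lemma lam_inner_translate_le:
  assumes "g \<in> G" "U \<subseteq> G" shows "lam_inner U \<le> lam_inner (g <# U)"
  unfolding lam_inner_def[of U]
proof (rule SUP_least)
  fix W assume W: "W \<in> inner_sets U"
  then have "lam W = lam (g <# W)"
    using assms lam_translate precompact_subset[OF inner_sets_precompact] by metis
  also have "\<dots> \<le> lam_inner (g <# U)" by (rule lam_le_inner[OF inner_sets_l_coset[OF assms(1) W]])
  finally show "lam W \<le> lam_inner (g <# U)" .
qed

section \<open>Caratheodory's construction\<close>

definition outer :: "'g set \<Rightarrow> ennreal" where
  "outer A = (INF U\<in>{U. openin mtopology U \<and> A \<subseteq> U}. lam_inner U)"

lemma outer_le: "openin mtopology U \<Longrightarrow> A \<subseteq> U \<Longrightarrow> outer A \<le> lam_inner U"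
  unfolding outer_def by (rule INF_lower) auto

lemma outer_open: "openin mtopology U \<Longrightarrow> outer U = lam_inner U"
  unfolding outer_def by (intro antisym INF_lower INF_greatest lam_inner_mono) auto

lemma outer_mono: "A \<subseteq> B \<Longrightarrow> outer A \<le> outer B"
  unfolding outer_def by (rule INF_superset_mono) auto

lemma outer_translate_le:
  assumes "g \<in> G" "A \<subseteq> G" shows "outer (g <# A) \<le> outer A"
  unfolding outer_def[of A]
proof (rule INF_greatest, clarify)
  fix U assume U: "openin mtopology U" "A \<subseteq> U"
  have UG: "U \<subseteq> G" using openin_subset[OF U(1)] by simp
  have "outer (g <# A) \<le> lam_inner (g <# U)"
    using U open_l_coset[OF assms(1) U(1)] by (intro outer_le) (auto simp: l_coset_image)
  also have "\<dots> \<le> lam_inner U"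
    using lam_inner_translate_le[of "inv g" "g <# U"] assms UG by (simp add: l_coset_inv_cancel l_coset_subset)
  finally show "outer (g <# A) \<le> lam_inner U" .
qed

lemma outer_translate: "g \<in> G \<Longrightarrow> A \<subseteq> G \<Longrightarrow> outer (g <# A) = outer A"
  using outer_translate_le[of g A] outer_translate_le[of "inv g" "g <# A"]
  by (intro antisym) (auto simp: l_coset_inv_cancel l_coset_subset)

lemma outer_countably_subadditive: "outer (\<Union>i. A i) \<le> (\<Sum>i. outer (A i))" for A :: "nat \<Rightarrow> 'g set"
proof (cases "(\<Sum>i. outer (A i)) = \<infinity>")
  case False
  then have fin: "outer (A i) \<noteq> \<infinity>" for i
    using sum_le_suminf[of "\<lambda>i. outer (A i)" "{i}"] by (auto simp: top_unique)
  show ?thesis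
  proof (rule ennreal_le_epsilon)
    fix e :: real assume "0 < e"
    have "\<exists>U. openin mtopology U \<and> A i \<subseteq> U \<and> lam_inner U \<le> outer (A i) + ennreal (e * (1/2) ^ Suc i)" for i
    proof -
      define c where "c = outer (A i) + ennreal (e * (1/2) ^ Suc i)"
      have "outer (A i) < c"
        using fin[of i] \<open>0 < e\<close> unfolding c_def
        by (cases "outer (A i)") (simp_all add: ennreal_plus[symmetric] ennreal_less_iff del: ennreal_plus)
      then obtain U where "openin mtopology U" "A i \<subseteq> U" "lam_inner U < c"
        unfolding outer_def INF_less_iff by auto
      then show ?thesis unfolding c_def[symmetric] by (intro exI[of _ U]) simp
    qed
    then obtain U where U: "\<And>i. openin mtopology (U i)" "\<And>i. A i \<subseteq> U i"
      "\<And>i. lam_inner (U i) \<le> outer (A i) + ennreal (e * (1/2) ^ Suc i)" by metis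
    have "outer (\<Union>i. A i) \<le> lam_inner (\<Union>i. U i)" using U by (intro outer_le openin_Union) auto
    also have "\<dots> \<le> (\<Sum>i. lam_inner (U i))" by (rule lam_inner_UN[OF U(1)])
    also have "\<dots> \<le> (\<Sum>i. outer (A i) + ennreal (e * (1/2) ^ Suc i))" using U(3) by (intro suminf_le) auto
    also have "\<dots> = (\<Sum>i. outer (A i)) + (\<Sum>i. ennreal (e * (1/2) ^ Suc i))" by (intro suminf_add[symmetric]) auto
    also have "(\<Sum>i. ennreal (e * (1/2) ^ Suc i)) = ennreal e"
    proof (rule suminf_ennreal_eq)
      show "(\<lambda>i. e * (1/2) ^ Suc i) sums e" using sums_mult[OF power_half_series, of e] by simp
    qed (use \<open>0 < e\<close> in auto)
    finally show "outer (\<Union>i. A i) \<le> (\<Sum>i. outer (A i)) + ennreal e" .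
  qed
qed simp

text \<open>Let \<open>W\<close> be compactly contained in \<open>U \<inter> E\<close>, with
  \<open>K\<close> the compact set in between. The open set \<open>U - K\<close> still contains
  \<open>A - E\<close>, and whatever is compactly contained in it lies in a compact set disjoint
  from \<open>K\<close>, so \<open>lam_separated\<close> applies.\<close>

lemma outer_splits_open:
  assumes E: "openin mtopology E"
  shows "outer (A \<inter> E) + outer (A - E) \<le> outer A"
  unfolding outer_def[of A]
proof (rule INF_greatest, clarify)
  fix U assume U: "openin mtopology U" "A \<subseteq> U"
  have ne: "inner_sets X \<noteq> {}" for X using inner_sets_empty by blast
  have "lam W + outer (A - E) \<le> lam_inner U" if W: "W \<in> inner_sets (U \<inter> E)" for W
  proof -
    obtain K where K: "openin mtopology W" "compactin mtopology K" "W \<subseteq> K" "K \<subseteq> U \<inter> E"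
      using W by (rule inner_setsE)
    have "openin mtopology (U - K)"
      using U(1) compactin_imp_closedin[OF Hausdorff_space_mtopology K(2)] by (rule openin_diff)
    then have "outer (A - E) \<le> lam_inner (U - K)" using U(2) K(4) by (intro outer_le) auto
    then have "lam W + outer (A - E) \<le> lam W + lam_inner (U - K)" by (rule add_left_mono)
    also have "\<dots> = (SUP W'\<in>inner_sets (U - K). lam W + lam W')"
      unfolding lam_inner_def by (rule ennreal_SUP_add_right[OF ne])
    also have "\<dots> \<le> lam_inner U"
    proof (rule SUP_least)
      fix W' assume "W' \<in> inner_sets (U - K)"
      then obtain K' where K': "openin mtopology W'" "compactin mtopology K'" "W' \<subseteq> K'" "K' \<subseteq> U - K"
        by (rule inner_setsE)
      have "lam W + lam W' \<le> lam (W \<union> W')" using K K' by (intro lam_separated[of K K']) auto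
      also have "\<dots> \<le> lam_inner U"
        using K K' by (intro lam_le_inner inner_setsI[of _ "K \<union> K'"]) (auto intro: compactin_Un)
      finally show "lam W + lam W' \<le> lam_inner U" .
    qed
    finally show ?thesis .
  qed
  then have "lam_inner (U \<inter> E) + outer (A - E) \<le> lam_inner U"
    unfolding lam_inner_def[of "U \<inter> E"] ennreal_SUP_add_left[OF ne, symmetric] by (rule SUP_least)
  moreover have "outer (A \<inter> E) \<le> lam_inner (U \<inter> E)" using U E by (intro outer_le) auto
  ultimately show "outer (A \<inter> E) + outer (A - E) \<le> lam_inner U" by (meson add_right_mono order_trans)
qed

definition haar :: "'g measure" where
  "haar = measure_of G (sets (borel_of mtopology)) outer"

lemma sets_haar: "sets haar = sets (borel_of mtopology)"
  unfolding haar_def using sets.sets_measure_of_eq[of "borel_of mtopology"] by simp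

lemma outer_measure: "measure_space G (sets (borel_of mtopology)) outer"
proof -
  interpret P: sigma_algebra G "Pow G" by (rule sigma_algebra_Pow)
  have "outer {} = 0" using outer_open[of "{}"] lam_inner_le[of "{}"] lam_empty by simp
  then have pos: "positive (Pow G) outer" by (simp add: positive_def)
  have oms: "outer_measure_space (Pow G) outer"
    unfolding outer_measure_space_def increasing_def countably_subadditive_def
    using pos outer_mono outer_countably_subadditive by auto
  define \<Lambda> where "\<Lambda> = lambda_system G (Pow G) outer"
  have ms: "measure_space G \<Lambda> outer" unfolding \<Lambda>_def by (rule P.caratheodory_lemma[OF oms])
  have "E \<in> \<Lambda>" if E: "openin mtopology E" for E
  proof -
    have EG: "E \<subseteq> G" using openin_subset[OF E] by simp
    have "outer A \<le> outer (A \<inter> E) + outer (A - E)" for A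
    proof -
      \<comment> \<open>Binary subadditivity is read off from the countable one by padding with
        \<open>{}\<close>.\<close>
      define B :: "nat \<Rightarrow> 'g set" where "B i = (if i = 0 then A \<inter> E else if i = 1 then A - E else {})" for i
      have "A \<subseteq> B 0 \<union> B 1" by (auto simp: B_def)
      then have "outer A \<le> outer (\<Union>i. B i)" by (intro outer_mono) blast
      also have "\<dots> \<le> (\<Sum>i. outer (B i))" by (rule outer_countably_subadditive)
      also have "\<dots> = (\<Sum>i\<in>{0, 1}. outer (B i))"
        by (rule suminf_finite) (auto simp: B_def \<open>outer {} = 0\<close>)
      finally show ?thesis by (simp add: B_def)
    qed
    then have "outer (A \<inter> E) + outer (A - E) = outer A" for A
      using outer_splits_open[OF E, of A] by (rule antisym[rotated])
    then show ?thesis unfolding \<Lambda>_def P.lambda_system_eq using EG by auto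
  qed
  then have sub: "sets (borel_of mtopology) \<subseteq> \<Lambda>"
    unfolding sets_borel_of topspace_mtopology
    using ms by (intro sigma_algebra.sigma_sets_subset) (auto simp: measure_space_def)
  have "sigma_algebra G (sets (borel_of mtopology))" using sets.sigma_algebra_axioms[of "borel_of mtopology"] by simp
  from measure_down[OF ms this sub] show ?thesis .
qed

lemma emeasure_haar: "A \<in> sets (borel_of mtopology) \<Longrightarrow> emeasure haar A = outer A"
  using outer_measure unfolding haar_def measure_space_def
  by (intro emeasure_measure_of_sigma) auto

lemma emeasure_haar_open: "openin mtopology U \<Longrightarrow> emeasure haar U = lam_inner U"
  by (simp add: emeasure_haar outer_open)

lemma haar_left_invariant:
  assumes "g \<in> G" "A \<in> sets haar" shows "emeasure haar (g <# A) = emeasure haar A"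
proof -
  have AG: "A \<subseteq> G" using sets.sets_into_space[of A "borel_of mtopology"] assms by (simp add: sets_haar)
  have meas: "(\<lambda>h. inv g \<otimes> h) \<in> borel_of mtopology \<rightarrow>\<^sub>M borel_of mtopology"
    using assms by (intro continuous_map_borel_measurable translation_continuous) simp
  then have "g <# A \<in> sets (borel_of mtopology)"
    using measurable_sets[OF meas, of A] assms by (simp add: l_coset_eq_vimage[OF assms(1) AG] sets_haar)
  then show ?thesis using assms AG by (simp add: emeasure_haar sets_haar outer_translate)
qed

theorem left_haar_measure_haar: "left_haar_measure L mtopology haar"
  unfolding left_haar_measure_def
proof (intro conjI allI impI ballI)
  show "sets haar = sets (borel_of mtopology)" by (rule sets_haar)
  have sp: "space haar = G" using sets_eq_imp_space_eq[OF sets_haar] by simp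
  obtain K where "compactin mtopology K" "A0 \<subseteq> K" using A0(3) precompact_def by auto
  then have "lam A0 \<le> lam_inner G"
    using A0(1) compactin_subset_topspace[of mtopology K] by (intro lam_le_inner inner_setsI) auto
  moreover have "emeasure haar G = lam_inner G" using emeasure_haar_open[OF openin_topspace] by simp
  ultimately show "emeasure haar (space haar) \<noteq> 0" using lam_A0 sp by auto
next
  fix K assume K: "compactin mtopology K"
  obtain U C where U: "openin mtopology U" "compactin mtopology C" "K \<subseteq> U" "U \<subseteq> C"
    using compact_in_open_precompact[OF K] by metis
  have "emeasure haar K \<le> emeasure haar U" using U by (intro emeasure_mono) (auto simp: sets_haar)
  also have "\<dots> \<le> lam U" using U(1) by (simp add: emeasure_haar_open lam_inner_le)
  also have "\<dots> < \<infinity>" using lam_finite[of U] U by (auto simp: precompact_def)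
  finally show "emeasure haar K < \<infinity>" .
qed (rule haar_left_invariant)

lemma haar_open_le_lam: "openin mtopology U \<Longrightarrow> emeasure haar U \<le> lam U"
  by (simp add: emeasure_haar_open lam_inner_le)

lemma lam_le_haar_open: "W \<in> inner_sets U \<Longrightarrow> openin mtopology U \<Longrightarrow> lam W \<le> emeasure haar U"
  by (simp add: emeasure_haar_open lam_le_inner)

end

subsection \<open>Uniqueness of Haar measures\<close>

lemma (in Metric_space) separable_imp_second_countable:
  assumes "separable_space mtopology" shows "second_countable mtopology"
proof -
  obtain q :: "nat \<Rightarrow> 'a" where q: "M \<noteq> {} \<Longrightarrow> range q \<subseteq> M"
     "\<And>x \<epsilon>. x \<in> M \<Longrightarrow> \<epsilon> > 0 \<Longrightarrow> \<exists>n. d (q n) x < \<epsilon>"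
    using separable_dense_sequence[OF assms] by metis
  define \<B> where "\<B> = range (\<lambda>(n, b::nat). mball (q n) (1 / Suc b))"
  have "\<exists>V\<in>\<B>. x \<in> V \<and> V \<subseteq> U" if U: "openin mtopology U" "x \<in> U" for U x
  proof -
    have x: "x \<in> M" using openin_subset[OF U(1)] U(2) by auto
    obtain e where e: "e > 0" "mball x e \<subseteq> U" using U openin_mtopology by blast
    obtain b where b: "1 / Suc b < e / 2" using e
      by (metis half_gt_zero_iff nat_approx_posE of_nat_Suc)
    obtain n where n: "d (q n) x < 1 / Suc b" using q(2)[OF x, of "1 / Suc b"] by auto
    have qn: "q n \<in> M" using q(1) x by blast
    have "mball (q n) (1 / Suc b) \<subseteq> mball x e"
    proof
      fix y assume y: "y \<in> mball (q n) (1 / Suc b)"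
      have "d x y \<le> d x (q n) + d (q n) y" using y qn x by (intro triangle) auto
      then show "y \<in> mball x e" using y n b x by (auto simp: commute)
    qed
    moreover have "x \<in> mball (q n) (1 / Suc b)" using n qn x by simp
    moreover have "mball (q n) (1 / Suc b) \<in> \<B>" unfolding \<B>_def by (intro image_eqI[of _ _ "(n, b)"]) auto
    ultimately show ?thesis using e(2) by blast
  qed
  then show ?thesis unfolding second_countable_def \<B>_def by (intro exI[of _ \<B>]) (auto simp: \<B>_def)
qed

text \<open>An open set of the product is a countable union of open rectangles. Thus multiplication
  is measurable for the product \<sigma>-algebra, which Fubini's theorem requires.\<close>

lemma sets_borel_of_prod_topology:
  assumes "second_countable T" "second_countable T'" and U: "openin (prod_topology T T') U"
  shows "U \<in> sets (borel_of T \<Otimes>\<^sub>M borel_of T')"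
proof -
  obtain \<B> where \<B>: "countable \<B>" "\<And>V. V \<in> \<B> \<Longrightarrow> openin T V"
    "\<And>U x. openin T U \<Longrightarrow> x \<in> U \<Longrightarrow> \<exists>V\<in>\<B>. x \<in> V \<and> V \<subseteq> U"
    using assms(1) unfolding second_countable_def by metis
  obtain \<B>' where \<B>': "countable \<B>'" "\<And>V. V \<in> \<B>' \<Longrightarrow> openin T' V"
    "\<And>U x. openin T' U \<Longrightarrow> x \<in> U \<Longrightarrow> \<exists>V\<in>\<B>'. x \<in> V \<and> V \<subseteq> U"
    using assms(2) unfolding second_countable_def by metis
  define \<C> where "\<C> = {(V, V') \<in> \<B> \<times> \<B>'. V \<times> V' \<subseteq> U}"
  have "countable \<C>" unfolding \<C>_def
    by (rule countable_subset[OF _ countable_SIGMA[OF \<B>(1) \<B>'(1)]]) auto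
  moreover have "V \<times> V' \<in> sets (borel_of T \<Otimes>\<^sub>M borel_of T')" if "(V, V') \<in> \<C>" for V V'
    using that \<B>(2) \<B>'(2) unfolding \<C>_def by auto
  ultimately have "(\<Union>(V, V')\<in>\<C>. V \<times> V') \<in> sets (borel_of T \<Otimes>\<^sub>M borel_of T')"
    by (intro sets.countable_UN') auto
  moreover have "(\<Union>(V, V')\<in>\<C>. V \<times> V') = U"
  proof
    show "(\<Union>(V, V')\<in>\<C>. V \<times> V') \<subseteq> U" unfolding \<C>_def by auto
    show "U \<subseteq> (\<Union>(V, V')\<in>\<C>. V \<times> V')"
    proof (rule subrelI)
      fix x y assume xy: "(x, y) \<in> U"
      obtain W W' where W: "openin T W" "openin T' W'" "x \<in> W" "y \<in> W'" "W \<times> W' \<subseteq> U"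
        using U xy unfolding openin_prod_topology_alt by metis
      obtain V where "V \<in> \<B>" "x \<in> V" "V \<subseteq> W" using \<B>(3) W by metis
      moreover obtain V' where "V' \<in> \<B>'" "y \<in> V'" "V' \<subseteq> W'" using \<B>'(3) W by metis
      ultimately have "(V, V') \<in> \<C>" "(x, y) \<in> V \<times> V'" using W(5) unfolding \<C>_def by auto
      then show "(x, y) \<in> (\<Union>(V, V')\<in>\<C>. V \<times> V')" by blast
    qed
  qed
  ultimately show ?thesis by simp
qed

lemma continuous_map_prod_borel_measurable:
  assumes "second_countable T" "second_countable T'" and f: "continuous_map (prod_topology T T') T'' f"
  shows "f \<in> borel_of T \<Otimes>\<^sub>M borel_of T' \<rightarrow>\<^sub>M borel_of T''"
proof (rule measurable_sigma_sets[where \<Omega> = "topspace T''" and A = "{U. openin T'' U}"])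
  have sp: "space (borel_of T \<Otimes>\<^sub>M borel_of T') = topspace (prod_topology T T')"
    by (simp add: space_pair_measure)
  show "f -` U \<inter> space (borel_of T \<Otimes>\<^sub>M borel_of T') \<in> sets (borel_of T \<Otimes>\<^sub>M borel_of T')" if "U \<in> {U. openin T'' U}" for U
  proof -
    have "openin (prod_topology T T') {x \<in> topspace (prod_topology T T'). f x \<in> U}"
      using that by (intro openin_continuous_map_preimage[OF f]) simp
    moreover have "f -` U \<inter> space (borel_of T \<Otimes>\<^sub>M borel_of T') = {x \<in> topspace (prod_topology T T'). f x \<in> U}"
      unfolding sp by blast
    ultimately show ?thesis using sets_borel_of_prod_topology[OF assms(1,2)] by metis
  qed
  show "{U. openin T'' U} \<subseteq> Pow (topspace T'')" using openin_subset by auto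
  show "f \<in> space (borel_of T \<Otimes>\<^sub>M borel_of T') \<rightarrow> topspace T''"
    using f unfolding sp by (simp add: continuous_map_def)
qed (rule sets_borel_of)

context metric_group begin

lemma second_countable: "second_countable mtopology"
  using separable by (rule separable_imp_second_countable)

abbreviation "borel_G \<equiv> borel_of mtopology"

lemma mult_measurable [measurable]: "(\<lambda>(g, h). g \<otimes> h) \<in> borel_G \<Otimes>\<^sub>M borel_G \<rightarrow>\<^sub>M borel_G"
  by (intro continuous_map_prod_borel_measurable second_countable mult_continuous)

lemma inv_measurable [measurable]: "(\<lambda>g. inv g) \<in> borel_G \<rightarrow>\<^sub>M borel_G"
  by (intro continuous_map_borel_measurable inv_continuous)

lemma precompact_open_cover:
  obtains E :: "nat \<Rightarrow> 'g set" where "\<And>i. openin mtopology (E i)" "\<And>i. precompact (E i)" "(\<Union>i. E i) = G"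
proof -
  define \<U> where "\<U> = {U. openin mtopology U \<and> precompact U}"
  have "\<Union>\<U> = topspace mtopology"
  proof
    show "\<Union>\<U> \<subseteq> topspace mtopology" unfolding \<U>_def using openin_subset by blast
    show "topspace mtopology \<subseteq> \<Union>\<U>"
    proof
      fix x assume "x \<in> topspace mtopology"
      then obtain N K where "openin mtopology N" "compactin mtopology K" "x \<in> N" "N \<subseteq> K"
        using compact_basis[OF openin_topspace] by metis
      then show "x \<in> \<Union>\<U>" unfolding \<U>_def precompact_def by blast
    qed
  qed
  then obtain \<V> where \<V>: "countable \<V>" "\<V> \<subseteq> \<U>" "\<Union>\<V> = topspace mtopology"
    using second_countable_imp_Lindelof_space[OF second_countable] unfolding Lindelof_space_def \<U>_def
    by (metis (no_types, lifting) mem_Collect_eq)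
  have "\<V> \<noteq> {}" using \<V>(3) by auto
  then have r: "range (from_nat_into \<V>) = \<V>" using \<V>(1) by (simp add: range_from_nat_into)
  have "from_nat_into \<V> i \<in> \<U>" for i using r \<V>(2) by blast
  then show thesis using \<V>(3) r by (intro that[of "from_nat_into \<V>"]) (auto simp: \<U>_def)
qed

section \<open>Positivity, finiteness and invariance of Haar measures\<close>

lemma left_haar_measureD:
  assumes "left_haar_measure L mtopology \<mu>"
  shows haar_sets: "sets \<mu> = sets borel_G" and haar_space: "space \<mu> = G"
    and haar_space_pos: "emeasure \<mu> G \<noteq> 0"
    and haar_compact: "compactin mtopology K \<Longrightarrow> emeasure \<mu> K < \<infinity>"
    and haar_translate: "g \<in> G \<Longrightarrow> A \<in> sets borel_G \<Longrightarrow> emeasure \<mu> (g <# A) = emeasure \<mu> A"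
proof -
  show s: "sets \<mu> = sets borel_G" using assms by (simp add: left_haar_measure_def)
  show sp: "space \<mu> = G" using sets_eq_imp_space_eq[OF s] by simp
  show "emeasure \<mu> G \<noteq> 0" "compactin mtopology K \<Longrightarrow> emeasure \<mu> K < \<infinity>"
    "g \<in> G \<Longrightarrow> A \<in> sets borel_G \<Longrightarrow> emeasure \<mu> (g <# A) = emeasure \<mu> A"
    using assms s sp unfolding left_haar_measure_def by auto
qed

lemma haar_precompact:
  assumes \<mu>: "left_haar_measure L mtopology \<mu>" and "precompact A" shows "emeasure \<mu> A < \<infinity>"
proof -
  obtain K where K: "compactin mtopology K" "A \<subseteq> K" using assms(2) precompact_def by auto
  have "K \<in> sets \<mu>" unfolding haar_sets[OF \<mu>]
    by (intro borel_of_closed compactin_imp_closedin[OF Hausdorff_space_mtopology] K)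
  then have "emeasure \<mu> A \<le> emeasure \<mu> K" using K(2) by (intro emeasure_mono)
  then show ?thesis using haar_compact[OF \<mu> K(1)] by (rule order_le_less_trans)
qed

text \<open>If \<open>W\<close> were null, so would be every precompact open set, being covered by
  finitely many translates of \<open>W\<close>, and hence the whole group, which is a countable
  union of such sets.\<close>

lemma haar_open_pos:
  assumes \<mu>: "left_haar_measure L mtopology \<mu>" and W: "openin mtopology W" "W \<noteq> {}"
  shows "emeasure \<mu> W \<noteq> 0"
proof
  assume 0: "emeasure \<mu> W = 0"
  obtain E :: "nat \<Rightarrow> 'g set" where E: "\<And>i. openin mtopology (E i)" "\<And>i. precompact (E i)" "(\<Union>i. E i) = G"
    using precompact_open_cover by metis
  have null: "E i \<in> null_sets \<mu>" for i
  proof -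
    obtain F where F: "finite F" "F \<subseteq> G" "E i \<subseteq> (\<Union>g\<in>F. g <# W)"
      using precompact_cover[OF E(2)[of i] W] by (elim exE conjE)
    have "g <# W \<in> null_sets \<mu>" if "g \<in> F" for g
      using that F(2) 0 haar_translate[OF \<mu>, of g W] open_l_coset[of g W] W(1)
      by (auto simp: null_sets_def haar_sets[OF \<mu>])
    then have "(\<Union>g\<in>F. g <# W) \<in> null_sets \<mu>" using F(1) by (intro null_sets_UN') (auto simp: countable_finite)
    then show ?thesis by (rule null_sets_subset[OF _ _ F(3)]) (simp add: haar_sets[OF \<mu>] E(1))
  qed
  have "(\<Union>i. E i) \<in> null_sets \<mu>" by (intro null_sets_UN null)
  then show False using haar_space_pos[OF \<mu>] E(3) by (simp add: null_sets_def)
qed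

lemma haar_sigma_finite:
  assumes \<mu>: "left_haar_measure L mtopology \<mu>" shows "sigma_finite_measure \<mu>"
proof
  obtain E :: "nat \<Rightarrow> 'g set" where E: "\<And>i. openin mtopology (E i)" "\<And>i. precompact (E i)" "(\<Union>i. E i) = G"
    using precompact_open_cover by metis
  show "\<exists>A. countable A \<and> A \<subseteq> sets \<mu> \<and> \<Union>A = space \<mu> \<and> (\<forall>a\<in>A. emeasure \<mu> a \<noteq> \<infinity>)"
    using E haar_precompact[OF \<mu> E(2)]
    by (intro exI[of _ "range E"]) (auto simp: haar_sets[OF \<mu>] haar_space[OF \<mu>] less_top)
qed

lemma haar_nn_integral_translate:
  assumes \<mu>: "left_haar_measure L mtopology \<mu>" and g: "g \<in> G" and f: "f \<in> borel_measurable borel_G"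
  shows "(\<integral>\<^sup>+ x. f (g \<otimes> x) \<partial>\<mu>) = (\<integral>\<^sup>+ x. f x \<partial>\<mu>)"
proof -
  note [measurable_cong] = haar_sets[OF \<mu>]
  have m: "(\<lambda>x. g \<otimes> x) \<in> \<mu> \<rightarrow>\<^sub>M \<mu>"
    using continuous_map_borel_measurable[OF translation_continuous[OF g]] by simp
  have "distr \<mu> \<mu> (\<lambda>x. g \<otimes> x) = \<mu>"
  proof (rule measure_eqI)
    fix A assume "A \<in> sets (distr \<mu> \<mu> (\<lambda>x. g \<otimes> x))"
    then have A: "A \<in> sets borel_G" by (simp add: haar_sets[OF \<mu>])
    then have AG: "A \<subseteq> G" using sets.sets_into_space by fastforce
    have "emeasure (distr \<mu> \<mu> (\<lambda>x. g \<otimes> x)) A = emeasure \<mu> ((\<lambda>x. g \<otimes> x) -` A \<inter> space \<mu>)"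
      using A by (intro emeasure_distr[OF m]) (simp add: haar_sets[OF \<mu>])
    also have "(\<lambda>x. g \<otimes> x) -` A \<inter> space \<mu> = inv g <# A"
      using g AG by (simp add: l_coset_eq_vimage haar_space[OF \<mu>])
    also have "emeasure \<mu> (inv g <# A) = emeasure \<mu> A" using g A by (intro haar_translate[OF \<mu>]) auto
    finally show "emeasure (distr \<mu> \<mu> (\<lambda>x. g \<otimes> x)) A = emeasure \<mu> A" .
  qed simp
  then have "(\<integral>\<^sup>+ x. f x \<partial>\<mu>) = (\<integral>\<^sup>+ x. f x \<partial>distr \<mu> \<mu> (\<lambda>x. g \<otimes> x))" by simp
  also have "\<dots> = (\<integral>\<^sup>+ x. f (g \<otimes> x) \<partial>\<mu>)" using f by (intro nn_integral_distr m) simp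
  finally show ?thesis ..
qed

text \<open>The set is the right translate of \<open>W\<close> by \<open>inv x\<close>, whose
  measure left invariance does not determine. Being open, nonempty and precompact, it makes the
  denominator \<open>D x\<close> in \<open>haar_measure_formula\<close> positive and finite.\<close>

lemma right_translate_open_precompact:
  assumes "openin mtopology W" "precompact W" "W \<noteq> {}" "x \<in> G"
  shows "openin mtopology {z \<in> G. z \<otimes> x \<in> W}" "precompact {z \<in> G. z \<otimes> x \<in> W}" "{z \<in> G. z \<otimes> x \<in> W} \<noteq> {}"
proof -
  have c: "continuous_map mtopology mtopology (\<lambda>z. z \<otimes> y)" if "y \<in> G" for y
  proof -
    have "continuous_map mtopology (prod_topology mtopology mtopology) (\<lambda>h. (h, y))"
      using that by (intro continuous_map_pairedI) auto
    from continuous_map_compose[OF this mult_continuous] show ?thesis by (simp add: o_def)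
  qed
  have WG: "W \<subseteq> G" using openin_subset[OF assms(1)] by simp
  show "openin mtopology {z \<in> G. z \<otimes> x \<in> W}"
    using openin_continuous_map_preimage[OF c[OF assms(4)] assms(1)] by simp
  obtain K where K: "compactin mtopology K" "W \<subseteq> K" using assms(2) precompact_def by auto
  have "z \<in> (\<lambda>z. z \<otimes> inv x) ` K" if "z \<in> G" "z \<otimes> x \<in> W" for z
  proof (rule image_eqI)
    show "z = (z \<otimes> x) \<otimes> inv x" using that assms(4) by (simp add: m_assoc)
  qed (use that K(2) in auto)
  then show "precompact {z \<in> G. z \<otimes> x \<in> W}"
    unfolding precompact_def using assms(4)
    by (intro exI[of _ "(\<lambda>z. z \<otimes> inv x) ` K"] conjI image_compactin[OF K(1) c]) auto
  obtain w where w: "w \<in> W" using assms(3) by auto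
  then have "(w \<otimes> inv x) \<otimes> x = w" using WG assms(4) by (auto simp: m_assoc)
  then show "{z \<in> G. z \<otimes> x \<in> W} \<noteq> {}" using w WG assms(4)
    by (metis (mono_tags, lifting) empty_iff inv_closed m_closed mem_Collect_eq subsetD)
qed

text \<open>With \<open>D x = \<integral> 1\<^sub>W (z x) d\<nu>(z)\<close>, both sides are values of
  \<open>\<integral>\<integral> 1\<^sub>A(x) 1\<^sub>W(y x) / D x d\<nu>(y) d\<mu>(x)\<close>: substitute \<open>x \<mapsto> y\<^sup>-\<^sup>1 x\<close> and then \<open>y \<mapsto> x y\<close>.\<close>

lemma haar_measure_formula:
  assumes \<mu>: "left_haar_measure L mtopology \<mu>" and \<nu>: "left_haar_measure L mtopology \<nu>"
    and W: "openin mtopology W" "precompact W" "W \<noteq> {}" and A: "A \<in> sets borel_G"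
  shows "emeasure \<mu> A = emeasure \<mu> W *
    (\<integral>\<^sup>+ y. indicator A (inv y) / (\<integral>\<^sup>+ z. indicator W (z \<otimes> inv y) \<partial>\<nu>) \<partial>\<nu>)"
proof -
  interpret M: sigma_finite_measure \<mu> by (rule haar_sigma_finite[OF \<mu>])
  interpret N: sigma_finite_measure \<nu> by (rule haar_sigma_finite[OF \<nu>])
  interpret MN: pair_sigma_finite \<mu> \<nu> ..
  note [measurable_cong] = haar_sets[OF \<mu>] haar_sets[OF \<nu>]
  have WB [measurable]: "W \<in> sets borel_G" using W by simp
  note A [measurable]
  define D where "D x = (\<integral>\<^sup>+ z. indicator W (z \<otimes> x) \<partial>\<nu>)" for x
  have D_meas [measurable]: "D \<in> borel_measurable borel_G"
    unfolding D_def by measurable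
  have D: "D x \<noteq> 0 \<and> D x < \<infinity>" if "x \<in> G" for x
  proof -
    note R = right_translate_open_precompact[OF W that]
    have "D x = (\<integral>\<^sup>+ z. indicator {z \<in> G. z \<otimes> x \<in> W} z \<partial>\<nu>)"
      unfolding D_def by (intro nn_integral_cong) (auto simp: haar_space[OF \<nu>] indicator_def)
    also have "\<dots> = emeasure \<nu> {z \<in> G. z \<otimes> x \<in> W}"
      using R(1) by (intro nn_integral_indicator) (simp add: haar_sets[OF \<nu>])
    finally show ?thesis using haar_open_pos[OF \<nu> R(1,3)] haar_precompact[OF \<nu> R(2)] by simp
  qed
  define h :: "'g \<Rightarrow> 'g \<Rightarrow> ennreal" where "h x y = indicator A x * indicator W (y \<otimes> x) / D x" for x y
  have h [measurable]: "case_prod h \<in> borel_measurable (borel_G \<Otimes>\<^sub>M borel_G)" unfolding h_def by measurable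
  have "emeasure \<mu> A = (\<integral>\<^sup>+ x. indicator A x \<partial>\<mu>)" by (simp add: haar_sets[OF \<mu>] A)
  also have "\<dots> = (\<integral>\<^sup>+ x. (\<integral>\<^sup>+ y. h x y \<partial>\<nu>) \<partial>\<mu>)"
  proof (rule nn_integral_cong)
    fix x assume "x \<in> space \<mu>"
    then have x: "x \<in> G" by (simp add: haar_space[OF \<mu>])
    have [measurable]: "(\<lambda>y. y \<otimes> x) \<in> borel_G \<rightarrow>\<^sub>M borel_G"
      using measurable_compose[OF measurable_Pair2'[of x borel_G borel_G] mult_measurable] x by simp
    have "(\<integral>\<^sup>+ y. h x y \<partial>\<nu>) = (\<integral>\<^sup>+ y. (indicator A x / D x) * indicator W (y \<otimes> x) \<partial>\<nu>)"
      unfolding h_def by (simp add: divide_ennreal_def ac_simps)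
    also have "\<dots> = (indicator A x / D x) * D x" unfolding D_def by (intro nn_integral_cmult) simp
    also have "\<dots> = indicator A x" using D[OF x] by (simp add: ennreal_divide_times less_top)
    finally show "indicator A x = (\<integral>\<^sup>+ y. h x y \<partial>\<nu>)" ..
  qed
  also have "\<dots> = (\<integral>\<^sup>+ y. (\<integral>\<^sup>+ x. h x y \<partial>\<mu>) \<partial>\<nu>)" by (rule MN.Fubini'[symmetric]) simp
  also have "\<dots> = (\<integral>\<^sup>+ y. (\<integral>\<^sup>+ x. h (inv y \<otimes> x) y \<partial>\<mu>) \<partial>\<nu>)"
  proof (rule nn_integral_cong)
    fix y assume "y \<in> space \<nu>"
    then have y: "y \<in> G" by (simp add: haar_space[OF \<nu>])
    have "(\<lambda>x. h x y) \<in> borel_measurable borel_G"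
      using measurable_compose[OF measurable_Pair2'[of y borel_G borel_G] h] y by simp
    then show "(\<integral>\<^sup>+ x. h x y \<partial>\<mu>) = (\<integral>\<^sup>+ x. h (inv y \<otimes> x) y \<partial>\<mu>)"
      using haar_nn_integral_translate[OF \<mu>, of "inv y" "\<lambda>x. h x y"] y by simp
  qed
  also have "\<dots> = (\<integral>\<^sup>+ y. (\<integral>\<^sup>+ x. indicator W x * (indicator A (inv y \<otimes> x) / D (inv y \<otimes> x)) \<partial>\<mu>) \<partial>\<nu>)"
    by (intro nn_integral_cong)
      (auto simp: h_def haar_space[OF \<nu>] haar_space[OF \<mu>] m_assoc[symmetric] divide_ennreal_def ac_simps)
  also have "\<dots> = (\<integral>\<^sup>+ x. (\<integral>\<^sup>+ y. indicator W x * (indicator A (inv y \<otimes> x) / D (inv y \<otimes> x)) \<partial>\<nu>) \<partial>\<mu>)"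
    by (rule MN.Fubini') measurable
  also have "\<dots> = (\<integral>\<^sup>+ x. indicator W x * (\<integral>\<^sup>+ y. indicator A (inv y) / D (inv y) \<partial>\<nu>) \<partial>\<mu>)"
  proof (rule nn_integral_cong)
    fix x assume "x \<in> space \<mu>"
    then have x: "x \<in> G" by (simp add: haar_space[OF \<mu>])
    define f where "f y = indicator W x * (indicator A (inv y \<otimes> x) / D (inv y \<otimes> x))" for y
    have [measurable]: "(\<lambda>y. inv y \<otimes> x) \<in> borel_G \<rightarrow>\<^sub>M borel_G"
      using measurable_compose[OF measurable_compose[OF inv_measurable measurable_Pair2'[of x borel_G borel_G]] mult_measurable] x by simp
    have f [measurable]: "f \<in> borel_measurable borel_G" unfolding f_def by measurable
    have "(\<integral>\<^sup>+ y. f y \<partial>\<nu>) = (\<integral>\<^sup>+ y. f (x \<otimes> y) \<partial>\<nu>)"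
      by (rule haar_nn_integral_translate[OF \<nu> x f, symmetric])
    also have "\<dots> = (\<integral>\<^sup>+ y. indicator W x * (indicator A (inv y) / D (inv y)) \<partial>\<nu>)"
    proof (rule nn_integral_cong)
      fix y assume "y \<in> space \<nu>"
      then have y: "y \<in> G" by (simp add: haar_space[OF \<nu>])
      have "inv (x \<otimes> y) \<otimes> x = inv y" using x y by (simp add: inv_mult_group m_assoc)
      then show "f (x \<otimes> y) = indicator W x * (indicator A (inv y) / D (inv y))" by (simp add: f_def)
    qed
    also have "\<dots> = indicator W x * (\<integral>\<^sup>+ y. indicator A (inv y) / D (inv y) \<partial>\<nu>)"
      by (intro nn_integral_cmult) measurable
    finally show "(\<integral>\<^sup>+ y. indicator W x * (indicator A (inv y \<otimes> x) / D (inv y \<otimes> x)) \<partial>\<nu>) =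
      indicator W x * (\<integral>\<^sup>+ y. indicator A (inv y) / D (inv y) \<partial>\<nu>)" by (simp add: f_def)
  qed
  also have "\<dots> = emeasure \<mu> W * (\<integral>\<^sup>+ y. indicator A (inv y) / D (inv y) \<partial>\<nu>)"
    by (subst nn_integral_multc) (simp_all add: haar_sets[OF \<mu>])
  finally show ?thesis unfolding D_def .
qed

lemma ex_open_precompact:
  obtains W where "openin mtopology W" "precompact W" "W \<noteq> {}"
proof -
  have "\<one> \<in> topspace mtopology" by simp
  then obtain N K where "openin mtopology N" "compactin mtopology K" "\<one> \<in> N" "N \<subseteq> K"
    using compact_basis[OF openin_topspace] by metis
  then show thesis by (intro that[of N]) (auto simp: precompact_def)
qed

text \<open>The second factor in \<open>haar_measure_formula\<close> depends on \<nu>,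
  \<open>W\<close> and \<open>A\<close> but not on \<mu>. Using the formula for \<mu> and for \<nu>
  itself with the same \<open>W\<close> eliminates it.\<close>

theorem haar_unique:
  assumes \<mu>: "left_haar_measure L mtopology \<mu>" and \<nu>: "left_haar_measure L mtopology \<nu>"
  obtains c :: ennreal where "c \<noteq> 0" "c < \<infinity>"
    "\<And>A. A \<in> sets borel_G \<Longrightarrow> emeasure \<mu> A = c * emeasure \<nu> A"
proof -
  obtain W where W: "openin mtopology W" "precompact W" "W \<noteq> {}" using ex_open_precompact by metis
  define c where "c = emeasure \<mu> W / emeasure \<nu> W"
  have pos: "emeasure \<mu> W \<noteq> 0" "emeasure \<mu> W < \<infinity>" "emeasure \<nu> W \<noteq> 0" "emeasure \<nu> W < \<infinity>"
    using haar_open_pos[OF _ W(1,3)] haar_precompact[OF _ W(2)] \<mu> \<nu> by auto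
  show thesis
  proof (rule that[of c])
    show "c \<noteq> 0" "c < \<infinity>" using pos by (auto simp: c_def less_top[symmetric] ennreal_divide_eq_top_iff)
    fix A assume A: "A \<in> sets borel_G"
    define C where "C = (\<integral>\<^sup>+ y. indicator A (inv y) / (\<integral>\<^sup>+ z. indicator W (z \<otimes> inv y) \<partial>\<nu>) \<partial>\<nu>)"
    have "c * emeasure \<nu> A = c * (emeasure \<nu> W * C)"
      using haar_measure_formula[OF \<nu> \<nu> W A] by (simp add: C_def)
    also have "\<dots> = (c * emeasure \<nu> W) * C" by (simp add: mult.assoc)
    also have "c * emeasure \<nu> W = emeasure \<mu> W"
      using pos by (simp add: c_def ennreal_divide_times less_top)
    also have "emeasure \<mu> W * C = emeasure \<mu> A"
      using haar_measure_formula[OF \<mu> \<nu> W A] by (simp add: C_def)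
    finally show "emeasure \<mu> A = c * emeasure \<nu> A" ..
  qed
qed

section \<open>Ratios of Haar measures as limits of packing ratios\<close>

text \<open>The filter \<open>F\<close> is left free so that the content can be taken along a
  subsequence chosen beforehand, as in \<open>packing_ratio_bounds\<close>.\<close>

lemma ex_packing_content:
  assumes "openin mtopology A0" "A0 \<noteq> {}" "precompact A0" "F \<le> sequentially" "F \<noteq> bot"
  obtains F' lam where "F' \<le> F" "packing_content L d A0 F' lam"
proof -
  obtain F' lam where F': "F' \<le> F" "F' \<noteq> bot" "\<And>A. ((\<lambda>k. packing k A / packing k A0) \<longlongrightarrow> lam A) F'"
    using ennreal_cluster_point[OF assms(5), of "\<lambda>k A. packing k A / packing k A0"] by metis
  show thesis
    using F' assms by (intro that[of F' lam]) (unfold_locales, auto)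
qed

theorem ex_haar: "\<exists>\<mu>. left_haar_measure L mtopology \<mu>"
proof -
  obtain W where W: "openin mtopology W" "precompact W" "W \<noteq> {}" using ex_open_precompact by metis
  obtain F' lam where "packing_content L d W F' lam"
    using ex_packing_content[OF W(1,3,2) order_refl sequentially_bot] by metis
  then interpret packing_content L d W F' lam .
  show ?thesis using left_haar_measure_haar by blast
qed

text \<open>Along a subsequence on which the ratio tends to its upper limit, take a content
  normalised at \<open>B\<close>. Its value at \<open>A\<close> is that upper limit, and its Haar
  measure is \<open>c\<close> times \<nu>. The measure of an open set is at most its content and at
  least the content of any set compactly contained in it. So \<open>lam B = 1\<close> confines
  \<open>c\<close> between \<open>1 / emeasure \<nu> B'\<close> and
  \<open>1 / emeasure \<nu> B\<close>, and \<open>lam A\<close> is confined in the same way.\<close>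

lemma packing_ratio_bounds:
  assumes \<nu>: "left_haar_measure L mtopology \<nu>"
    and A: "A \<in> inner_sets A'" "openin mtopology A'"
    and B: "B \<in> inner_sets B'" "openin mtopology B'" "B \<noteq> {}" "precompact B'"
  shows "limsup (\<lambda>k. packing k A / packing k B) \<le> emeasure \<nu> A' / emeasure \<nu> B"
    and "emeasure \<nu> A / emeasure \<nu> B' \<le> limsup (\<lambda>k. packing k A / packing k B)"
proof -
  define R where "R k = packing k A / packing k B" for k
  obtain r :: "nat \<Rightarrow> nat" where r: "strict_mono r" "(R \<circ> r) \<longlonglongrightarrow> limsup R" using limsup_subseq_lim by blast
  define F where "F = filtermap r sequentially"
  have oA: "openin mtopology A" and oB: "openin mtopology B" and pB: "precompact B"
    using A(1) B(1) inner_sets_precompact by (auto simp: inner_sets_def)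
  have F: "F \<le> sequentially" "F \<noteq> bot"
    unfolding F_def using filterlim_subseq[OF r(1)] by (auto simp: filterlim_def filtermap_bot_iff)
  have RF: "(R \<longlongrightarrow> limsup R) F" using r(2) by (simp add: F_def filterlim_filtermap o_def)
  obtain F' lam where F': "F' \<le> F" and pc: "packing_content L d B F' lam"
    using ex_packing_content[OF oB B(3) pB F] by metis
  interpret packing_content L d B F' lam by (rule pc)
  have lim: "lam A = limsup R"
    using tendsto_unique[OF F(2) lam[of A] tendsto_mono[OF F' RF, unfolded R_def[abs_def]]]
    by (simp add: R_def[abs_def])
  obtain c where c: "c \<noteq> 0" "c < \<infinity>" "\<And>S. S \<in> sets borel_G \<Longrightarrow> emeasure haar S = c * emeasure \<nu> S"
    using haar_unique[OF left_haar_measure_haar \<nu>] by metis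
  have cU: "emeasure haar U = c * emeasure \<nu> U" if "openin mtopology U" for U using c(3) that by simp
  have "B' \<noteq> {}" using B(1,3) by (auto elim: inner_setsE)
  have pos: "emeasure \<nu> B \<noteq> 0" "emeasure \<nu> B < \<infinity>" "emeasure \<nu> B' \<noteq> 0" "emeasure \<nu> B' < \<infinity>"
    using haar_open_pos[OF \<nu>] haar_precompact[OF \<nu>] oB B pB \<open>B' \<noteq> {}\<close> by auto
  have "c * emeasure \<nu> B \<le> 1" using haar_open_le_lam[OF oB] lam_A0 cU[OF oB] by simp
  then have c1: "c \<le> 1 / emeasure \<nu> B"
    using pos(1,2) divide_right_mono_ennreal[of "c * emeasure \<nu> B" 1 "emeasure \<nu> B"]
    by (simp add: mult_divide_eq_ennreal less_top)
  have "1 \<le> c * emeasure \<nu> B'" using lam_le_haar_open[OF B(1,2)] lam_A0 cU[OF B(2)] by simp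
  then have c2: "1 / emeasure \<nu> B' \<le> c"
    using pos(3,4) divide_right_mono_ennreal[of 1 "c * emeasure \<nu> B'" "emeasure \<nu> B'"]
    by (simp add: mult_divide_eq_ennreal less_top)
  have "lam A \<le> c * emeasure \<nu> A'" using lam_le_haar_open[OF A] cU[OF A(2)] by simp
  also have "\<dots> \<le> 1 / emeasure \<nu> B * emeasure \<nu> A'" by (rule mult_right_mono[OF c1]) simp
  also have "\<dots> = emeasure \<nu> A' / emeasure \<nu> B" by (simp add: divide_ennreal_def mult.commute)
  finally show "limsup (\<lambda>k. packing k A / packing k B) \<le> emeasure \<nu> A' / emeasure \<nu> B"
    using lim by (simp add: R_def[abs_def])
  have "emeasure \<nu> A / emeasure \<nu> B' = 1 / emeasure \<nu> B' * emeasure \<nu> A" by (simp add: divide_ennreal_def mult.commute)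
  also have "\<dots> \<le> c * emeasure \<nu> A" by (rule mult_right_mono[OF c2]) simp
  also have "\<dots> \<le> lam A" using haar_open_le_lam[OF oA] cU[OF oA] by simp
  finally show "emeasure \<nu> A / emeasure \<nu> B' \<le> limsup (\<lambda>k. packing k A / packing k B)"
    using lim by (simp add: R_def[abs_def])
qed

definition superlevel :: "('g \<Rightarrow> real) \<Rightarrow> real \<Rightarrow> 'g set" where
  "superlevel u t = {g \<in> G. t < u g}"

lemma superlevel_open:
  "continuous_map mtopology euclideanreal u \<Longrightarrow> openin mtopology (superlevel u t)"
  using openin_continuous_map_preimage[of mtopology euclideanreal u "{t<..}"] by (simp add: superlevel_def)

text \<open>The closed set where \<open>u\<close> is at least \<open>t\<close>, cut by a compact
  set, fits between the two superlevel sets. Varying the threshold thus produces compactly contained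
  approximations.\<close>

lemma superlevel_inner:
  assumes u: "continuous_map mtopology euclideanreal u" "precompact (superlevel u s)" and "s < t"
  shows "superlevel u t \<in> inner_sets (superlevel u s)"
proof -
  obtain K where K: "compactin mtopology K" "superlevel u s \<subseteq> K" using u(2) precompact_def by auto
  have "closedin mtopology {g \<in> topspace mtopology. u g \<in> {t..}}"
    by (rule closedin_continuous_map_preimage[OF u(1)]) simp
  then have "compactin mtopology (K \<inter> {g \<in> topspace mtopology. u g \<in> {t..}})"
    using K(1) by (rule compact_Int_closedin[rotated])
  then show ?thesis
    using K(2) \<open>s < t\<close> compactin_subset_topspace[OF K(1)]
    by (intro inner_setsI[OF superlevel_open[OF u(1)]]) (auto simp: superlevel_def subset_iff)
qed

lemma emeasure_superlevel_tendsto: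
  assumes \<nu>: "sets \<nu> = sets borel_G" and u: "continuous_map mtopology euclideanreal u"
    and t: "decseq t" "t \<longlonglongrightarrow> 0" "\<And>n::nat. t n > 0"
  shows "(\<lambda>n. emeasure \<nu> (superlevel u (t n))) \<longlonglongrightarrow> emeasure \<nu> (superlevel u 0)"
proof -
  have "(\<lambda>n. emeasure \<nu> (superlevel u (t n))) \<longlonglongrightarrow> emeasure \<nu> (\<Union>n. superlevel u (t n))"
  proof (rule Lim_emeasure_incseq)
    show "range (\<lambda>n. superlevel u (t n)) \<subseteq> sets \<nu>" using superlevel_open[OF u] \<nu> by auto
    show "incseq (\<lambda>n. superlevel u (t n))"
      using t(1) by (force simp: incseq_def decseq_def superlevel_def)
  qed
  moreover have "(\<Union>n. superlevel u (t n)) = superlevel u 0"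
  proof
    show "(\<Union>n. superlevel u (t n)) \<subseteq> superlevel u 0"
      unfolding superlevel_def using t(3) by (auto intro: order.strict_trans)
    show "superlevel u 0 \<subseteq> (\<Union>n. superlevel u (t n))"
    proof
      fix g assume g: "g \<in> superlevel u 0"
      then have "\<forall>\<^sub>F n in sequentially. t n < u g" by (intro order_tendstoD[OF t(2)]) (simp add: superlevel_def)
      then obtain n where "t n < u g" using eventually_happens'[OF sequentially_bot] by blast
      then show "g \<in> (\<Union>n. superlevel u (t n))" using g by (auto simp: superlevel_def)
    qed
  qed
  ultimately show ?thesis by simp
qed

text \<open>The packing ratios themselves are not known to converge, hence the upper limit. For
  fixed \<open>m\<close> the supremum over \<open>n\<close> raises the lower bound to
  \<open>a / b\<close>, while the upper bound \<open>a / bm m\<close> stays; continuity of \<nu>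
  from below closes the gap as \<open>m\<close> grows.\<close>

theorem haar_ratio_limit:
  assumes \<nu>: "left_haar_measure L mtopology \<nu>"
    and u: "continuous_map mtopology euclideanreal u" "precompact (superlevel u 0)"
    and w: "continuous_map mtopology euclideanreal w" "precompact (superlevel w 0)" "e \<in> G" "1 \<le> w e"
  shows "(\<lambda>m. SUP n. limsup (\<lambda>k. packing k (superlevel u (1 / Suc n)) / packing k (superlevel w (1 / Suc (Suc m)))))
    \<longlonglongrightarrow> emeasure \<nu> (superlevel u 0) / emeasure \<nu> (superlevel w 0)"
proof -
  define a b where "a = emeasure \<nu> (superlevel u 0)" and "b = emeasure \<nu> (superlevel w 0)"
  define an bm where "an n = emeasure \<nu> (superlevel u (1 / Suc n))"
    and "bm m = emeasure \<nu> (superlevel w (1 / Suc (Suc m)))" for n m :: nat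
  define R where "R n m = limsup (\<lambda>k. packing k (superlevel u (1 / Suc n)) / packing k (superlevel w (1 / Suc (Suc m))))" for n m
  have lim: "(\<lambda>n. 1 / real (Suc n)) \<longlonglongrightarrow> 0" "decseq (\<lambda>n. 1 / real (Suc n))"
    using LIMSEQ_inverse_real_of_nat by (simp_all add: inverse_eq_divide decseq_def frac_le)
  have an: "an \<longlonglongrightarrow> a" unfolding an_def a_def
    using emeasure_superlevel_tendsto[OF haar_sets[OF \<nu>] u(1) lim(2,1)] by simp
  have bm: "bm \<longlonglongrightarrow> b" unfolding bm_def b_def
    using emeasure_superlevel_tendsto[OF haar_sets[OF \<nu>] w(1), of "\<lambda>m. 1 / real (Suc (Suc m))"]
      LIMSEQ_Suc[OF lim(1)] by (simp add: decseq_def frac_le)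
  \<comment> \<open>\<open>Suc (Suc m)\<close> keeps the threshold at most 1/2, strictly below
    \<open>w e\<close>. With \<open>Suc m\<close> the set for \<open>m = 0\<close> could be
    empty.\<close>
  have "e \<in> superlevel w (1 / Suc (Suc m))" for m
    using w(3,4) order.strict_trans2[of "1 / real (Suc (Suc m))" 1] by (simp add: superlevel_def)
  then have ne: "superlevel w (1 / Suc (Suc m)) \<noteq> {}" for m by blast
  have inn: "superlevel u (1 / Suc n) \<in> inner_sets (superlevel u 0)"
    "superlevel w (1 / Suc (Suc m)) \<in> inner_sets (superlevel w 0)" for n m
    using superlevel_inner u w by auto
  note bounds = packing_ratio_bounds[OF \<nu> inn(1) superlevel_open[OF u(1)] inn(2) superlevel_open[OF w(1)] ne w(2)]
  have up: "R n m \<le> a / bm m" and lo: "an n / b \<le> R n m" for n m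
    using bounds[of n m] unfolding R_def a_def b_def an_def bm_def by auto
  have "e \<in> superlevel w 0" using w(3,4) by (simp add: superlevel_def)
  then have "superlevel w 0 \<noteq> {}" by blast
  then have b: "b \<noteq> 0" "b < \<infinity>" and a: "a < \<infinity>"
    using haar_open_pos[OF \<nu> superlevel_open[OF w(1)]] haar_precompact[OF \<nu>] u w by (auto simp: a_def b_def)
  have "(\<lambda>m. a * inverse (bm m)) \<longlonglongrightarrow> a * inverse b"
  proof (rule ennreal_tendsto_cmult)
    show "(\<lambda>m. inverse (bm m)) \<longlonglongrightarrow> inverse b"
      by (rule continuous_on_tendsto_compose[OF continuous_on_inverse_ennreal[OF continuous_on_id, of UNIV] bm]) auto
  qed (use a in simp)
  then have upper: "(\<lambda>m. a / bm m) \<longlonglongrightarrow> a / b" by (simp add: divide_ennreal_def)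
  have "(\<lambda>n. inverse b * an n) \<longlonglongrightarrow> inverse b * a"
    using b an by (intro ennreal_tendsto_cmult) (auto simp: less_top[symmetric])
  then have an_b: "(\<lambda>n. an n / b) \<longlonglongrightarrow> a / b" by (simp add: divide_ennreal_def mult.commute)
  have "a / b \<le> (SUP n. R n m)" for m
    by (rule LIMSEQ_le_const2[OF an_b]) (meson SUP_upper UNIV_I lo order_trans)
  moreover have "(SUP n. R n m) \<le> a / bm m" for m using up by (intro SUP_least)
  ultimately have "(\<lambda>m. SUP n. R n m) \<longlonglongrightarrow> a / b"
    by (intro tendsto_sandwich[OF _ _ tendsto_const upper]) auto
  then show ?thesis by (simp add: R_def a_def b_def)
qed

end

subsection \<open>Measurable Haar families\<close>

context Metric_space begin

lemma continuous_map_dist: "a \<in> M \<Longrightarrow> continuous_map mtopology euclideanreal (d a)"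
  using continuous_map_mdist[of mtopology "metric (M, d)" "\<lambda>_. a" "\<lambda>x. x"]
  by (simp add: mdist_metric mtopology_of_def mspace_metric)

lemma dense_near:
  assumes "mtopology closure_of range q = M" "x \<in> M" "e > 0"
  obtains n where "q n \<in> M" "d x (q n) < e"
  using assms unfolding metric_closure_of by fastforce

text \<open>In a complete space total boundedness gives a compact closure, and a ball lies in the
  closure of the dense points in it. The test involves only distances within the sequence and
  quantifiers over numbers, so it stays measurable when the space varies.\<close>

lemma precompact_ball_iff:
  fixes q :: "nat \<Rightarrow> 'a"
  assumes "mcomplete" and q: "range q \<subseteq> M" "mtopology closure_of range q = M" and "r > 0"
  shows "(\<exists>K. compactin mtopology K \<and> mball (q n) r \<subseteq> K) \<longleftrightarrow>
    (\<forall>j::nat. \<exists>N. \<forall>m. d (q n) (q m) < r \<longrightarrow> (\<exists>i<N. d (q i) (q m) < 1 / Suc j))"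
proof
  assume "\<exists>K. compactin mtopology K \<and> mball (q n) r \<subseteq> K"
  then obtain K where K: "compactin mtopology K" "mball (q n) r \<subseteq> K" by auto
  show "\<forall>j::nat. \<exists>N. \<forall>m. d (q n) (q m) < r \<longrightarrow> (\<exists>i<N. d (q i) (q m) < 1 / Suc j)"
  proof
    fix j :: nat
    have "K \<subseteq> \<Union> (range (\<lambda>i. mball (q i) (1 / Suc j)))"
    proof
      fix x assume "x \<in> K"
      then have x: "x \<in> M" using compactin_subset_topspace[OF K(1)] by auto
      obtain i where "q i \<in> M" "d x (q i) < 1 / Suc j" using dense_near[OF q(2) x, of "1 / Suc j"] by auto
      then show "x \<in> \<Union> (range (\<lambda>i. mball (q i) (1 / Suc j)))" using x by (auto simp: commute)
    qed
    then obtain \<F> where \<F>: "finite \<F>" "\<F> \<subseteq> range (\<lambda>i. mball (q i) (1 / Suc j))" "K \<subseteq> \<Union>\<F>"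
      using compactinD[OF K(1), of "range (\<lambda>i. mball (q i) (1 / Suc j))"] by auto
    obtain I where I: "finite I" "\<F> = (\<lambda>i. mball (q i) (1 / Suc j)) ` I"
      using finite_subset_image[OF \<F>(1,2)] by auto
    show "\<exists>N. \<forall>m. d (q n) (q m) < r \<longrightarrow> (\<exists>i<N. d (q i) (q m) < 1 / Suc j)"
    proof (rule exI[of _ "Suc (Max I)"], intro allI impI)
      fix m assume "d (q n) (q m) < r"
      then have "q m \<in> K" using K(2) q(1) by (auto simp: image_subset_iff)
      then obtain i where "i \<in> I" "d (q i) (q m) < 1 / Suc j" using \<F>(3) I(2) by auto
      then show "\<exists>i<Suc (Max I). d (q i) (q m) < 1 / Suc j" using Max_ge[OF I(1), of i] by (intro exI[of _ i]) (simp add: less_Suc_eq_le)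
    qed
  qed
next
  assume tb: "\<forall>j::nat. \<exists>N. \<forall>m. d (q n) (q m) < r \<longrightarrow> (\<exists>i<N. d (q i) (q m) < 1 / Suc j)"
  define S where "S = {y. \<exists>m. y = q m \<and> d (q n) (q m) < r}"
  have SM: "S \<subseteq> M" using q(1) by (auto simp: S_def)
  have "mtotally_bounded S" unfolding mtotally_bounded_def
  proof (intro allI impI)
    fix e :: real assume "e > 0"
    then obtain j where j: "1 / Suc j < e / 2"
      by (metis half_gt_zero_iff nat_approx_posE of_nat_Suc)
    obtain N where N: "\<And>m. d (q n) (q m) < r \<Longrightarrow> \<exists>i<N. d (q i) (q m) < 1 / Suc j" using tb by blast
    \<comment> \<open>\<open>mtotally_bounded\<close> wants centres in \<open>S\<close>, so each
      useful \<open>q i\<close> is exchanged for a point of \<open>S\<close> near it. This doubles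
      the radius and explains \<open>e / 2\<close>.\<close>
    define I where "I = {i. i < N \<and> (\<exists>y\<in>S. d (q i) y < 1 / Suc j)}"
    have "\<forall>i\<in>I. \<exists>y. y \<in> S \<and> d (q i) y < 1 / Suc j" by (auto simp: I_def)
    then obtain f where f: "\<And>i. i \<in> I \<Longrightarrow> f i \<in> S \<and> d (q i) (f i) < 1 / Suc j" by metis
    have "S \<subseteq> (\<Union>x\<in>f ` I. mball x e)"
    proof
      fix y assume y: "y \<in> S"
      then obtain i where i: "i < N" "d (q i) y < 1 / Suc j" using N by (auto simp: S_def)
      then have "i \<in> I" using y by (auto simp: I_def)
      have "d (f i) y \<le> d (f i) (q i) + d (q i) y" using f[OF \<open>i \<in> I\<close>] y SM q(1) by (intro triangle) auto
      then have "d (f i) y < e" using f[OF \<open>i \<in> I\<close>] i(2) j by (simp add: commute)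
      then show "y \<in> (\<Union>x\<in>f ` I. mball x e)" using \<open>i \<in> I\<close> f[OF \<open>i \<in> I\<close>] y SM by auto
    qed
    moreover have "finite (f ` I)" by (simp add: I_def)
    ultimately show "\<exists>K. finite K \<and> K \<subseteq> S \<and> S \<subseteq> (\<Union>x\<in>K. mball x e)" using f by (intro exI[of _ "f ` I"]) auto
  qed
  then have "compactin mtopology (mtopology closure_of S)"
    using mtotally_bounded_eq_compact_closure_of[OF assms(1)] by blast
  moreover have "mball (q n) r \<subseteq> mtopology closure_of S"
  proof
    fix y assume y: "y \<in> mball (q n) r"
    have "\<exists>z\<in>S. z \<in> mball y e" if "e > 0" for e
    proof -
      have y': "y \<in> M" "d (q n) y < r" "q n \<in> M" using y by auto
      obtain m where m: "q m \<in> M" "d y (q m) < min e (r - d (q n) y)"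
        using dense_near[OF q(2) y'(1), of "min e (r - d (q n) y)"] y' \<open>e > 0\<close> by auto
      have "d (q n) (q m) \<le> d (q n) y + d y (q m)" using y' m by (intro triangle) auto
      then have "q m \<in> S" using m(2) by (auto simp: S_def)
      then show ?thesis using m y' by (intro bexI[of _ "q m"]) auto
    qed
    then show "y \<in> mtopology closure_of S" using y unfolding metric_closure_of by auto
  qed
  ultimately show "\<exists>K. compactin mtopology K \<and> mball (q n) r \<subseteq> K" by blast
qed

end

context metric_group begin

lemma packing_dense:
  fixes q :: "nat \<Rightarrow> 'g"
  assumes q: "range q \<subseteq> G" "mtopology closure_of range q = G" and A: "openin mtopology A"
  shows "packing k A = (SUP ns. if (\<forall>l<length ns. q (ns ! l) \<in> A) \<and>
      (\<forall>l<length ns. \<forall>l'<length ns. l \<noteq> l' \<longrightarrow> 1 / Suc k < d \<one> (inv (q (ns ! l)) \<otimes> q (ns ! l')))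
    then of_nat (length ns) else 0)" (is "_ = (SUP ns. if ?ok ns then _ else _)")
proof (rule antisym)
  show "packing k A \<le> (SUP ns. if ?ok ns then of_nat (length ns) else 0)"
  proof (rule packing_least)
    fix S assume "S \<in> packings k A"
    then have S: "finite S" "S \<subseteq> A" "\<And>a b. a \<in> S \<Longrightarrow> b \<in> S \<Longrightarrow> a \<noteq> b \<Longrightarrow> 1 / Suc k < d \<one> (inv a \<otimes> b)"
      by (auto simp: packings_def)
    have SG: "S \<subseteq> G" using S(2) openin_subset[OF A] by auto
    obtain xs where xs: "distinct xs" "set xs = S" using finite_distinct_list[OF S(1)] by auto
    have "\<exists>\<sigma>. limitin mtopology (\<lambda>n. q (\<sigma> n)) a sequentially" if a: "a \<in> S" for a
    proof -
      have aG: "a \<in> G" using SG a by auto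
      have "\<exists>i. d a (q i) < 1 / Suc n" for n using dense_near[OF q(2) aG, of "1 / Suc n"] by auto
      then obtain \<sigma> where \<sigma>: "\<And>n. d a (q (\<sigma> n)) < 1 / Suc n" by metis
      have "(\<lambda>n. d (q (\<sigma> n)) a) \<longlonglongrightarrow> 0"
      proof (rule tendsto_sandwich[OF _ _ tendsto_const LIMSEQ_inverse_real_of_nat])
        show "\<forall>\<^sub>F n in sequentially. d (q (\<sigma> n)) a \<le> inverse (real (Suc n))"
          using \<sigma> by (intro always_eventually) (simp add: commute inverse_eq_divide less_imp_le)
      qed simp
      then have "limitin mtopology (\<lambda>n. q (\<sigma> n)) a sequentially"
        unfolding limitin_metric_dist_null using aG q(1) by (simp add: image_subset_iff)
      then show ?thesis by blast
    qed
    then obtain \<sigma> where \<sigma>: "\<And>a. a \<in> S \<Longrightarrow> limitin mtopology (\<lambda>n. q (\<sigma> a n)) a sequentially" by metis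
    have "\<forall>\<^sub>F n in sequentially. \<forall>a\<in>S. q (\<sigma> a n) \<in> A"
      using S(1,2) \<sigma> A by (intro eventually_ball_finite) (auto simp: limitin_def)
    moreover
    have "\<forall>\<^sub>F n in sequentially. \<forall>a\<in>S. \<forall>b\<in>S. a \<noteq> b \<longrightarrow> 1 / Suc k < d \<one> (inv (q (\<sigma> a n)) \<otimes> q (\<sigma> b n))"
    proof (intro eventually_ball_finite[OF S(1)] ballI)
      fix a b assume ab: "a \<in> S" "b \<in> S"
      show "\<forall>\<^sub>F n in sequentially. a \<noteq> b \<longrightarrow> 1 / Suc k < d \<one> (inv (q (\<sigma> a n)) \<otimes> q (\<sigma> b n))"
      proof (cases "a = b")
        case False
        have "limitin (prod_topology mtopology mtopology) (\<lambda>n. (q (\<sigma> a n), q (\<sigma> b n))) (a, b) sequentially"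
          using \<sigma> ab by (simp add: limitin_pairwise o_def)
        from continuous_map_limit[OF quotient_continuous this]
        have "limitin mtopology (\<lambda>n. inv (q (\<sigma> a n)) \<otimes> q (\<sigma> b n)) (inv a \<otimes> b) sequentially"
          by (simp add: o_def)
        from continuous_map_limit[OF continuous_map_dist[OF one_closed] this]
        have "(\<lambda>n. d \<one> (inv (q (\<sigma> a n)) \<otimes> q (\<sigma> b n))) \<longlonglongrightarrow> d \<one> (inv a \<otimes> b)"
          by (simp add: o_def)
        then show ?thesis using S(3)[OF ab False] by (auto dest: order_tendstoD(1))
      qed simp
    qed
    ultimately have "\<forall>\<^sub>F n in sequentially. (\<forall>a\<in>S. q (\<sigma> a n) \<in> A) \<and>
      (\<forall>a\<in>S. \<forall>b\<in>S. a \<noteq> b \<longrightarrow> 1 / Suc k < d \<one> (inv (q (\<sigma> a n)) \<otimes> q (\<sigma> b n)))"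
      by (rule eventually_conj)
    from eventually_happens'[OF sequentially_bot this] obtain n where n: "\<forall>a\<in>S. q (\<sigma> a n) \<in> A"
      "\<forall>a\<in>S. \<forall>b\<in>S. a \<noteq> b \<longrightarrow> 1 / Suc k < d \<one> (inv (q (\<sigma> a n)) \<otimes> q (\<sigma> b n))"
      by (elim exE conjE)
    define ns where "ns = map (\<lambda>a. \<sigma> a n) xs"
    have in_S: "xs ! l \<in> S" if "l < length xs" for l using that xs(2) nth_mem by blast
    have ok: "?ok ns" unfolding ns_def length_map
    proof (intro conjI allI impI)
      fix l l' assume l: "l < length xs" "l' < length xs" "l \<noteq> l'"
      then have "xs ! l \<noteq> xs ! l'" using xs(1) nth_eq_iff_index_eq by blast
      then show "1 / Suc k < d \<one> (inv (q (map (\<lambda>a. \<sigma> a n) xs ! l)) \<otimes> q (map (\<lambda>a. \<sigma> a n) xs ! l'))"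
        using n(2) in_S l by simp
    qed (use n(1) in_S in simp)
    have "card S = length ns" using xs distinct_card by (fastforce simp: ns_def)
    then have "of_nat (card S) = (if ?ok ns then of_nat (length ns) else (0::ennreal))" using ok by simp
    also have "\<dots> \<le> (SUP ns. if ?ok ns then of_nat (length ns) else 0)" by (rule SUP_upper) simp
    finally show "of_nat (card S) \<le> (SUP ns. if ?ok ns then of_nat (length ns) else (0::ennreal))" .
  qed
next
  show "(SUP ns. if ?ok ns then of_nat (length ns) else 0) \<le> packing k A"
  proof (rule SUP_least)
    fix ns :: "nat list"
    show "(if ?ok ns then of_nat (length ns) else 0) \<le> packing k A"
    proof (cases "?ok ns")
      case True
      define S where "S = (\<lambda>l. q (ns ! l)) ` {..<length ns}"
      have "inj_on (\<lambda>l. q (ns ! l)) {..<length ns}"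
      proof (rule inj_onI, rule ccontr)
        fix l l' assume l: "l \<in> {..<length ns}" "l' \<in> {..<length ns}" "q (ns ! l) = q (ns ! l')" "l \<noteq> l'"
        then have "1 / Suc k < d \<one> (inv (q (ns ! l)) \<otimes> q (ns ! l))" using True by auto
        also have "inv (q (ns ! l)) \<otimes> q (ns ! l) = \<one>" using q(1) by (intro l_inv) auto
        finally show False using zero[of \<one> \<one>] divide_pos_pos[of 1 "Suc k"] by (simp add: not_less)
      qed
      then have "card S = length ns" unfolding S_def by (simp add: card_image)
      moreover have "S \<in> packings k A" using True by (auto simp: S_def packings_def)
      ultimately show ?thesis using packing_upper[of S k A] True by simp
    next
      case False
      show ?thesis unfolding if_not_P[OF False] by simp
    qed
  qed
qed

end

section \<open>Packing numbers and Haar ratios along the field\<close>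

locale lc_group_field = borel_field_of_polish_groups X G T V
  for X :: "'x measure" and G :: "'x \<Rightarrow> 'g monoid" and T :: "'x \<Rightarrow> 'g topology"
    and V :: "('x \<times> 'g) measure" +
  fixes d :: "('x \<times> 'g) \<times> ('x \<times> 'g) \<Rightarrow> real" and \<phi> :: "nat \<Rightarrow> 'x \<Rightarrow> 'g"
  assumes locally_compact_fibre: "\<And>x. x \<in> space X \<Longrightarrow> locally_compact_space (T x)"
    and metric_measurable: "d \<in> borel_measurable (fibre_product V)"
    and metric_fibre: "\<And>x. x \<in> space X \<Longrightarrow> Metric_space (topspace (T x)) (\<lambda>v w. d ((x, v), (x, w)))"
    and mcomplete_fibre: "\<And>x. x \<in> space X \<Longrightarrow> Metric_space.mcomplete (topspace (T x)) (\<lambda>v w. d ((x, v), (x, w)))"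
    and mtopology_fibre: "\<And>x. x \<in> space X \<Longrightarrow> Metric_space.mtopology (topspace (T x)) (\<lambda>v w. d ((x, v), (x, w))) = T x"
    and section_measurable: "\<And>n. (\<lambda>x. (x, \<phi> n x)) \<in> X \<rightarrow>\<^sub>M V"
    and section_dense: "\<And>x. x \<in> space X \<Longrightarrow> T x closure_of range (\<lambda>n. \<phi> n x) = topspace (T x)"
begin

abbreviation dist_at :: "'x \<Rightarrow> 'g \<Rightarrow> 'g \<Rightarrow> real" where
  "dist_at x \<equiv> \<lambda>v w. d ((x, v), (x, w))"

lemma carrier_fibre: "x \<in> space X \<Longrightarrow> carrier (G x) = topspace (T x)"
  using topological_group_fibre by (simp add: topological_group_def)

lemma metric_group_fibre:
  assumes "x \<in> space X" shows "metric_group (G x) (dist_at x)"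
proof -
  note tg = topological_group_fibre[OF assms, unfolded topological_group_def]
  have top: "Metric_space.mtopology (carrier (G x)) (dist_at x) = T x"
    using mtopology_fibre[OF assms] carrier_fibre[OF assms] by simp
  have ax: "metric_group_axioms (G x) (dist_at x)"
    unfolding metric_group_axioms_def top
    using tg locally_compact_fibre[OF assms] polish_fibre[OF assms]
    by (intro conjI) (simp_all add: polish_topology_def)
  have "Metric_space (carrier (G x)) (dist_at x)"
    using metric_fibre[OF assms] by (simp only: carrier_fibre[OF assms])
  from metric_group.intro[OF this conjunct1[OF tg] ax] show ?thesis .
qed

lemma mtopology_carrier:
  "x \<in> space X \<Longrightarrow> Metric_space.mtopology (carrier (G x)) (dist_at x) = T x"
  using mtopology_fibre carrier_fibre by simp

lemma section_in_fibre: "x \<in> space X \<Longrightarrow> \<phi> n x \<in> topspace (T x)"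
  using measurable_space[OF section_measurable] space_total by force

lemma range_section: "x \<in> space X \<Longrightarrow> range (\<lambda>n. \<phi> n x) \<subseteq> topspace (T x)"
  using section_in_fibre by auto

lemma measurable_fibre_pair:
  assumes "f \<in> N \<rightarrow>\<^sub>M V" "g \<in> N \<rightarrow>\<^sub>M V" "\<And>x. x \<in> space N \<Longrightarrow> fst (f x) = fst (g x)"
  shows "(\<lambda>x. (f x, g x)) \<in> N \<rightarrow>\<^sub>M fibre_product V"
  unfolding fibre_product_def using assms by (intro measurable_restrict_space2 measurable_Pair) auto

lemma quotient_sections_measurable:
  "(\<lambda>x. (x, inv\<^bsub>G x\<^esub> (\<phi> i x) \<otimes>\<^bsub>G x\<^esub> \<phi> j x)) \<in> X \<rightarrow>\<^sub>M V"
proof -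
  have "(\<lambda>x. (x, inv\<^bsub>G x\<^esub> (\<phi> i x))) \<in> X \<rightarrow>\<^sub>M V"
    using measurable_compose[OF section_measurable inverse_measurable] by simp
  then have "(\<lambda>x. ((x, inv\<^bsub>G x\<^esub> (\<phi> i x)), (x, \<phi> j x))) \<in> X \<rightarrow>\<^sub>M fibre_product V"
    by (intro measurable_fibre_pair section_measurable) auto
  from measurable_compose[OF this mult_measurable] show ?thesis by simp
qed

lemma dist_sections_measurable:
  assumes "(\<lambda>x. (x, a x)) \<in> X \<rightarrow>\<^sub>M V" "(\<lambda>x. (x, b x)) \<in> X \<rightarrow>\<^sub>M V"
  shows "(\<lambda>x. dist_at x (a x) (b x)) \<in> borel_measurable X"
  using measurable_compose[OF measurable_fibre_pair[OF assms] metric_measurable] by simp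

text \<open>In every fibre the sets where \<open>u\<close> exceeds a positive threshold are open and
  compactly contained in the positivity set. Thresholds thus exhaust it from inside in all fibres at
  once, as \<open>haar_ratio_limit\<close> requires.\<close>

definition admissible :: "('x \<times> 'g \<Rightarrow> real) \<Rightarrow> bool" where
  "admissible u \<longleftrightarrow> u \<in> borel_measurable V \<and> (\<forall>x\<in>space X.
     continuous_map (T x) euclideanreal (\<lambda>g. u (x, g)) \<and>
     metric_group.precompact (G x) (dist_at x) (metric_group.superlevel (G x) (\<lambda>g. u (x, g)) 0))"

definition positivity_set :: "('x \<times> 'g \<Rightarrow> real) \<Rightarrow> ('x \<times> 'g) set" where
  "positivity_set u = {v \<in> space V. 0 < u v}"

lemma slice_positivity_set:
  assumes "x \<in> space X"
  shows "Pair x -` positivity_set u = metric_group.superlevel (G x) (\<lambda>g. u (x, g)) 0"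
proof -
  interpret g: metric_group "G x" "dist_at x" by (rule metric_group_fibre[OF assms])
  show ?thesis
    unfolding positivity_set_def g.superlevel_def using assms carrier_fibre[OF assms]
    by (auto simp: space_total)
qed

lemma admissibleD:
  assumes "admissible u"
  shows "u \<in> borel_measurable V"
    and "x \<in> space X \<Longrightarrow> continuous_map (T x) euclideanreal (\<lambda>g. u (x, g))"
    and "x \<in> space X \<Longrightarrow> metric_group.precompact (G x) (dist_at x) (metric_group.superlevel (G x) (\<lambda>g. u (x, g)) 0)"
  using assms by (auto simp: admissible_def)

text \<open>By \<open>packing_dense\<close> the value is a supremum over index lists of conditions
  on finitely many sections, each Borel in the base point.\<close>

lemma packing_superlevel_measurable:
  assumes u: "admissible u"
  shows "(\<lambda>x. metric_group.packing (G x) (dist_at x) k (metric_group.superlevel (G x) (\<lambda>g. u (x, g)) t)) \<in> borel_measurable X"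
proof -
  note [measurable] = measurable_compose[OF section_measurable admissibleD(1)[OF u]]
    dist_sections_measurable[OF unit_measurable quotient_sections_measurable]
  define ok where "ok x ns \<longleftrightarrow> (\<forall>l<length ns. t < u (x, \<phi> (ns ! l) x)) \<and>
    (\<forall>l<length ns. \<forall>l'<length ns. l \<noteq> l' \<longrightarrow>
      1 / Suc k < dist_at x \<one>\<^bsub>G x\<^esub> (inv\<^bsub>G x\<^esub> (\<phi> (ns ! l) x) \<otimes>\<^bsub>G x\<^esub> \<phi> (ns ! l') x))" for x ns
  have [measurable]: "Measurable.pred X (\<lambda>x. ok x ns)" for ns
    unfolding ok_def by measurable
  have "metric_group.packing (G x) (dist_at x) k (metric_group.superlevel (G x) (\<lambda>g. u (x, g)) t) =
      (SUP ns. if ok x ns then of_nat (length ns) else 0)" if x: "x \<in> space X" for x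
  proof -
    interpret g: metric_group "G x" "dist_at x" by (rule metric_group_fibre[OF x])
    have top: "g.mtopology = T x" by (rule mtopology_carrier[OF x])
    have "openin g.mtopology (g.superlevel (\<lambda>g. u (x, g)) t)"
      using admissibleD(2)[OF u x] top by (intro g.superlevel_open) simp
    from g.packing_dense[OF _ _ this, of "\<lambda>n. \<phi> n x" k]
    show ?thesis
      using section_dense[OF x] range_section[OF x] section_in_fibre[OF x] carrier_fibre[OF x]
      unfolding top ok_def by (simp add: g.superlevel_def)
  qed
  moreover have "(\<lambda>x. SUP ns. if ok x ns then of_nat (length ns) else (0::ennreal)) \<in> borel_measurable X"
    by measurable
  ultimately show ?thesis by (simp cong: measurable_cong)
qed

text \<open>The measures \<nu> are arbitrary in each fibre and need not vary measurably, but a ratio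
  does not see the scaling factor; \<open>haar_ratio_limit\<close> expresses it through packing
  numbers.\<close>

lemma haar_ratio_measurable:
  assumes \<nu>: "\<And>x. x \<in> space X \<Longrightarrow> left_haar_measure (G x) (T x) (\<nu> x)"
    and u: "admissible u" and w: "admissible w" "\<And>x. x \<in> space X \<Longrightarrow> \<exists>e\<in>topspace (T x). 1 \<le> w (x, e)"
  shows "(\<lambda>x. emeasure (\<nu> x) (Pair x -` positivity_set u) / emeasure (\<nu> x) (Pair x -` positivity_set w)) \<in> borel_measurable X"
proof (rule borel_measurable_LIMSEQ_order)
  fix m
  note [measurable] = packing_superlevel_measurable[OF u] packing_superlevel_measurable[OF w(1)]
  show "(\<lambda>x. SUP n. limsup (\<lambda>k.
      metric_group.packing (G x) (dist_at x) k (metric_group.superlevel (G x) (\<lambda>g. u (x, g)) (1 / Suc n)) /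
      metric_group.packing (G x) (dist_at x) k (metric_group.superlevel (G x) (\<lambda>g. w (x, g)) (1 / Suc (Suc m)))))
    \<in> borel_measurable X" by measurable
next
  fix x assume x: "x \<in> space X"
  interpret g: metric_group "G x" "dist_at x" by (rule metric_group_fibre[OF x])
  have top: "g.mtopology = T x" by (rule mtopology_carrier[OF x])
  obtain e where e: "e \<in> carrier (G x)" "1 \<le> w (x, e)" using w(2)[OF x] carrier_fibre[OF x] by auto
  show "(\<lambda>m. SUP n. limsup (\<lambda>k.
      g.packing k (g.superlevel (\<lambda>g. u (x, g)) (1 / Suc n)) /
      g.packing k (g.superlevel (\<lambda>g. w (x, g)) (1 / Suc (Suc m)))))
    \<longlonglongrightarrow> emeasure (\<nu> x) (Pair x -` positivity_set u) / emeasure (\<nu> x) (Pair x -` positivity_set w)"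
    unfolding slice_positivity_set[OF x]
    using admissibleD[OF u] admissibleD[OF w(1)] x \<nu>[OF x]
    by (intro g.haar_ratio_limit[of _ _ _ e]) (use e top in auto)
qed

section \<open>Measurable bump functions\<close>

text \<open>The criterion of \<open>Metric_space.precompact_ball_iff\<close> for the ball around
  \<open>\<phi> n x\<close> of radius \<open>1 / Suc b\<close>, written out so that its Borel
  dependence on \<open>x\<close> is visible.\<close>

definition precompact_ball :: "nat \<Rightarrow> 'x \<Rightarrow> bool" where
  "precompact_ball i x = (case prod_decode i of (n, b) \<Rightarrow>
     \<forall>j::nat. \<exists>N. \<forall>m. dist_at x (\<phi> n x) (\<phi> m x) < 1 / Suc b \<longrightarrow>
       (\<exists>i<N. dist_at x (\<phi> i x) (\<phi> m x) < 1 / Suc j))"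

text \<open>A tent of height 1 at \<open>\<phi> n x\<close>, positive exactly on the ball of radius
  \<open>1 / Suc b\<close>. It is switched off in fibres where this ball is not precompact, so that
  it is admissible over the whole base.\<close>

definition bump :: "nat \<Rightarrow> 'x \<times> 'g \<Rightarrow> real" where
  "bump i v = (if precompact_ball i (fst v) then
     case prod_decode i of (n, b) \<Rightarrow> max 0 (1 - Suc b * d ((fst v, \<phi> n (fst v)), v)) else 0)"

lemma precompact_ball_measurable [measurable]: "Measurable.pred X (precompact_ball i)"
proof -
  note [measurable] = dist_sections_measurable[OF section_measurable section_measurable]
  obtain n b where i: "prod_decode i = (n, b)" by fastforce
  show ?thesis unfolding precompact_ball_def i by simp
qed

lemma precompact_ball_iff:
  assumes "x \<in> space X" "prod_decode i = (n, b)"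
  shows "precompact_ball i x \<longleftrightarrow> metric_group.precompact (G x) (dist_at x)
    (Metric_space.mball (carrier (G x)) (dist_at x) (\<phi> n x) (1 / Suc b))"
proof -
  interpret g: metric_group "G x" "dist_at x" by (rule metric_group_fibre[OF assms(1)])
  have "g.mcomplete" using mcomplete_fibre[OF assms(1)] carrier_fibre[OF assms(1)] by simp
  from g.precompact_ball_iff[OF this, of "\<lambda>n. \<phi> n x" "1 / Suc b" n]
  show ?thesis
    using section_dense[OF assms(1)] range_section[OF assms(1)] carrier_fibre[OF assms(1)] mtopology_carrier[OF assms(1)]
    unfolding g.precompact_def precompact_ball_def assms(2) by simp
qed

lemma bump_measurable: "bump i \<in> borel_measurable V"
proof -
  obtain n b where i: "prod_decode i = (n, b)" by fastforce
  have "(\<lambda>v. ((fst v, \<phi> n (fst v)), v)) \<in> V \<rightarrow>\<^sub>M fibre_product V"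
    using measurable_compose[OF proj_measurable section_measurable[of n]]
    by (intro measurable_fibre_pair) auto
  from measurable_compose[OF this metric_measurable]
  have [measurable]: "(\<lambda>v. d ((fst v, \<phi> n (fst v)), v)) \<in> borel_measurable V" .
  have [measurable]: "Measurable.pred V (\<lambda>v. precompact_ball i (fst v))"
    using measurable_compose[OF proj_measurable precompact_ball_measurable] .
  show ?thesis unfolding bump_def i prod.case by measurable
qed

lemma bump_fibre:
  assumes x: "x \<in> space X"
  shows "continuous_map (T x) euclideanreal (\<lambda>g. bump i (x, g))"
    and "metric_group.precompact (G x) (dist_at x) (metric_group.superlevel (G x) (\<lambda>g. bump i (x, g)) 0)"
proof -
  interpret g: metric_group "G x" "dist_at x" by (rule metric_group_fibre[OF x])
  have top: "g.mtopology = T x" by (rule mtopology_carrier[OF x])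
  obtain n b where i: "prod_decode i = (n, b)" by fastforce
  have \<phi>: "\<phi> n x \<in> carrier (G x)" using section_in_fibre[OF x] carrier_fibre[OF x] by simp
  have "continuous_map g.mtopology euclideanreal (\<lambda>g. max 0 (1 - Suc b * dist_at x (\<phi> n x) g))"
    using g.continuous_map_dist[OF \<phi>]
    by (intro continuous_map_real_max continuous_map_diff continuous_map_real_mult_left) auto
  then show "continuous_map (T x) euclideanreal (\<lambda>g. bump i (x, g))"
    unfolding bump_def i top by (cases "precompact_ball i x") simp_all
  show "g.precompact (g.superlevel (\<lambda>g. bump i (x, g)) 0)"
  proof (cases "precompact_ball i x")
    case True
    then have "g.precompact (g.mball (\<phi> n x) (1 / Suc b))" using precompact_ball_iff[OF x i] by simp
    moreover have "g.superlevel (\<lambda>g. bump i (x, g)) 0 \<subseteq> g.mball (\<phi> n x) (1 / Suc b)"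
      using True \<phi> unfolding g.superlevel_def bump_def i by (auto simp: field_simps)
    ultimately show ?thesis unfolding g.precompact_def by blast
  next
    case False
    then have "g.superlevel (\<lambda>g. bump i (x, g)) 0 = {}" unfolding g.superlevel_def bump_def by simp
    then show ?thesis unfolding g.precompact_def by (intro exI[of _ "{}"]) simp
  qed
qed

lemma admissible_bump: "admissible (bump i)"
  unfolding admissible_def using bump_measurable bump_fibre by blast

text \<open>A small ball around a section passing near \<open>g\<close> lies in a compact
  neighbourhood inside \<open>U\<close>; hence it is precompact and its tent is not switched
  off.\<close>

lemma ex_bump:
  assumes x: "x \<in> space X" and U: "openin (T x) U" "g \<in> U"
  obtains i where "precompact_ball i x" "0 < bump i (x, g)" "\<And>h. h \<in> topspace (T x) \<Longrightarrow> 0 < bump i (x, h) \<Longrightarrow> h \<in> U"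
proof -
  interpret g: metric_group "G x" "dist_at x" by (rule metric_group_fibre[OF x])
  have top: "g.mtopology = T x" by (rule mtopology_carrier[OF x])
  obtain N K where N: "openin g.mtopology N" "compactin g.mtopology K" "g \<in> N" "N \<subseteq> K" "K \<subseteq> U"
    using g.compact_basis[of U g] U top by metis
  obtain e where e: "e > 0" "g.mball g e \<subseteq> N" using N g.openin_mtopology by blast
  have gG: "g \<in> carrier (G x)" using openin_subset[OF N(1)] N(3) by auto
  obtain b where b: "1 / Suc b < e / 2" using e by (metis half_gt_zero_iff nat_approx_posE of_nat_Suc)
  obtain n where n: "\<phi> n x \<in> carrier (G x)" "dist_at x g (\<phi> n x) < 1 / Suc b"
    using g.dense_near[of "\<lambda>n. \<phi> n x" g "1 / Suc b"] gG section_dense[OF x] carrier_fibre[OF x] top by auto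
  have sub: "g.mball (\<phi> n x) (1 / Suc b) \<subseteq> N"
  proof
    fix y assume y: "y \<in> g.mball (\<phi> n x) (1 / Suc b)"
    have "dist_at x g y \<le> dist_at x g (\<phi> n x) + dist_at x (\<phi> n x) y" using y n gG by (intro g.triangle) auto
    then have "y \<in> g.mball g e" using y n b gG by auto
    then show "y \<in> N" using e by auto
  qed
  define i where "i = prod_encode (n, b)"
  have i: "prod_decode i = (n, b)" by (simp add: i_def)
  have pb: "precompact_ball i x"
    unfolding precompact_ball_iff[OF x i] g.precompact_def using sub N by blast
  have val: "bump i (x, h) = max 0 (1 - Suc b * dist_at x (\<phi> n x) h)" for h
    using pb by (simp add: bump_def i)
  show thesis
  proof (rule that[OF pb])
    show "0 < bump i (x, g)" using n(2) unfolding val by (simp add: g.commute field_simps)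
    fix h assume h: "h \<in> topspace (T x)" "0 < bump i (x, h)"
    have "real (Suc b) * dist_at x (\<phi> n x) h < 1" using h(2) unfolding val by simp
    then have "dist_at x (\<phi> n x) h < 1 / Suc b" by (simp add: field_simps)
    moreover have "h \<in> carrier (G x)" using h(1) by (simp add: carrier_fibre[OF x])
    ultimately have "h \<in> g.mball (\<phi> n x) (1 / Suc b)" using n(1) by simp
    then have "h \<in> N" using sub by (rule subsetD[rotated])
    then show "h \<in> U" using N(4,5) by blast
  qed
qed

text \<open>Local compactness gives every fibre an index with a precompact ball, and the least such
  index is a Borel function of the base point. The positivity set therefore has positive finite Haar
  measure in all fibres simultaneously and serves to normalise.\<close>

definition unit_bump :: "'x \<times> 'g \<Rightarrow> real" where
  "unit_bump v = bump (LEAST i. precompact_ball i (fst v)) v"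

lemma unit_bump:
  shows "admissible unit_bump"
    and "x \<in> space X \<Longrightarrow> \<exists>e\<in>topspace (T x). 1 \<le> unit_bump (x, e)"
proof -
  have "(\<lambda>v. LEAST i. precompact_ball i (fst v)) \<in> V \<rightarrow>\<^sub>M count_space UNIV"
    using measurable_compose[OF proj_measurable precompact_ball_measurable] by measurable
  then have "unit_bump \<in> borel_measurable V"
    unfolding unit_bump_def[abs_def] by (rule measurable_compose_countable[OF bump_measurable])
  then show "admissible unit_bump"
    unfolding admissible_def unit_bump_def using bump_fibre by simp
  assume x: "x \<in> space X"
  interpret g: metric_group "G x" "dist_at x" by (rule metric_group_fibre[OF x])
  have "\<one>\<^bsub>G x\<^esub> \<in> topspace (T x)" using g.one_closed carrier_fibre[OF x] by simp
  then obtain i where "precompact_ball i x" using ex_bump[OF x openin_topspace] by metis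
  then have pb: "precompact_ball (LEAST i. precompact_ball i x) x" by (rule LeastI)
  obtain n b where i: "prod_decode (LEAST i. precompact_ball i x) = (n, b)" by fastforce
  have "\<phi> n x \<in> carrier (G x)" using section_in_fibre[OF x] carrier_fibre[OF x] by simp
  then have "unit_bump (x, \<phi> n x) = 1" using pb by (simp add: unit_bump_def bump_def i)
  then show "\<exists>e\<in>topspace (T x). 1 \<le> unit_bump (x, e)" using section_in_fibre[OF x] by (intro bexI[of _ "\<phi> n x"]) auto
qed

lemma admissible_min:
  assumes "admissible u" "admissible w" shows "admissible (\<lambda>v. min (u v) (w v))"
  unfolding admissible_def
proof (intro conjI ballI)
  note [measurable] = admissibleD(1)[OF assms(1)] admissibleD(1)[OF assms(2)]
  show "(\<lambda>v. min (u v) (w v)) \<in> borel_measurable V" by measurable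
  fix x assume x: "x \<in> space X"
  interpret g: metric_group "G x" "dist_at x" by (rule metric_group_fibre[OF x])
  show "continuous_map (T x) euclideanreal (\<lambda>g. min (u (x, g)) (w (x, g)))"
    using admissibleD(2)[OF _ x] assms by (intro continuous_map_real_min)
  have "g.superlevel (\<lambda>g. min (u (x, g)) (w (x, g))) 0 \<subseteq> g.superlevel (\<lambda>g. u (x, g)) 0"
    by (auto simp: g.superlevel_def)
  then show "g.precompact (g.superlevel (\<lambda>g. min (u (x, g)) (w (x, g))) 0)"
    using admissibleD(3)[OF assms(1) x] unfolding g.precompact_def by blast
qed

text \<open>Cutting down to the fibres over \<open>B\<close> lets positivity sets distinguish points
  of different fibres.\<close>

lemma admissible_indicator_mult:
  assumes u: "admissible u" and B: "B \<in> sets X"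
  shows "admissible (\<lambda>v. indicator B (fst v) * u v)"
  unfolding admissible_def
proof (intro conjI ballI)
  note [measurable] = admissibleD(1)[OF u] proj_measurable B
  show "(\<lambda>v. indicator B (fst v) * u v) \<in> borel_measurable V" by measurable
  fix x assume x: "x \<in> space X"
  interpret g: metric_group "G x" "dist_at x" by (rule metric_group_fibre[OF x])
  show "continuous_map (T x) euclideanreal (\<lambda>g. indicator B (fst (x, g)) * u (x, g))"
    using admissibleD(2)[OF u x] by (simp add: continuous_map_real_mult_left)
  have "g.superlevel (\<lambda>g. indicator B (fst (x, g)) * u (x, g)) 0 \<subseteq> g.superlevel (\<lambda>g. u (x, g)) 0"
    by (auto simp: g.superlevel_def indicator_def split: if_splits)
  then show "g.precompact (g.superlevel (\<lambda>g. indicator B (fst (x, g)) * u (x, g)) 0)"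
    using admissibleD(3)[OF u x] unfolding g.precompact_def by blast
qed

section \<open>Generation of the Borel structure by positivity sets\<close>

definition positivity_sets :: "('x \<times> 'g) set set" where
  "positivity_sets = positivity_set ` {u. admissible u}"

lemma positivity_set_measurable: "admissible u \<Longrightarrow> positivity_set u \<in> sets V"
  using admissibleD(1)[of u] unfolding positivity_set_def by measurable

lemma positivity_sets_subset: "positivity_sets \<subseteq> sets V"
  using positivity_set_measurable by (auto simp: positivity_sets_def)

lemma Int_stable_positivity_sets: "Int_stable positivity_sets"
proof (rule Int_stableI)
  fix A B assume "A \<in> positivity_sets" "B \<in> positivity_sets"
  then obtain u w where uw: "admissible u" "admissible w" "A = positivity_set u" "B = positivity_set w"
    by (auto simp: positivity_sets_def)
  then have "A \<inter> B = positivity_set (\<lambda>v. min (u v) (w v))" by (auto simp: positivity_set_def)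
  then show "A \<inter> B \<in> positivity_sets" using admissible_min[OF uw(1,2)] by (auto simp: positivity_sets_def)
qed

lemma space_total_UN_bump: "space V = (\<Union>i. positivity_set (bump i))"
proof
  show "(\<Union>i. positivity_set (bump i)) \<subseteq> space V" by (auto simp: positivity_set_def)
  show "space V \<subseteq> (\<Union>i. positivity_set (bump i))"
  proof
    fix v assume v: "v \<in> space V"
    obtain x g where xg: "v = (x, g)" "x \<in> space X" "g \<in> topspace (T x)" using v space_total by auto
    obtain i where "0 < bump i v" using ex_bump[OF xg(2) openin_topspace xg(3)] xg(1) by metis
    then show "v \<in> (\<Union>i. positivity_set (bump i))" using v by (auto simp: positivity_set_def)
  qed
qed

text \<open>The bumps cut down to the sets \<open>B j\<close> are countably many and separate
  points: some \<open>B j\<close> distinguishes two fibres, and within a fibre a bump around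
  \<open>g\<close> can avoid \<open>h\<close>. Blackwell's theorem does the rest.\<close>

lemma sets_total_generated: "sets V = sigma_sets (space V) positivity_sets"
proof
  show "sigma_sets (space V) positivity_sets \<subseteq> sets V"
    using positivity_sets_subset by (rule sets.sigma_sets_subset)
  obtain B :: "nat \<Rightarrow> 'x set" where B: "range B \<subseteq> sets X" "B 0 = space X"
    "\<And>x y. x \<in> space X \<Longrightarrow> y \<in> space X \<Longrightarrow> x \<noteq> y \<Longrightarrow> \<exists>n. x \<in> B n \<and> y \<notin> B n"
    using standard_borel_separating_sequence[OF standard_borel_base] by metis
  define A where "A m = (case prod_decode m of (j, i) \<Rightarrow>
    positivity_set (\<lambda>v. indicator (B j) (fst v) * bump i v))" for m
  have A: "A m \<in> positivity_sets" for m
    using B(1) admissible_indicator_mult[OF admissible_bump]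
    by (auto simp: A_def positivity_sets_def split: prod.splits)
  have AE: "v \<in> A (prod_encode (j, i)) \<longleftrightarrow> v \<in> space V \<and> fst v \<in> B j \<and> 0 < bump i v" for v i j
    by (auto simp: A_def positivity_set_def indicator_def)
  have "sets V = sigma_sets (space V) (range A)"
  proof (rule standard_borel_countably_generated[OF standard_borel_total])
    show "A n \<in> sets V" for n using A positivity_sets_subset by blast
    fix v v' assume v: "v \<in> space V" "v' \<in> space V" "v \<noteq> v'"
    obtain x g y h where xg: "v = (x, g)" "v' = (y, h)" by fastforce
    have x: "x \<in> space X" "g \<in> topspace (T x)" and y: "y \<in> space X" "h \<in> topspace (T y)"
      using v xg space_total by auto
    have "\<exists>j i. v \<in> A (prod_encode (j, i)) \<and> v' \<notin> A (prod_encode (j, i))"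
    proof (cases "x = y")
      case False
      then obtain j where j: "x \<in> B j" "y \<notin> B j" using B(3) x y by metis
      obtain i where "v \<in> positivity_set (bump i)" using v(1) unfolding space_total_UN_bump by blast
      then have "v \<in> A (prod_encode (j, i)) \<and> v' \<notin> A (prod_encode (j, i))"
        using j v(1) xg unfolding AE by (simp add: positivity_set_def)
      then show ?thesis by blast
    next
      case True
      interpret g: metric_group "G x" "dist_at x" by (rule metric_group_fibre[OF x(1)])
      have "openin (T x) (topspace (T x) - {h})"
        using y True t1_space_closedin_singleton[of "T x"]
          Hausdorff_imp_t1_space[OF g.Hausdorff_space_mtopology[unfolded mtopology_carrier[OF x(1)]]]
        by (intro openin_diff openin_topspace) simp
      moreover have "g \<in> topspace (T x) - {h}" using x v(3) xg True by auto
      ultimately obtain i where "0 < bump i (x, g)"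
        "\<And>h'. h' \<in> topspace (T x) \<Longrightarrow> 0 < bump i (x, h') \<Longrightarrow> h' \<in> topspace (T x) - {h}"
        using ex_bump[OF x(1)] by metis
      \<comment> \<open>Index 0 stands for \<open>B 0 = space X\<close>, that is, for the uncut
        bump.\<close>
      then have "v \<in> A (prod_encode (0, i)) \<and> v' \<notin> A (prod_encode (0, i))"
        using v(1) xg x y True B(2) unfolding AE by auto
      then show ?thesis by blast
    qed
    then show "\<exists>n. v \<in> A n \<longleftrightarrow> v' \<notin> A n" by blast
  qed
  also have "\<dots> \<subseteq> sigma_sets (space V) positivity_sets" using A by (intro sigma_sets_mono') auto
  finally show "sets V \<subseteq> sigma_sets (space V) positivity_sets" .
qed

text \<open>It is enough to look at generators, and the slice of a positivity set is open in the
  fibre.\<close>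

lemma slice_measurable:
  assumes x: "x \<in> space X" shows "Pair x \<in> borel_of (T x) \<rightarrow>\<^sub>M V"
proof (rule measurable_sigma_sets[OF sets_total_generated])
  show "positivity_sets \<subseteq> Pow (space V)" by (auto simp: positivity_sets_def positivity_set_def)
  show "Pair x \<in> space (borel_of (T x)) \<rightarrow> space V" using x by (auto simp: space_total)
  fix A assume "A \<in> positivity_sets"
  then obtain u where u: "admissible u" "A = positivity_set u" by (auto simp: positivity_sets_def)
  interpret g: metric_group "G x" "dist_at x" by (rule metric_group_fibre[OF x])
  have top: "g.mtopology = T x" by (rule mtopology_carrier[OF x])
  have o: "openin (T x) (Pair x -` A)"
    using g.superlevel_open[of "\<lambda>g. u (x, g)" 0] admissibleD(2)[OF u(1) x]
    unfolding u(2) slice_positivity_set[OF x] top by simp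
  then have "Pair x -` A \<inter> space (borel_of (T x)) = Pair x -` A" using openin_subset[OF o] by auto
  then show "Pair x -` A \<inter> space (borel_of (T x)) \<in> sets (borel_of (T x))" using o by simp
qed

lemma slice_sets:
  assumes "x \<in> space X" "D \<in> sets V" shows "Pair x -` D \<in> sets (borel_of (T x))"
proof -
  have "Pair x -` D \<subseteq> topspace (T x)" using sets.sets_into_space[OF assms(2)] by (auto simp: space_total)
  then have "Pair x -` D \<inter> space (borel_of (T x)) = Pair x -` D" by auto
  then show ?thesis using measurable_sets[OF slice_measurable[OF assms(1)] assms(2)] by simp
qed

section \<open>From positivity sets to all Borel functions\<close>

lemma haar_slice_finite:
  assumes x: "x \<in> space X" and \<mu>: "left_haar_measure (G x) (T x) M" and u: "admissible u"
  shows "emeasure M (Pair x -` positivity_set u) < \<infinity>"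
proof -
  interpret g: metric_group "G x" "dist_at x" by (rule metric_group_fibre[OF x])
  show ?thesis
    using g.haar_precompact[of M] \<mu> admissibleD(3)[OF u x]
    unfolding slice_positivity_set[OF x] mtopology_carrier[OF x] by blast
qed

lemma haar_slice_pos:
  assumes x: "x \<in> space X" and \<mu>: "left_haar_measure (G x) (T x) M"
    and u: "admissible u" and e: "\<exists>e\<in>topspace (T x). 1 \<le> u (x, e)"
  shows "emeasure M (Pair x -` positivity_set u) \<noteq> 0"
proof -
  interpret g: metric_group "G x" "dist_at x" by (rule metric_group_fibre[OF x])
  obtain e where "e \<in> carrier (G x)" "1 \<le> u (x, e)" using e carrier_fibre[OF x] by auto
  then have "e \<in> g.superlevel (\<lambda>g. u (x, g)) 0" by (auto simp: g.superlevel_def)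
  moreover have "openin g.mtopology (g.superlevel (\<lambda>g. u (x, g)) 0)"
    using admissibleD(2)[OF u x] by (intro g.superlevel_open) (simp add: mtopology_carrier[OF x])
  ultimately show ?thesis
    using g.haar_open_pos[of M] \<mu> unfolding slice_positivity_set[OF x] mtopology_carrier[OF x] by blast
qed

text \<open>The positivity sets are stable under intersection, so a Dynkin argument applies.
  Complements call for subtraction of finite values; therefore all sets are first intersected with
  the positivity set of one bump, and countably many of these cover the total space.\<close>

lemma haar_family_slices_measurable:
  assumes \<mu>: "\<And>x. x \<in> space X \<Longrightarrow> left_haar_measure (G x) (T x) (\<mu> x)"
    and meas: "\<And>u. admissible u \<Longrightarrow> (\<lambda>x. emeasure (\<mu> x) (Pair x -` positivity_set u)) \<in> borel_measurable X"
    and D: "D \<in> sets V"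
  shows "(\<lambda>x. emeasure (\<mu> x) (Pair x -` D)) \<in> borel_measurable X"
proof -
  define E where "E i = positivity_set (bump i)" for i
  have E: "E i \<in> sets V" for i unfolding E_def by (intro positivity_set_measurable admissible_bump)
  have sets_\<mu>: "sets (\<mu> x) = sets (borel_of (T x))" if "x \<in> space X" for x
    using \<mu>[OF that] by (simp add: left_haar_measure_def)
  have slice: "Pair x -` D \<in> sets (\<mu> x)" if "x \<in> space X" "D \<in> sets V" for x D
    using slice_sets[OF that] sets_\<mu>[OF that(1)] by simp
  have bounded: "(\<lambda>x. emeasure (\<mu> x) (Pair x -` (D \<inter> E i))) \<in> borel_measurable X" if "D \<in> sets V" for D i
  proof -
    have sub: "positivity_sets \<subseteq> Pow (space V)" by (auto simp: positivity_sets_def positivity_set_def)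
    have "D \<in> sigma_sets (space V) positivity_sets" using that sets_total_generated by simp
    with Int_stable_positivity_sets sub show ?thesis
    proof (induction rule: sigma_sets_induct_disjoint)
      case (basic A)
      then have "A \<inter> E i \<in> positivity_sets"
        using Int_stable_positivity_sets admissible_bump[of i] unfolding E_def
        by (intro Int_stableD[of positivity_sets]) (auto simp: positivity_sets_def)
      then obtain w where "admissible w" "A \<inter> E i = positivity_set w" by (auto simp: positivity_sets_def)
      then show ?case using meas[of w] by (simp only:)
    next
      case empty
      show ?case by simp
    next
      case (compl A)
      then have A: "A \<in> sets V" using sets_total_generated by simp
      have "emeasure (\<mu> x) (Pair x -` ((space V - A) \<inter> E i)) =
          emeasure (\<mu> x) (Pair x -` E i) - emeasure (\<mu> x) (Pair x -` (A \<inter> E i))" if x: "x \<in> space X" for x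
      proof -
        have "Pair x -` ((space V - A) \<inter> E i) = Pair x -` E i - Pair x -` (A \<inter> E i)"
          using sets.sets_into_space[OF E[of i]] by auto
        moreover have "emeasure (\<mu> x) (Pair x -` (A \<inter> E i)) \<le> emeasure (\<mu> x) (Pair x -` E i)"
          using slice[OF x E] by (intro emeasure_mono) auto
        then have "emeasure (\<mu> x) (Pair x -` (A \<inter> E i)) \<noteq> \<infinity>"
          using haar_slice_finite[OF x \<mu>[OF x] admissible_bump[of i]] by (auto simp: E_def top_unique)
        ultimately show ?thesis
          using slice[OF x E, of i] slice[OF x sets.Int[OF A E], of i] by (simp add: emeasure_Diff vimage_mono)
      qed
      moreover have "(\<lambda>x. emeasure (\<mu> x) (Pair x -` E i) - emeasure (\<mu> x) (Pair x -` (A \<inter> E i))) \<in> borel_measurable X"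
        using compl meas[OF admissible_bump[of i]] by (intro borel_measurable_minus_ennreal) (auto simp: E_def)
      ultimately show ?case by (simp cong: measurable_cong)
    next
      case (union A)
      then have A: "A n \<in> sets V" for n using sets_total_generated by auto
      have "emeasure (\<mu> x) (Pair x -` ((\<Union>n. A n) \<inter> E i)) = (\<Sum>n. emeasure (\<mu> x) (Pair x -` (A n \<inter> E i)))"
        if x: "x \<in> space X" for x
      proof -
        have "(\<Sum>n. emeasure (\<mu> x) (Pair x -` (A n \<inter> E i))) = emeasure (\<mu> x) (\<Union>n. Pair x -` (A n \<inter> E i))"
        proof (rule suminf_emeasure)
          show "range (\<lambda>n. Pair x -` (A n \<inter> E i)) \<subseteq> sets (\<mu> x)"
            using slice[OF x sets.Int[OF A E]] by blast
          show "disjoint_family (\<lambda>n. Pair x -` (A n \<inter> E i))"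
            using union(1) unfolding disjoint_family_on_def by blast
        qed
        also have "(\<Union>n. Pair x -` (A n \<inter> E i)) = Pair x -` ((\<Union>n. A n) \<inter> E i)" by auto
        finally show ?thesis ..
      qed
      moreover have "(\<lambda>x. \<Sum>n. emeasure (\<mu> x) (Pair x -` (A n \<inter> E i))) \<in> borel_measurable X"
        using union by (intro borel_measurable_suminf_order) auto
      ultimately show ?case by (simp cong: measurable_cong)
    qed
  qed
  have DE: "D \<inter> disjointed E i \<in> sets V" for i
    using D sets.range_disjointed_sets[of E V] E by auto
  \<comment> \<open>Intersecting once more with \<open>E i\<close> leaves the set unchanged and
    gives the form treated by \<open>bounded\<close>.\<close>
  have "emeasure (\<mu> x) (Pair x -` D) = (\<Sum>i. emeasure (\<mu> x) (Pair x -` (D \<inter> disjointed E i \<inter> E i)))"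
    if x: "x \<in> space X" for x
  proof -
    have eq: "D \<inter> disjointed E i \<inter> E i = D \<inter> disjointed E i" for i using disjointed_subset[of E i] by auto
    have "(\<Sum>i. emeasure (\<mu> x) (Pair x -` (D \<inter> disjointed E i))) = emeasure (\<mu> x) (\<Union>i. Pair x -` (D \<inter> disjointed E i))"
      using slice[OF x DE] disjoint_family_disjointed[of E]
      by (intro suminf_emeasure) (auto simp: disjoint_family_on_def)
    also have "(\<Union>i. Pair x -` (D \<inter> disjointed E i)) = Pair x -` (D \<inter> (\<Union>i. disjointed E i))" by auto
    also have "D \<inter> (\<Union>i. disjointed E i) = D"
      using sets.sets_into_space[OF D] space_total_UN_bump unfolding UN_disjointed_eq by (auto simp: E_def)
    finally show ?thesis unfolding eq ..
  qed
  moreover have "(\<lambda>x. \<Sum>i. emeasure (\<mu> x) (Pair x -` (D \<inter> disjointed E i \<inter> E i))) \<in> borel_measurable X"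
    using bounded[OF DE] by (intro borel_measurable_suminf_order) auto
  ultimately show ?thesis by (simp cong: measurable_cong)
qed

lemma nn_integral_fibre_measurable:
  fixes F :: "'x \<times> 'g \<Rightarrow> ennreal"
  assumes \<mu>: "\<And>x. x \<in> space X \<Longrightarrow> left_haar_measure (G x) (T x) (\<mu> x)"
    and meas: "\<And>D. D \<in> sets V \<Longrightarrow> (\<lambda>x. emeasure (\<mu> x) (Pair x -` D)) \<in> borel_measurable X"
    and F: "F \<in> borel_measurable V"
  shows "(\<lambda>x. \<integral>\<^sup>+ g. F (x, g) \<partial>\<mu> x) \<in> borel_measurable X"
proof -
  have sets_\<mu>: "sets (\<mu> x) = sets (borel_of (T x))" if "x \<in> space X" for x
    using \<mu>[OF that] by (simp add: left_haar_measure_def)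
  have slice: "(\<lambda>g. f (x, g)) \<in> borel_measurable (\<mu> x)" if "x \<in> space X" "f \<in> borel_measurable V"
    for x and f :: "'x \<times> 'g \<Rightarrow> ennreal"
    using measurable_compose[OF slice_measurable[OF that(1)] that(2)]
    by (simp cong: measurable_cong_sets[OF sets_\<mu>[OF that(1)] refl])
  show ?thesis
    using F
  proof (induction rule: borel_measurable_induct)
    case (cong f g)
    have "(\<integral>\<^sup>+ h. f (x, h) \<partial>\<mu> x) = (\<integral>\<^sup>+ h. g (x, h) \<partial>\<mu> x)" if x: "x \<in> space X" for x
      using cong(3) x sets_eq_imp_space_eq[OF sets_\<mu>[OF x]]
      by (intro nn_integral_cong) (auto simp: space_total)
    with cong show ?case by (simp cong: measurable_cong)
  next
    case (set A)
    have "(\<integral>\<^sup>+ g. indicator A (x, g) \<partial>\<mu> x) = emeasure (\<mu> x) (Pair x -` A)" if x: "x \<in> space X" for x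
    proof -
      have "(\<integral>\<^sup>+ g. indicator A (x, g) \<partial>\<mu> x) = (\<integral>\<^sup>+ g. indicator (Pair x -` A) g \<partial>\<mu> x)"
        by (intro nn_integral_cong) (auto simp: indicator_def)
      then show ?thesis using slice_sets[OF x set] sets_\<mu>[OF x] by simp
    qed
    then show ?case using meas[OF set] by (simp cong: measurable_cong)
  next
    case (mult u c)
    have "(\<integral>\<^sup>+ g. c * u (x, g) \<partial>\<mu> x) = c * (\<integral>\<^sup>+ g. u (x, g) \<partial>\<mu> x)" if x: "x \<in> space X" for x
      using slice[OF x mult(2)] by (rule nn_integral_cmult)
    then show ?case using mult by (simp cong: measurable_cong)
  next
    case (add u v)
    have "(\<integral>\<^sup>+ g. v (x, g) + u (x, g) \<partial>\<mu> x) = (\<integral>\<^sup>+ g. v (x, g) \<partial>\<mu> x) + (\<integral>\<^sup>+ g. u (x, g) \<partial>\<mu> x)" if x: "x \<in> space X" for x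
      using slice[OF x] add by (intro nn_integral_add) auto
    then show ?case using add by (simp cong: measurable_cong)
  next
    case (seq U)
    have "(\<integral>\<^sup>+ g. (SUP i. U i) (x, g) \<partial>\<mu> x) = (SUP i. \<integral>\<^sup>+ g. U i (x, g) \<partial>\<mu> x)" if x: "x \<in> space X" for x
    proof -
      have "(\<integral>\<^sup>+ g. (SUP i. U i (x, g)) \<partial>\<mu> x) = (SUP i. \<integral>\<^sup>+ g. U i (x, g) \<partial>\<mu> x)"
        using slice[OF x] seq by (intro nn_integral_monotone_convergence_SUP) (auto simp: incseq_def le_fun_def)
      then show ?thesis by (simp add: image_comp)
    qed
    then show ?case using seq by (simp cong: measurable_cong)
  qed
qed

section \<open>Existence and uniqueness of the Borel family\<close>

text \<open>Arbitrary Haar measures of the fibres are rescaled to give the positivity set of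
  \<open>unit_bump\<close> measure 1. Their values on positivity sets then are the ratios that
  \<open>haar_ratio_measurable\<close> shows to be Borel.\<close>

theorem ex_borel_haar_family: "\<exists>\<mu>. borel_haar_family X G T V \<mu>"
proof -
  have "\<exists>\<mu>. left_haar_measure (G x) (T x) \<mu>" if x: "x \<in> space X" for x
  proof -
    interpret g: metric_group "G x" "dist_at x" by (rule metric_group_fibre[OF x])
    show ?thesis using g.ex_haar unfolding mtopology_carrier[OF x] .
  qed
  then obtain \<nu> where \<nu>: "\<And>x. x \<in> space X \<Longrightarrow> left_haar_measure (G x) (T x) (\<nu> x)" by metis
  define c where "c x = 1 / emeasure (\<nu> x) (Pair x -` positivity_set unit_bump)" for x
  have c: "c x \<noteq> 0" "c x < \<infinity>" if "x \<in> space X" for x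
    using haar_slice_finite[OF that \<nu>[OF that] unit_bump(1)]
      haar_slice_pos[OF that \<nu>[OF that] unit_bump(1) unit_bump(2)[OF that]]
    by (auto simp: c_def less_top[symmetric] ennreal_divide_eq_top_iff)
  define \<mu> where "\<mu> x = scale_measure (c x) (\<nu> x)" for x
  have \<mu>: "left_haar_measure (G x) (T x) (\<mu> x)" if x: "x \<in> space X" for x
    using \<nu>[OF x] c[OF x] unfolding left_haar_measure_def \<mu>_def
    by (simp add: space_scale_measure ennreal_mult_less_top)
  have "(\<lambda>x. emeasure (\<mu> x) (Pair x -` positivity_set u)) \<in> borel_measurable X" if "admissible u" for u
    using haar_ratio_measurable[OF \<nu> that unit_bump]
    by (simp add: \<mu>_def c_def divide_ennreal_def mult.commute)
  from haar_family_slices_measurable[of \<mu>, OF \<mu> this] nn_integral_fibre_measurable[of \<mu>, OF \<mu>]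
  have "borel_haar_family X G T V \<mu>" unfolding borel_haar_family_def using \<mu> by blast
  then show ?thesis by blast
qed

text \<open>The constant that uniqueness gives in a fibre must be the ratio of the two values at the
  positivity set of \<open>unit_bump\<close>. The Borel condition, applied to the indicator of that
  set, makes both values Borel in the base point.\<close>

theorem borel_haar_family_unique:
  assumes \<mu>: "borel_haar_family X G T V \<mu>" and \<mu>': "borel_haar_family X G T V \<mu>'"
  shows "\<exists>r :: 'x \<Rightarrow> real. r \<in> borel_measurable X \<and> (\<forall>x\<in>space X. 0 < r x) \<and>
    (\<forall>x\<in>space X. \<mu>' x = scale_measure (ennreal (r x)) (\<mu> x))"
proof -
  define m where "m \<kappa> x = emeasure (\<kappa> x) (Pair x -` positivity_set unit_bump)" for \<kappa> :: "'x \<Rightarrow> 'g measure" and x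
  have haar: "left_haar_measure (G x) (T x) (\<kappa> x)" if "borel_haar_family X G T V \<kappa>" "x \<in> space X" for \<kappa> x
    using that by (simp add: borel_haar_family_def)
  have m: "m \<kappa> \<in> borel_measurable X" if \<kappa>: "borel_haar_family X G T V \<kappa>" for \<kappa>
  proof -
    have "(indicator (positivity_set unit_bump) :: 'x \<times> 'g \<Rightarrow> ennreal) \<in> borel_measurable V"
      using positivity_set_measurable[OF unit_bump(1)] by simp
    then have "(\<lambda>x. \<integral>\<^sup>+ g. indicator (positivity_set unit_bump) (x, g) \<partial>\<kappa> x) \<in> borel_measurable X"
      using \<kappa> unfolding borel_haar_family_def by blast
    moreover have "(\<integral>\<^sup>+ g. indicator (positivity_set unit_bump) (x, g) \<partial>\<kappa> x) = m \<kappa> x" if x: "x \<in> space X" for x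
    proof -
      have "(\<integral>\<^sup>+ g. indicator (positivity_set unit_bump) (x, g) \<partial>\<kappa> x) =
          (\<integral>\<^sup>+ g. indicator (Pair x -` positivity_set unit_bump) g \<partial>\<kappa> x)"
        by (intro nn_integral_cong) (auto simp: indicator_def)
      then show ?thesis
        using slice_sets[OF x positivity_set_measurable[OF unit_bump(1)]] haar[OF \<kappa> x]
        by (simp add: m_def left_haar_measure_def)
    qed
    ultimately show ?thesis by (simp cong: measurable_cong)
  qed
  \<comment> \<open>Over \<open>space X\<close> the quotient is the finite positive constant of the
    fibre, so \<open>enn2real\<close> loses nothing there.\<close>
  define r where "r x = enn2real (m \<mu>' x / m \<mu> x)" for x
  have "0 < r x \<and> \<mu>' x = scale_measure (ennreal (r x)) (\<mu> x)" if x: "x \<in> space X" for x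
  proof -
    interpret g: metric_group "G x" "dist_at x" by (rule metric_group_fibre[OF x])
    have top: "g.mtopology = T x" by (rule mtopology_carrier[OF x])
    note h = haar[OF \<mu> x] and h' = haar[OF \<mu>' x]
    obtain c where c: "c \<noteq> 0" "c < \<infinity>" "\<And>A. A \<in> sets (borel_of (T x)) \<Longrightarrow> emeasure (\<mu>' x) A = c * emeasure (\<mu> x) A"
      using g.haar_unique[of "\<mu>' x" "\<mu> x"] h h' unfolding top by metis
    have "m \<mu>' x = c * m \<mu> x"
      unfolding m_def by (intro c(3) slice_sets[OF x] positivity_set_measurable unit_bump)
    moreover have "m \<mu> x \<noteq> 0" "m \<mu> x < \<infinity>"
      using haar_slice_finite[OF x h unit_bump(1)] haar_slice_pos[OF x h unit_bump(1) unit_bump(2)[OF x]]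
      by (auto simp: m_def)
    ultimately have "m \<mu>' x / m \<mu> x = c" by (simp add: mult_divide_eq_ennreal less_top)
    then have r: "ennreal (r x) = c" "0 < r x"
      using c(1,2) by (auto simp: r_def enn2real_positive_iff zero_less_iff_neq_zero)
    have "\<mu>' x = scale_measure (ennreal (r x)) (\<mu> x)"
      using h h' c(3) by (intro measure_eqI) (auto simp: r left_haar_measure_def)
    with r show ?thesis by simp
  qed
  moreover have "r \<in> borel_measurable X"
    unfolding r_def[abs_def] using m[OF \<mu>] m[OF \<mu>'] by measurable
  ultimately show ?thesis by blast
qed

end

theorem proposition10p2:
  fixes X :: "'x measure" and G :: "'x \<Rightarrow> 'g monoid" and T :: "'x \<Rightarrow> 'g topology"
    and V :: "('x \<times> 'g) measure"
  assumes "borel_field_of_polish_groups X G T V"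
    and "\<And>x. x \<in> space X \<Longrightarrow> locally_compact_space (T x)"
  shows "(\<exists>\<mu>. borel_haar_family X G T V \<mu>) \<and>
    (\<forall>\<mu> \<mu>'. borel_haar_family X G T V \<mu> \<longrightarrow> borel_haar_family X G T V \<mu>' \<longrightarrow>
       (\<exists>r :: 'x \<Rightarrow> real. r \<in> borel_measurable X \<and> (\<forall>x\<in>space X. 0 < r x) \<and>
          (\<forall>x\<in>space X. \<mu>' x = scale_measure (ennreal (r x)) (\<mu> x))))"
proof -
  interpret borel_field_of_polish_groups X G T V by fact
  obtain d :: "('x \<times> 'g) \<times> ('x \<times> 'g) \<Rightarrow> real" where d: "d \<in> borel_measurable (fibre_product V)"
    "\<And>x. x \<in> space X \<Longrightarrow> Metric_space (topspace (T x)) (\<lambda>v w. d ((x, v), (x, w))) \<and>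
       Metric_space.mcomplete (topspace (T x)) (\<lambda>v w. d ((x, v), (x, w))) \<and>
       Metric_space.mtopology (topspace (T x)) (\<lambda>v w. d ((x, v), (x, w))) = T x"
    using ex_borel_metric unfolding Let_def by blast
  obtain \<phi> :: "nat \<Rightarrow> 'x \<Rightarrow> 'g" where "\<And>n. (\<lambda>x. (x, \<phi> n x)) \<in> X \<rightarrow>\<^sub>M V"
    "\<And>x. x \<in> space X \<Longrightarrow> T x closure_of range (\<lambda>n. \<phi> n x) = topspace (T x)"
    using ex_dense_sections by blast
  then interpret lc_group_field X G T V d \<phi>
    using d assms(2) borel_field_of_polish_groups_axioms
    by (intro lc_group_field.intro lc_group_field_axioms.intro) simp_all
  show ?thesis using ex_borel_haar_family borel_haar_family_unique by blast
qed

end
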